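(* Let $n\in\mathbb{N}$, $n\ge1$, let $\beta,\gamma\in(0,1)$ and denote by $p(t,x,y)$, $t>0$, $x,y\in\mathbb{R}^n$, the fundamental solution to the space-time fractional heat equation $$\frac{\partial^\beta u}{\partial t^\beta}=-(-\Delta_x)^\gamma u\quad\text{on }(0,\infty)\times\mathbb{R}^n.$$ (a) As $|x-y|^{-2\gamma/\beta}t\to\infty$, $$p(t,x,y)\sim\begin{cases}\displaystyle\frac{\Gamma\left(\frac{1}{2\gamma}\right)\Gamma\left(1-\frac{1}{2\gamma}\right)}{2\pi\gamma\,\Gamma\left(1-\frac{\beta}{2\gamma}\right)}\,t^{-\beta/(2\gamma)},&\text{if } n=1\text{ and }\gamma\in(\tfrac12,1),\\[14pt]\displaystyle\frac{\beta}{\pi\Gamma(1-\beta)}\,t^{-\beta}\log\left[|x-y|^{-1/\beta}t\right],&\text{if } n=1\text{ and }\gamma=\tfrac12,\\[14pt]\displaystyle\frac{2\gamma\,\Gamma\left(\frac{n-2\gamma}{2}\right)}{2^{1+2\gamma}\pi^{n/2}\Gamma(1-\beta)\Gamma(1+\gamma)}\,|x-y|^{2\gamma-n}t^{-\beta},&\text{if } n>2\gamma\text{ and }\gamma\in(0,1).\end{cases}$$ (b) As $|x-y|^{-2\gamma/\beta}t\to0$, $$p(t,x,y)\sim\frac{\gamma4^\gamma\,\Gamma\left(\frac n2+\gamma\right)}{\pi^{n/2}\Gamma(1-\gamma)\,\beta\Gamma(\beta)}\,|x-y|^{-n-2\gamma}t^\beta.$$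
   Context: The Caputo derivative of order $\beta\in(0,1)$ is $\frac{\partial^\beta f(t)}{\partial t^\beta}=\frac{1}{\Gamma(1-\beta)}\frac{\mathrm{d}}{\mathrm{d}t}\int_0^t\frac{f(s)-f(0)}{(t-s)^\beta}\,\mathrm{d}s$. The fractional Laplacian of order $\gamma\in(0,1)$ on $\mathbb{R}^n$ is $$-(-\Delta_x)^\gamma u(x)=\frac{\gamma4^\gamma\Gamma\left(\gamma+\frac n2\right)}{\pi^{n/2}\Gamma(1-\gamma)}\lim_{\epsilon\downarrow0}\int_{|y|>\epsilon}\frac{u(x+y)-u(x)}{|y|^{n+2\gamma}}\,\mathrm{d}y$$ (Fourier multiplier $-|\xi|^{2\gamma}$). The fundamental solution of the equation is given by $$p(t,x,y)=\int_0^\infty p_{2\gamma}(s,x,y)\,\mathrm{d}_s\mathbb{P}(S_t^{-1}\le s),$$ where $p_{2\gamma}(t,x,y)$ is the transition density of the rotationally symmetric $2\gamma$-stable Lévy process in $\mathbb{R}^n$ with characteristic function $\mathbb{E}\,e^{\mathrm{i}\xi\cdot X_t}=e^{-t|\xi|^{2\gamma}}$, $S=(S_t)_{t\ge0}$ is an independent $\beta$-stable subordinator (non-decreasing Lévy process with $\mathbb{E}\,e^{-rS_t}=e^{-tr^\beta}$, $r>0$), $S_t^{-1}=\inf\{s\ge0:S_s>t\}$ is its inverse, and $\mathrm{d}_s\mathbb{P}(S_t^{-1}\le s)$ denotes integration with respect to the law of $S_t^{-1}$. Asymptotics: "$f(t,x,y)\sim g(t,x,y)$ as $A(t,x,y)\to\ell$"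 means that the ratio $f/g$ tends to $1$ as the quantity $A(t,x,y)$, with $t>0$ and $x,y\in\mathbb{R}^n$, $x\neq y$, tends to $\ell$ (so the convergence depends on $(t,x,y)$ only through $A$). *)

theory Defs
  imports "HOL-Probability.Probability" "HOL-Library.Landau_Symbols"
begin

definition cadlag :: "(real \<Rightarrow> 'a::topological_space) \<Rightarrow> bool" where
  "cadlag f \<longleftrightarrow>
     (\<forall>t\<ge>0. (f \<longlongrightarrow> f t) (at_right t)) \<and>
     (\<forall>t>0. \<exists>l. (f \<longlongrightarrow> l) (at_left t))"

text \<open>
  Processes are functions on all of \<^typ>\<open>real\<close>, but only the times \<open>t \<ge> 0\<close> matter. Paths are
  cadlag for every \<open>\<omega>\<close>, not just almost surely; this makes first passage times measurable
  without completing \<open>M\<close>. Stochastic continuity is not listed, because it follows from right-continuity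
  and stationarity of the increments.
\<close>

definition levy_process :: "'w measure \<Rightarrow> (real \<Rightarrow> 'w \<Rightarrow> 'a::euclidean_space) \<Rightarrow> bool" where
  "levy_process M X \<longleftrightarrow>
     (\<forall>t\<ge>0. X t \<in> borel_measurable M) \<and>
     (AE \<omega> in M. X 0 \<omega> = 0) \<and>
     (\<forall>(k::nat) \<tau>. 0 \<le> \<tau> 0 \<and> (\<forall>i<k. \<tau> i \<le> \<tau> (Suc i)) \<longrightarrow>
        prob_space.indep_vars M (\<lambda>_. borel)
          (\<lambda>i \<omega>. X (\<tau> (Suc i)) \<omega> - X (\<tau> i) \<omega>) {..<k}) \<and>
     (\<forall>s\<ge>0. \<forall>h\<ge>0.
        distr M borel (\<lambda>\<omega>. X (s + h) \<omega> - X s \<omega>) = distr M borel (X h)) \<and>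
     (\<forall>\<omega>\<in>space M. cadlag (\<lambda>t. X t \<omega>))"

definition symmetric_stable_process ::
    "'w measure \<Rightarrow> real \<Rightarrow> (real \<Rightarrow> 'w \<Rightarrow> 'a::euclidean_space) \<Rightarrow> bool" where
  "symmetric_stable_process M \<alpha> X \<longleftrightarrow>
     levy_process M X \<and>
     (\<forall>t\<ge>0. \<forall>\<xi>. (CLINT \<omega>|M. iexp (\<xi> \<bullet> X t \<omega>))
        = complex_of_real (exp (- t * norm \<xi> powr \<alpha>)))"

definition stable_subordinator :: "'w measure \<Rightarrow> real \<Rightarrow> (real \<Rightarrow> 'w \<Rightarrow> real) \<Rightarrow> bool" where
  "stable_subordinator M \<beta> S \<longleftrightarrow>
     levy_process M S \<and>
     (\<forall>\<omega>\<in>space M. mono_on {0..} (\<lambda>t. S t \<omega>)) \<and>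
     (\<forall>t\<ge>0. \<forall>r>0. (LINT \<omega>|M. exp (- r * S t \<omega>)) = exp (- t * r powr \<beta>))"

definition independent_processes ::
    "'w measure \<Rightarrow> (real \<Rightarrow> 'w \<Rightarrow> 'a::euclidean_space) \<Rightarrow> (real \<Rightarrow> 'w \<Rightarrow> 'b::euclidean_space) \<Rightarrow> bool" where
  "independent_processes M X Y \<longleftrightarrow>
     prob_space.indep_set M
       (sets (vimage_algebra (space M) (\<lambda>\<omega>. \<lambda>t\<in>{0..}. X t \<omega>) (PiM {0..} (\<lambda>_. borel))))
       (sets (vimage_algebra (space M) (\<lambda>\<omega>. \<lambda>t\<in>{0..}. Y t \<omega>) (PiM {0..} (\<lambda>_. borel))))"

text \<open>
  By translation invariance, a Levy process started at \<open>x\<close> is \<open>x + X\<close>. Continuity in \<open>y\<close> selects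
  the pointwise version of the density, which is otherwise determined only almost everywhere.
\<close>

definition transition_density ::
    "'w measure \<Rightarrow> (real \<Rightarrow> 'w \<Rightarrow> 'a::euclidean_space) \<Rightarrow> (real \<Rightarrow> 'a \<Rightarrow> 'a \<Rightarrow> real) \<Rightarrow> bool" where
  "transition_density M X q \<longleftrightarrow>
     (\<forall>t>0. \<forall>x.
        (\<forall>y. 0 \<le> q t x y) \<and>
        continuous_on UNIV (q t x) \<and>
        distributed M lborel (\<lambda>\<omega>. x + X t \<omega>) (\<lambda>y. ennreal (q t x y)))"

text \<open>
  For a \<open>\<beta>\<close>-stable subordinator the set below is nonempty almost surely, so the value of
  \<^term>\<open>Inf {}\<close> plays no role.
\<close>

definition inverse_subordinator :: "(real \<Rightarrow> 'w \<Rightarrow> real) \<Rightarrow> real \<Rightarrow> 'w \<Rightarrow> real" where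
  "inverse_subordinator S t \<omega> = Inf {s. 0 \<le> s \<and> S s \<omega> > t}"

text \<open>
  With \<open>q\<close> the transition density of the symmetric \<open>2\<gamma>\<close>-stable process and \<open>S\<close> an independent
  \<open>\<beta>\<close>-stable subordinator, this is the fundamental solution of the equation
  \<open>\<partial>\<^sup>\<beta>u/\<partial>t\<^sup>\<beta> = -(-\<Delta>)\<^sup>\<gamma>u\<close> with Caputo time derivative.
\<close>

definition fundamental_solution ::
    "'w measure \<Rightarrow> (real \<Rightarrow> 'w \<Rightarrow> real) \<Rightarrow> (real \<Rightarrow> 'a::euclidean_space \<Rightarrow> 'a \<Rightarrow> real)
      \<Rightarrow> real \<Rightarrow> 'a \<Rightarrow> 'a \<Rightarrow> real" where
  "fundamental_solution M S q t x y =
     (LINT s:{0<..}|distr M borel (inverse_subordinator S t). q s x y)"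

text \<open>
  The filter of all \<open>(t, x, y)\<close> with \<open>t > 0\<close>, \<open>x \<noteq> y\<close> along which \<open>A (t, x, y)\<close> tends to a limit:
  it constrains \<open>(t, x, y)\<close> only through \<open>A\<close>, hence limits along it are uniform in
  \<open>(t, x, y)\<close> for a given size of \<open>A\<close>.
\<close>

definition along :: "(real \<times> 'a \<times> 'a \<Rightarrow> real) \<Rightarrow> real filter \<Rightarrow> (real \<times> 'a \<times> 'a) filter" where
  "along A F = inf (filtercomap A F) (principal {(t, x, y). 0 < t \<and> x \<noteq> y})"

end

theory Submission
  imports Defs "HOL-Real_Asymp.Real_Asymp"
begin

text \<open>
  Writing \<open>\<Theta>\<close> for a one-sided \<open>\<gamma>\<close>-stable variable, the symmetric stable density is a Gaussian mixture,
  because \<open>exp (- s |\<xi>|\<^sup>2\<^sup>\<gamma>) = E exp (- s\<^sup>1\<^sup>/\<^sup>\<gamma> |\<xi>|\<^sup>2 \<Theta>)\<close>. By self-similarity the inverse subordinator at time \<open>t\<close> is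
  distributed as \<open>(t / S\<^sub>1)\<^sup>\<beta>\<close>. With \<open>r = |x - y|\<close>, \<open>A = r powr (- 2\<gamma>/\<beta>) * t\<close>, \<open>k(u) = u\<^sup>n\<^sup>/\<^sup>2 exp (- u)\<close> and
  \<open>T = S\<^sub>1\<^sup>\<beta>\<^sup>/\<^sup>\<gamma> / (4 \<Theta>)\<close> for independent \<open>S\<^sub>1\<close>, \<open>\<Theta>\<close>, this gives
  \<open>p t x y = r\<^sup>-\<^sup>n \<pi>\<^sup>-\<^sup>n\<^sup>/\<^sup>2 E k (A\<^sup>-\<^sup>\<beta>\<^sup>/\<^sup>\<gamma> T)\<close>. A Tauberian argument shows \<open>x\<^sup>\<beta> P(S\<^sub>1 > x) \<rightarrow> 1 / \<Gamma>(1 - \<beta>)\<close>, and likewise for \<open>\<Theta>\<close>,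
  so both tails of \<open>T\<close> are regularly varying with index \<open>\<gamma>\<close>. Since
  \<open>E k (\<epsilon> T) = \<integral> k'(u) P(\<epsilon> T > u) du\<close>, the regime as \<open>\<epsilon> \<rightarrow> 0\<close> is decided by comparing \<open>n/2\<close> with \<open>\<gamma>\<close>, and the one
  as \<open>\<epsilon> \<rightarrow> \<infinity>\<close> by the lower tail of \<open>T\<close>.
\<close>

section \<open>Gamma-type integrals\<close>

text \<open>The data are a characteristic function and a Laplace transform, and stable densities
  have no usable closed form; everything is therefore reduced to distribution functions of two
  positive variables. \<Theta> is not among the data: its law is constructed, and it lives on its
  own factor of a product measure beside the law of \<open>S 1\<close>. If \<open>P(T > u)\<close>
  is like c u^(-\<gamma>), the scaled expectation tends to c times the integral of k'(u)
  u^(-\<gamma>), that is c \<gamma> \<Gamma>(n/2 - \<gamma>), which requires n/2 > \<gamma>. For n/2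
  = \<gamma> the divergent integral of 1/u is cut off at u of order \<epsilon>, whence the
  logarithm; for n/2 < \<gamma> the moment of T of order n/2 is finite and is itself the limit. As
  \<epsilon> grows the exponent changes sign, and \<Gamma>(n/2 + \<gamma>) is always finite, so (b)
  has a single case. The factors 1/(\<beta> \<Gamma>(\<beta>)) and 1/(\<gamma> \<Gamma>(\<gamma>))
  are the moments of \<open>S 1\<close> of order -\<beta> and of \<Theta> of order -\<gamma>: the
  tail of a ratio is the tail of its heavy component times a moment of the other one.\<close>

lemma nn_integral_exp_greaterThan:
  "(\<integral>\<^sup>+u. ennreal (exp (- u)) * indicator {y<..} u \<partial>lborel) = ennreal (exp (- y :: real))"
proof -
  have "(\<integral>\<^sup>+u. ennreal (exp (- u)) * indicator {y<..} u \<partial>lborel)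
      = (\<integral>\<^sup>+u. ennreal (exp (- u)) * indicator {y..} u \<partial>lborel)"
    by (intro nn_integral_cong_AE, use AE_lborel_singleton[of y] in eventually_elim)
       (auto simp: indicator_def)
  also have "\<dots> = ennreal (0 - (- exp (- y)))"
  proof (rule nn_integral_FTC_atLeast)
    show "((\<lambda>u::real. - exp (- u)) \<longlongrightarrow> 0) at_top"
      by real_asymp
  qed (auto intro!: derivative_eq_intros)
  finally show ?thesis by simp
qed

lemma nn_integral_exp_between:
  assumes "0 \<le> y"
  shows "(\<integral>\<^sup>+u. ennreal (exp (- u)) * indicator {0<..<y} u \<partial>lborel) = ennreal (1 - exp (- y :: real))"
proof -
  have "(\<integral>\<^sup>+u. ennreal (exp (- u)) * indicator {0<..<y} u \<partial>lborel)
      = (\<integral>\<^sup>+u. ennreal (exp (- u)) * indicator {0..y} u \<partial>lborel)"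
    by (intro nn_integral_cong_AE, use AE_lborel_singleton[of y] AE_lborel_singleton[of 0] in eventually_elim)
       (auto simp: indicator_def)
  also have "\<dots> = ennreal (- exp (- y) - (- exp (- 0)))"
    by (rule nn_integral_FTC_Icc) (use assms in \<open>auto intro!: derivative_eq_intros\<close>)
  finally show ?thesis by simp
qed

lemma nn_integral_powr_lessThan:
  assumes "0 < a" "0 \<le> c"
  shows "(\<integral>\<^sup>+r. ennreal (r powr (a - 1)) * indicator {0<..<c} r \<partial>lborel) = ennreal (c powr a / a)"
proof -
  have *: "((\<lambda>x. x powr (a - 1)) has_integral (c powr (a - 1 + 1) / (a - 1 + 1))) {0..c}"
    by (rule has_integral_powr_from_0) (use assms in auto)
  have "(\<integral>\<^sup>+r. ennreal (r powr (a - 1)) * indicator {0<..<c} r \<partial>lborel)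
      = (\<integral>\<^sup>+r. ennreal (indicator {0..c} r * r powr (a - 1)) \<partial>lborel)"
    by (intro nn_integral_cong_AE, use AE_lborel_singleton[of c] AE_lborel_singleton[of 0] in eventually_elim)
       (auto simp: indicator_def)
  also have "\<dots> = ennreal (c powr a / a)"
    using nn_integral_has_integral_lebesgue[OF _ *] by simp
  finally show ?thesis .
qed

lemma nn_integral_powr_greaterThan:
  assumes "0 < a" "0 < c"
  shows "(\<integral>\<^sup>+r. ennreal (r powr (- 1 - a)) * indicator {c<..} r \<partial>lborel) = ennreal (c powr (- a) / a)"
proof -
  have "(\<integral>\<^sup>+r. ennreal (r powr (- 1 - a)) * indicator {c<..} r \<partial>lborel)
      = (\<integral>\<^sup>+r. ennreal (r powr (- 1 - a)) * indicator {c..} r \<partial>lborel)"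
    by (intro nn_integral_cong_AE, use AE_lborel_singleton[of c] in eventually_elim)
       (auto simp: indicator_def)
  also have "\<dots> = ennreal (0 - (- (c powr (- a) / a)))"
  proof (rule nn_integral_FTC_atLeast)
    show "((\<lambda>r. - (r powr (- a) / a)) \<longlongrightarrow> 0) at_top"
      using assms by real_asymp
    show "((\<lambda>r. - (r powr - a / a)) has_real_derivative x powr (- 1 - a)) (at x)" if "c \<le> x" for x
      using that assms by (auto intro!: derivative_eq_intros simp: diff_minus_eq_add minus_diff_commute)
  qed auto
  finally show ?thesis by simp
qed

lemma nn_integral_Gamma:
  assumes "0 < s"
  shows "(\<integral>\<^sup>+t. ennreal (t powr (s - 1) * exp (- t)) * indicator {0<..} t \<partial>lborel) = ennreal (Gamma (s::real))"
proof -
  have "(\<integral>\<^sup>+t. ennreal (t powr (s - 1) * exp (- t)) * indicator {0<..} t \<partial>lborel)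
      = (\<integral>\<^sup>+t. ennreal (indicator {0..} t * t powr (s - 1) / exp t) \<partial>lborel)"
    by (intro nn_integral_cong_AE, use AE_lborel_singleton[of 0] in eventually_elim)
       (auto simp: indicator_def exp_minus field_simps)
  then show ?thesis
    using Gamma_conv_nn_integral_real[OF assms] by simp
qed

text \<open>Since \<open>exp (- y)\<close> is the integral of \<open>exp (- u)\<close> over
  \<open>u > y\<close>, Tonelli trades the exponential weight for masses of sublevel sets. For power
  functions these masses are explicit, which reduces the integrals below to \<open>Gamma\<close>
  itself.\<close>

lemma (in sigma_finite_measure) nn_integral_layer_cake_exp:
  assumes [measurable]: "w \<in> borel_measurable M" "Y \<in> borel_measurable M"
  shows "(\<integral>\<^sup>+x. w x * ennreal (exp (- Y x)) \<partial>M)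
    = (\<integral>\<^sup>+u. ennreal (exp (- u)) * (\<integral>\<^sup>+x. w x * indicator {..<u} (Y x) \<partial>M) \<partial>lborel)"
proof -
  interpret P: pair_sigma_finite M lborel ..
  have "(\<integral>\<^sup>+x. w x * ennreal (exp (- Y x)) \<partial>M)
      = (\<integral>\<^sup>+x. w x * (\<integral>\<^sup>+u. ennreal (exp (- u)) * indicator {Y x<..} u \<partial>lborel) \<partial>M)"
    by (simp add: nn_integral_exp_greaterThan)
  also have "\<dots> = (\<integral>\<^sup>+x. \<integral>\<^sup>+u. w x * ennreal (exp (- u)) * indicator {Y x<..} u \<partial>lborel \<partial>M)"
    by (subst nn_integral_cmult[symmetric]) (auto simp: mult.assoc)
  also have "\<dots> = (\<integral>\<^sup>+u. \<integral>\<^sup>+x. w x * ennreal (exp (- u)) * indicator {Y x<..} u \<partial>M \<partial>lborel)"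
    unfolding indicator_def greaterThan_iff by (rule P.Fubini'[symmetric]) measurable
  also have "\<dots> = (\<integral>\<^sup>+u. ennreal (exp (- u)) * (\<integral>\<^sup>+x. w x * indicator {..<u} (Y x) \<partial>M) \<partial>lborel)"
    by (subst nn_integral_cmult[symmetric])
       (auto intro!: nn_integral_cong simp: indicator_def mult_ac)
  finally show ?thesis .
qed

lemma (in sigma_finite_measure) nn_integral_layer_cake_one_minus_exp:
  assumes [measurable]: "w \<in> borel_measurable M" "Y \<in> borel_measurable M"
    and "\<And>x. x \<in> space M \<Longrightarrow> 0 \<le> Y x"
  shows "(\<integral>\<^sup>+x. w x * ennreal (1 - exp (- Y x)) \<partial>M)
    = (\<integral>\<^sup>+u. ennreal (exp (- u)) * indicator {0<..} u * (\<integral>\<^sup>+x. w x * indicator {u<..} (Y x) \<partial>M) \<partial>lborel)"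
proof -
  interpret P: pair_sigma_finite M lborel ..
  have "(\<integral>\<^sup>+x. w x * ennreal (1 - exp (- Y x)) \<partial>M)
      = (\<integral>\<^sup>+x. w x * (\<integral>\<^sup>+u. ennreal (exp (- u)) * indicator {0<..<Y x} u \<partial>lborel) \<partial>M)"
    by (intro nn_integral_cong) (simp add: nn_integral_exp_between assms)
  also have "\<dots> = (\<integral>\<^sup>+x. \<integral>\<^sup>+u. w x * ennreal (exp (- u)) * indicator {0<..<Y x} u \<partial>lborel \<partial>M)"
    by (subst nn_integral_cmult[symmetric]) (auto simp: mult.assoc)
  also have "\<dots> = (\<integral>\<^sup>+u. \<integral>\<^sup>+x. w x * ennreal (exp (- u)) * indicator {0<..<Y x} u \<partial>M \<partial>lborel)"
    unfolding indicator_def greaterThanLessThan_iff by (rule P.Fubini'[symmetric]) measurable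
  also have "\<dots> = (\<integral>\<^sup>+u. ennreal (exp (- u)) * indicator {0<..} u * (\<integral>\<^sup>+x. w x * indicator {u<..} (Y x) \<partial>M) \<partial>lborel)"
    by (subst nn_integral_cmult[symmetric])
       (auto intro!: nn_integral_cong simp: indicator_def mult_ac)
  finally show ?thesis .
qed

lemma powr_less_iff_less:
  fixes b x y :: real
  assumes "0 < b" "0 \<le> x" "0 \<le> y"
  shows "x powr b < y powr b \<longleftrightarrow> x < y"
  using assms by (metis linorder_neqE_linordered_idom order_less_asym powr_less_mono2)

lemma powr_mult_less_iff:
  fixes b c r u :: real
  assumes "0 < b" "0 < c" "0 < r" "0 < u"
  shows "c * r powr b < u \<longleftrightarrow> r < (u / c) powr (1 / b)"
    and "u < c * r powr b \<longleftrightarrow> (u / c) powr (1 / b) < r"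
proof -
  have u: "u = c * ((u / c) powr (1 / b)) powr b"
    using assms by (simp add: powr_powr)
  show "c * r powr b < u \<longleftrightarrow> r < (u / c) powr (1 / b)"
    using assms by (subst u) (simp add: powr_less_iff_less)
  show "u < c * r powr b \<longleftrightarrow> (u / c) powr (1 / b) < r"
    using assms by (subst u) (simp add: powr_less_iff_less)
qed

lemma nn_integral_powr_exp_neg_powr:
  assumes "0 < a" "0 < b" "0 < c"
  shows "(\<integral>\<^sup>+r. ennreal (r powr (a - 1) * exp (- (c * r powr b))) * indicator {0<..} r \<partial>lborel)
    = ennreal (Gamma (a / b) / b * c powr (- a / b))"
proof -
  define w where "w r = ennreal (r powr (a - 1)) * indicator {0<..} r" for r :: real
  \<comment> \<open>The interval \<open>r < (u / c) powr (1 / b)\<close> has weight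
    \<open>(u / c) powr (a / b) / a\<close>, so the outer integral produces
    \<open>Gamma (a / b + 1)\<close>; the recursion removes the shift.\<close>
  have G: "Gamma (a / b + 1) = a / b * Gamma (a / b)"
    by (rule Gamma_plus1) (use assms in \<open>auto dest!: nonpos_Ints_nonpos simp: divide_le_0_iff\<close>)
  have [measurable]: "w \<in> borel_measurable borel" unfolding w_def by measurable
  have inner: "(\<integral>\<^sup>+r. w r * indicator {..<u} (c * r powr b) \<partial>lborel)
      = ennreal ((u / c) powr (a / b) / a) * indicator {0<..} u" for u
  proof (cases "0 < u")
    case True
    have "(\<integral>\<^sup>+r. w r * indicator {..<u} (c * r powr b) \<partial>lborel)
      = (\<integral>\<^sup>+r. ennreal (r powr (a - 1)) * indicator {0<..<(u / c) powr (1 / b)} r \<partial>lborel)"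
      using powr_mult_less_iff(1)[OF assms(2,3) _ True]
      by (intro nn_integral_cong) (auto simp: w_def indicator_def)
    also have "\<dots> = ennreal (((u / c) powr (1 / b)) powr a / a)"
      by (rule nn_integral_powr_lessThan) (use assms in auto)
    finally show ?thesis using True assms by (simp add: powr_powr)
  next
    case False
    then have "\<not> c * r powr b < u" for r
      using assms by (smt (verit) mult_nonneg_nonneg powr_ge_zero)
    then show ?thesis using False by (simp add: indicator_def)
  qed
  have "(\<integral>\<^sup>+r. ennreal (r powr (a - 1) * exp (- (c * r powr b))) * indicator {0<..} r \<partial>lborel)
      = (\<integral>\<^sup>+r. w r * ennreal (exp (- (c * r powr b))) \<partial>lborel)"
    by (intro nn_integral_cong) (auto simp: w_def ennreal_mult indicator_def)
  also have "\<dots> = (\<integral>\<^sup>+u. ennreal (exp (- u)) * (ennreal ((u / c) powr (a / b) / a) * indicator {0<..} u) \<partial>lborel)"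
    by (subst lborel.nn_integral_layer_cake_exp) (auto simp: inner)
  also have "\<dots> = (\<integral>\<^sup>+u. ennreal (c powr (- a / b) / a) *
      (ennreal (u powr (a / b + 1 - 1) * exp (- u)) * indicator {0<..} u) \<partial>lborel)"
    by (intro nn_integral_cong)
       (use assms in \<open>auto simp: indicator_def powr_divide powr_minus field_simps ennreal_mult[symmetric]\<close>)
  also have "\<dots> = ennreal (c powr (- a / b) / a) * ennreal (Gamma (a / b + 1))"
    using assms by (subst nn_integral_cmult, measurable, subst nn_integral_Gamma) (auto simp: add_pos_pos)
  also have "\<dots> = ennreal (Gamma (a / b) / b * c powr (- a / b))"
    using assms G by (subst ennreal_mult[symmetric]) (auto simp: field_simps Gamma_real_nonneg)
  finally show ?thesis .
qed

text \<open>For \<open>b = 1\<close> this writes \<open>c powr k\<close> as a mixture of functions 1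
  - exp(-c r), the identity that extracts positive moments from a Laplace transform. The factor
  \<open>k\<close> gives the ray beyond y the weight \<open>y powr (- k)\<close>. The condition
  \<open>k < b\<close> is convergence at 0, where the integrand has order
  \<open>r powr (b - 1 - k)\<close>.\<close>

lemma nn_integral_powr_one_minus_exp:
  assumes "0 < k" "k < b" "0 < c"
  shows "(\<integral>\<^sup>+r. ennreal (k * r powr (- 1 - k) * (1 - exp (- (c * r powr b)))) * indicator {0<..} r \<partial>lborel)
    = ennreal (Gamma (1 - k / b) * c powr (k / b))"
proof -
  define w where "w r = ennreal (k * r powr (- 1 - k)) * indicator {0<..} r" for r :: real
  have b: "0 < b" using assms by simp
  have [measurable]: "w \<in> borel_measurable borel" unfolding w_def by measurable
  have inner: "(\<integral>\<^sup>+r. w r * indicator {u<..} (c * r powr b) \<partial>lborel)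
      = ennreal ((u / c) powr (- k / b))" if "0 < u" for u
  proof -
    have "(\<integral>\<^sup>+r. w r * indicator {u<..} (c * r powr b) \<partial>lborel)
      = (\<integral>\<^sup>+r. ennreal k * (ennreal (r powr (- 1 - k)) * indicator {(u / c) powr (1 / b)<..} r) \<partial>lborel)"
      using powr_mult_less_iff(2)[OF b assms(3) _ that] that assms b
      by (intro nn_integral_cong)
         (auto simp: w_def indicator_def ennreal_mult dest: order.strict_trans1[OF powr_ge_zero])
    also have "\<dots> = ennreal k * ennreal (((u / c) powr (1 / b)) powr (- k) / k)"
      by (subst nn_integral_cmult, measurable, subst nn_integral_powr_greaterThan) (use assms that in auto)
    also have "\<dots> = ennreal ((u / c) powr (- k / b))"
      using that assms by (simp add: powr_powr ennreal_mult[symmetric])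
    finally show ?thesis .
  qed
  have "(\<integral>\<^sup>+r. ennreal (k * r powr (- 1 - k) * (1 - exp (- (c * r powr b)))) * indicator {0<..} r \<partial>lborel)
      = (\<integral>\<^sup>+r. w r * ennreal (1 - exp (- (c * r powr b))) \<partial>lborel)"
    by (intro nn_integral_cong) (use assms in \<open>auto simp: w_def ennreal_mult indicator_def\<close>)
  also have "\<dots> = (\<integral>\<^sup>+u. ennreal (exp (- u)) * indicator {0<..} u *
      (\<integral>\<^sup>+r. w r * indicator {u<..} (c * r powr b) \<partial>lborel) \<partial>lborel)"
    by (subst lborel.nn_integral_layer_cake_one_minus_exp) (use assms in auto)
  also have "\<dots> = (\<integral>\<^sup>+u. ennreal (c powr (k / b)) *
      (ennreal (u powr (1 - k / b - 1) * exp (- u)) * indicator {0<..} u) \<partial>lborel)"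
    by (intro nn_integral_cong)
       (use assms inner in \<open>auto simp: powr_divide powr_minus field_simps ennreal_mult[symmetric] split: split_indicator\<close>)
  also have "\<dots> = ennreal (c powr (k / b)) * ennreal (Gamma (1 - k / b))"
    using assms by (subst nn_integral_cmult, measurable, subst nn_integral_Gamma) auto
  also have "\<dots> = ennreal (Gamma (1 - k / b) * c powr (k / b))"
    using assms by (subst ennreal_mult[symmetric]) (auto simp: field_simps Gamma_real_nonneg)
  finally show ?thesis .
qed

section \<open>One-sided stable laws\<close>

lemma integrable_mult_continuous_unit_interval:
  fixes w z \<phi> :: "_ \<Rightarrow> real"
  assumes w: "integrable M w" and [measurable]: "z \<in> borel_measurable M"
    and z: "AE x in M. z x \<in> {0..1}" and \<phi>: "continuous_on UNIV \<phi>"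
  shows "integrable M (\<lambda>x. w x * \<phi> (z x))"
proof -
  have [measurable]: "w \<in> borel_measurable M" "\<phi> \<in> borel_measurable borel"
    using w \<phi> by (auto intro: borel_measurable_continuous_onI)
  have "compact (\<phi> ` {0..1})"
    by (intro compact_continuous_image continuous_on_subset[OF \<phi>]) auto
  then obtain B where "\<forall>y\<in>\<phi> ` {0..1}. norm y \<le> B"
    by (meson bounded_iff compact_imp_bounded)
  then have B: "\<And>u. u \<in> {0..1} \<Longrightarrow> \<bar>\<phi> u\<bar> \<le> B" by auto
  show ?thesis
  proof (rule Bochner_Integration.integrable_bound[of M "\<lambda>x. B * w x"])
    show "AE x in M. norm (w x * \<phi> (z x)) \<le> norm (B * w x)"
      using z
    proof eventually_elim
      case (elim x)
      have "\<bar>\<phi> (z x)\<bar> \<le> \<bar>B\<bar>" using B[OF elim] by simp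
      then show ?case by (simp add: abs_mult mult.commute[of "\<bar>w x\<bar>"] mult_right_mono)
    qed
  qed (use w in auto)
qed

text \<open>By Weierstrass, \<phi> is uniformly close on [0,1] to a polynomial, whose integrals
  converge by hypothesis. The error is the tolerance times the total mass, and the mass converges
  too, being the moment of order 0. Weights depending on \<open>i\<close> allow a probability law
  multiplied by a growing factor.\<close>

lemma tendsto_integral_of_moments:
  fixes M :: "'i \<Rightarrow> 'a measure" and w z :: "'i \<Rightarrow> 'a \<Rightarrow> real" and v y :: "'b \<Rightarrow> real"
  assumes w: "\<And>i. integrable (M i) (w i)" "\<And>i. AE x in M i. 0 \<le> w i x"
    and z: "\<And>i. z i \<in> borel_measurable (M i)" "\<And>i. AE x in M i. z i x \<in> {0..1}"
    and v: "integrable N v" "AE x in N. 0 \<le> v x"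
    and y: "y \<in> borel_measurable N" "AE x in N. y x \<in> {0..1}"
    and moments: "\<And>k::nat. ((\<lambda>i. \<integral>x. w i x * z i x ^ k \<partial>M i) \<longlongrightarrow> (\<integral>x. v x * y x ^ k \<partial>N)) F"
    and \<phi>: "continuous_on UNIV \<phi>"
  shows "((\<lambda>i. \<integral>x. w i x * \<phi> (z i x) \<partial>M i) \<longlongrightarrow> (\<integral>x. v x * \<phi> (y x) \<partial>N)) F"
proof (rule tendstoI)
  fix e :: real assume e: "0 < e"
  \<comment> \<open>The added 1 absorbs the difference between the mass of \<open>w i\<close> and
    its limit, and keeps \<open>C\<close> positive when the limiting mass is 0.\<close>
  define C where "C = (\<integral>x. v x \<partial>N) + 1"
  have C: "0 < C" using integral_nonneg_AE[OF v(2)] by (simp add: C_def)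
  obtain g where g: "real_polynomial_function g" "\<And>u. u \<in> {0..1} \<Longrightarrow> \<bar>\<phi> u - g u\<bar> < e / (3 * C)"
    using Stone_Weierstrass_real_polynomial_function[of "{0..1::real}" \<phi> "e / (3 * C)"]
      continuous_on_subset[OF \<phi>] e C by auto
  from g(1) obtain a m where ga: "g = (\<lambda>x. \<Sum>i\<le>m. a i * x ^ i)"
    unfolding real_polynomial_function_iff_sum by blast
  have g_cont: "continuous_on UNIV g" unfolding ga by (intro continuous_intros)
  have err: "\<bar>(\<integral>x. u x * \<phi> (t x) \<partial>L) - (\<integral>x. u x * g (t x) \<partial>L)\<bar> \<le> e / (3 * C) * (\<integral>x. u x \<partial>L)"
    if u: "integrable L u" "AE x in L. 0 \<le> u x"
      and t: "t \<in> borel_measurable L" "AE x in L. t x \<in> {0..1}" for L :: "'c measure" and u t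
  proof -
    note int = integrable_mult_continuous_unit_interval[OF u(1) t \<phi>]
      integrable_mult_continuous_unit_interval[OF u(1) t g_cont]
    have "\<bar>(\<integral>x. u x * \<phi> (t x) \<partial>L) - (\<integral>x. u x * g (t x) \<partial>L)\<bar> = \<bar>\<integral>x. u x * \<phi> (t x) - u x * g (t x) \<partial>L\<bar>"
      using int by simp
    also have "\<dots> \<le> (\<integral>x. \<bar>u x * \<phi> (t x) - u x * g (t x)\<bar> \<partial>L)"
      by (rule integral_abs_bound)
    also have "\<dots> \<le> (\<integral>x. e / (3 * C) * u x \<partial>L)"
    proof (rule integral_mono_AE)
      show "AE x in L. \<bar>u x * \<phi> (t x) - u x * g (t x)\<bar> \<le> e / (3 * C) * u x"
        using u(2) t(2)
      proof eventually_elim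
        case (elim x)
        have "\<bar>u x * \<phi> (t x) - u x * g (t x)\<bar> = u x * \<bar>\<phi> (t x) - g (t x)\<bar>"
          using elim(1) by (simp add: right_diff_distrib[symmetric] abs_mult)
        also have "\<dots> \<le> u x * (e / (3 * C))"
          using g(2)[OF elim(2)] elim(1) by (intro mult_left_mono) auto
        finally show ?case by (simp add: mult.commute)
      qed
    qed (use int u in auto)
    finally show ?thesis by simp
  qed
  have expand: "(\<integral>x. u x * g (t x) \<partial>L) = (\<Sum>k\<le>m. a k * (\<integral>x. u x * t x ^ k \<partial>L))"
    if u: "integrable L u" and t: "t \<in> borel_measurable L" "AE x in L. t x \<in> {0..1}"
    for L :: "'c measure" and u t
  proof -
    have "integrable L (\<lambda>x. u x * t x ^ k)" for k
      using integrable_mult_continuous_unit_interval[OF u t, of "\<lambda>x. x ^ k"]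
      by (simp add: continuous_intros)
    then have "(\<integral>x. (\<Sum>k\<le>m. a k * (u x * t x ^ k)) \<partial>L) = (\<Sum>k\<le>m. a k * (\<integral>x. u x * t x ^ k \<partial>L))"
      by (subst Bochner_Integration.integral_sum) auto
    then show ?thesis
      by (simp add: ga sum_distrib_left mult_ac)
  qed
  have "((\<lambda>i. \<Sum>k\<le>m. a k * (\<integral>x. w i x * z i x ^ k \<partial>M i)) \<longlongrightarrow>
      (\<Sum>k\<le>m. a k * (\<integral>x. v x * y x ^ k \<partial>N))) F"
    by (intro tendsto_intros moments)
  then have "((\<lambda>i. \<integral>x. w i x * g (z i x) \<partial>M i) \<longlongrightarrow> (\<integral>x. v x * g (y x) \<partial>N)) F"
    by (simp add: expand[OF w(1) z] expand[OF v(1) y])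
  moreover have "((\<lambda>i. \<integral>x. w i x \<partial>M i) \<longlongrightarrow> (\<integral>x. v x \<partial>N)) F"
    using moments[of 0] by simp
  ultimately have "\<forall>\<^sub>F i in F. dist (\<integral>x. w i x * g (z i x) \<partial>M i) (\<integral>x. v x * g (y x) \<partial>N) < e / 3"
    "\<forall>\<^sub>F i in F. dist (\<integral>x. w i x \<partial>M i) (\<integral>x. v x \<partial>N) < 1"
    using e by (auto intro: tendstoD simp del: divide_less_eq_numeral1 less_divide_eq_numeral1)
  then show "\<forall>\<^sub>F i in F. dist (\<integral>x. w i x * \<phi> (z i x) \<partial>M i) (\<integral>x. v x * \<phi> (y x) \<partial>N) < e"
  proof eventually_elim
    case (elim i)
    have "\<bar>(\<integral>x. w i x * \<phi> (z i x) \<partial>M i) - (\<integral>x. w i x * g (z i x) \<partial>M i)\<bar> \<le> e / (3 * C) * (\<integral>x. w i x \<partial>M i)"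
      by (rule err[OF w z])
    also have "\<dots> \<le> e / (3 * C) * C"
      using elim(2) e C by (intro mult_left_mono) (auto simp: C_def dist_real_def)
    finally have 1: "\<bar>(\<integral>x. w i x * \<phi> (z i x) \<partial>M i) - (\<integral>x. w i x * g (z i x) \<partial>M i)\<bar> \<le> e / 3"
      using C by simp
    have "\<bar>(\<integral>x. v x * \<phi> (y x) \<partial>N) - (\<integral>x. v x * g (y x) \<partial>N)\<bar> \<le> e / (3 * C) * (\<integral>x. v x \<partial>N)"
      by (rule err[OF v y])
    also have "\<dots> \<le> e / (3 * C) * C"
      using e C by (intro mult_left_mono) (auto simp: C_def)
    finally have 2: "\<bar>(\<integral>x. v x * \<phi> (y x) \<partial>N) - (\<integral>x. v x * g (y x) \<partial>N)\<bar> \<le> e / 3"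
      using C by simp
    show ?case using 1 2 elim(1) unfolding dist_real_def by linarith
  qed
qed

lemma continuous_on_cts_step: "a < b \<Longrightarrow> continuous_on UNIV (cts_step a b)"
  by (rule uniformly_continuous_imp_continuous[OF cts_step_uniformly_continuous])

text \<open>\<open>cts_step\<close> decreases from 1 to 0 and so does \<open>exp (- x)\<close> in
  \<open>x\<close>; the composition is thus an increasing ramp, 0 up to \<open>q\<close> and 1 from
  \<open>p\<close> on. It is a continuous function of \<open>exp (- x)\<close> squeezed between two
  tail indicators.\<close>

lemma cts_step_exp_bounds:
  fixes p q x :: real
  assumes "q < p"
  shows "indicator {p..} x \<le> cts_step (exp (- p)) (exp (- q)) (exp (- x))"
    and "cts_step (exp (- p)) (exp (- q)) (exp (- x)) \<le> indicator {q<..} x"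
  using assms by (auto simp: cts_step_def indicator_def field_simps)

lemma cts_step_nonneg: "a < b \<Longrightarrow> 0 \<le> cts_step a b x" and cts_step_le_1: "a < b \<Longrightarrow> cts_step a b x \<le> 1"
  by (auto simp: cts_step_def field_simps)

text \<open>Let \<open>y\<close> decrease to \<open>x\<close> and use right-continuity. Comparison
  through ramps, or through events that differ in a strict inequality, only ever yields such shifted
  inequalities.\<close>

lemma real_distribution_eqI_cdf_interlace:
  assumes "real_distribution M1" "real_distribution M2"
    and le: "\<And>x y. x < y \<Longrightarrow> cdf M1 x \<le> cdf M2 y" "\<And>x y. x < y \<Longrightarrow> cdf M2 x \<le> cdf M1 y"
  shows "M1 = M2"
proof -
  have cdf_le: "cdf L1 x \<le> cdf L2 x"
    if L2: "real_distribution L2" and le: "\<And>y. x < y \<Longrightarrow> cdf L1 x \<le> cdf L2 y" for L1 L2 x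
  proof -
    interpret L2: real_distribution L2 by fact
    have "(cdf L2 \<longlongrightarrow> cdf L2 x) (at_right x)"
      using L2.cdf_is_right_cont[of x] by (simp add: continuous_within)
    then show ?thesis
      by (rule tendsto_lowerbound) (auto simp: eventually_at_right_field intro!: exI[of _ "x + 1"] le)
  qed
  have "cdf M1 = cdf M2"
    using cdf_le[OF assms(2) le(1)] cdf_le[OF assms(1) le(2)] by (intro ext order.antisym) auto
  then show ?thesis using assms(1,2) by (intro cdf_unique)
qed

text \<open>The map \<open>exp (- x)\<close> sends the half-line into [0,1] and makes Laplace
  transforms at integers a moment sequence. The two laws therefore agree on continuous functions of
  \<open>exp (- x)\<close>, and ramps between two tails make the distribution functions
  interlace.\<close>

lemma laplace_transform_unique:
  assumes "real_distribution M1" "real_distribution M2"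
    and nonneg: "AE x in M1. 0 \<le> x" "AE x in M2. 0 \<le> x"
    and eq: "\<And>r. 0 < r \<Longrightarrow> (\<integral>x. exp (- (r * x)) \<partial>M1) = (\<integral>x. exp (- (r * x)) \<partial>M2)"
  shows "M1 = M2"
proof -
  have cdf_le: "cdf L2 q \<le> cdf L1 p"
    if L: "real_distribution L1" "real_distribution L2"
    and nonneg: "AE x in L1. 0 \<le> x" "AE x in L2. 0 \<le> x"
    and eq: "\<And>r. 0 < r \<Longrightarrow> (\<integral>x. exp (- (r * x)) \<partial>L1) = (\<integral>x. exp (- (r * x)) \<partial>L2)"
      and qp: "q < p" for L1 L2 p q
  proof -
    interpret L1: real_distribution L1 by fact
    interpret L2: real_distribution L2 by fact
    have moments: "(\<integral>x. 1 * exp (- x) ^ k \<partial>L1) = (\<integral>x. 1 * exp (- x) ^ k \<partial>L2)" for k :: nat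
    proof (cases "k = 0")
      case False
      then show ?thesis using eq[of "real k"] by (simp add: exp_of_nat_mult[symmetric])
    qed (simp add: L1.prob_space[unfolded L1.space_eq_univ] L2.prob_space[unfolded L2.space_eq_univ])
    let ?f = "cts_step (exp (- p)) (exp (- q))"
    have cont: "continuous_on UNIV ?f"
      using qp by (intro continuous_on_cts_step) simp
    then have [measurable]: "?f \<in> borel_measurable borel"
      by (rule borel_measurable_continuous_onI)
    \<comment> \<open>A constant sequence: the convergence statement degenerates to an equality of
      integrals.\<close>
    have "((\<lambda>i::nat. \<integral>x. 1 * ?f (exp (- x)) \<partial>L1) \<longlongrightarrow> (\<integral>x. 1 * ?f (exp (- x)) \<partial>L2)) sequentially"
      by (rule tendsto_integral_of_moments[OF _ _ _ _ _ _ _ _ _ cont])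
         (use nonneg moments in simp_all)
    then have E: "(\<integral>x. ?f (exp (- x)) \<partial>L1) = (\<integral>x. ?f (exp (- x)) \<partial>L2)"
      by (simp add: tendsto_const_iff)
    have int: "integrable L1 (\<lambda>x. ?f (exp (- x)))" "integrable L2 (\<lambda>x. ?f (exp (- x)))"
      using qp by (auto intro!: L1.integrable_const_bound[of _ 1] L2.integrable_const_bound[of _ 1]
        simp: cts_step_nonneg cts_step_le_1)
    have "measure L1 {p..} = (\<integral>x. indicator {p..} x \<partial>L1)" by simp
    also have "\<dots> \<le> (\<integral>x. ?f (exp (- x)) \<partial>L1)"
      by (rule integral_mono) (use int cts_step_exp_bounds[OF qp] in
        \<open>auto intro!: integrable_real_indicator simp: L1.emeasure_eq_measure\<close>)
    also have "\<dots> \<le> (\<integral>x. indicator {q<..} x \<partial>L2)"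
      unfolding E by (rule integral_mono) (use int cts_step_exp_bounds[OF qp] in
        \<open>auto intro!: integrable_real_indicator simp: L2.emeasure_eq_measure\<close>)
    also have "\<dots> = measure L2 {q<..}" by simp
    also have "\<dots> = 1 - cdf L2 q"
      using L2.prob_compl[of "{..q}"] by (simp add: cdf_def Compl_eq_Diff_UNIV[symmetric])
    finally have "cdf L2 q \<le> 1 - measure L1 {p..}" by simp
    also have "\<dots> = measure L1 {..<p}"
      using L1.prob_compl[of "{p..}"] by (simp add: Compl_eq_Diff_UNIV[symmetric])
    also have "\<dots> \<le> cdf L1 p"
      unfolding cdf_def by (intro L1.finite_measure_mono) auto
    finally show ?thesis .
  qed
  show ?thesis
    using cdf_le[OF assms(2,1) nonneg(2,1) eq[symmetric]] cdf_le[OF assms(1,2) nonneg eq]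
    by (intro real_distribution_eqI_cdf_interlace assms(1,2))
qed

text \<open>Where \<open>y > x\<close>, the function 1 - exp(-y/x) is at least
  \<open>1 - exp (- 1)\<close>. The bound holds at every positive \<open>x\<close>, not just
  asymptotically, and so serves both as a majorant and for tightness.\<close>

lemma laplace_tail_bound:
  assumes "real_distribution M" and nonneg: "AE y in M. 0 \<le> y" and x: "0 < x"
  shows "(1 - exp (- 1)) * measure M {x<..} \<le> 1 - (\<integral>y. exp (- (1 / x * y)) \<partial>M)"
proof -
  interpret real_distribution M by fact
  have int: "integrable M (\<lambda>y. exp (- (1 / x * y)))"
    by (rule integrable_const_bound[of _ 1]) (use nonneg x in auto)
  have "(1 - exp (- 1)) * prob {x<..} = (\<integral>y. (1 - exp (- 1)) * indicator {x<..} y \<partial>M)" by simp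
  also have "\<dots> \<le> (\<integral>y. 1 - exp (- (1 / x * y)) \<partial>M)"
  proof (rule integral_mono_AE)
    show "AE y in M. (1 - exp (- 1)) * indicator {x<..} y \<le> 1 - exp (- (1 / x * y))"
      using nonneg by eventually_elim (use x in \<open>auto simp: indicator_def field_simps\<close>)
  qed (use int in \<open>auto intro: integrable_real_indicator simp: emeasure_eq_measure\<close>)
  also have "\<dots> = 1 - (\<integral>y. exp (- (1 / x * y)) \<partial>M)"
    using int prob_space[unfolded space_eq_univ] by simp
  finally show ?thesis .
qed

section \<open>Moments and tail of a one-sided stable law\<close>

locale one_sided_stable = real_distribution M for M :: "real measure" +
  fixes b :: real
  assumes b_pos: "0 < b" and b_less_1: "b < 1"
    and AE_nonneg: "AE x in M. 0 \<le> x"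
    and laplace: "\<And>r. 0 < r \<Longrightarrow> (\<integral>x. exp (- (r * x)) \<partial>M) = exp (- (r powr b))"
begin

lemma integrable_exp: "0 \<le> r \<Longrightarrow> integrable M (\<lambda>x. exp (- (r * x)))"
  by (rule integrable_const_bound[of _ 1]) (use AE_nonneg in auto)

lemma nn_laplace: "0 < r \<Longrightarrow> (\<integral>\<^sup>+x. ennreal (exp (- (r * x))) \<partial>M) = ennreal (exp (- (r powr b)))"
  by (subst nn_integral_eq_integral) (auto simp: laplace integrable_exp)

text \<open>An atom at 0 would keep the Laplace transform bounded away from 0 as \<open>r\<close>
  tends to infinity.\<close>

lemma AE_pos: "AE x in M. 0 < x"
proof -
  have le: "prob {..0} \<le> exp (- (r powr b))" if "0 < r" for r
  proof -
    have "prob {..0} = (\<integral>x. indicator {..0} x \<partial>M)" by simp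
    also have "\<dots> \<le> (\<integral>x. exp (- (r * x)) \<partial>M)"
    proof (rule integral_mono_AE)
      show "AE x in M. indicator {..0} x \<le> exp (- (r * x))"
        using AE_nonneg by eventually_elim (auto simp: indicator_def)
    qed (use that in \<open>auto intro: integrable_exp integrable_real_indicator simp: emeasure_eq_measure\<close>)
    finally show ?thesis using laplace[OF that] by simp
  qed
  have "((\<lambda>r. exp (- (r powr b))) \<longlongrightarrow> 0) at_top"
    using b_pos by real_asymp
  then have "prob {..0} \<le> 0"
    by (rule tendsto_lowerbound)
       (auto simp: eventually_at_top_linorder intro!: exI[of _ 1] le)
  then have "prob {..0} = 0" by (simp add: measure_le_0_iff)
  then have "AE x in M. x \<notin> {..0}"
    by (subst (asm) prob_eq_0) auto
  then show ?thesis by eventually_elim auto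
qed

text \<open>\<open>Gamma a * x powr (- a)\<close> is the integral of r^(a-1) exp(-x r) over r > 0;
  Tonelli then puts the Laplace transform under the integral. That all negative moments are finite
  supplies the dominating functions both for the tails of ratios and for the Gaussian
  mixture.\<close>

lemma nn_integral_powr_neg:
  assumes a: "0 < a"
  shows "(\<integral>\<^sup>+x. ennreal (x powr (- a)) \<partial>M) = ennreal (Gamma (a / b) / (b * Gamma a))"
proof -
  interpret P: pair_sigma_finite M lborel ..
  have "ennreal (Gamma a) * (\<integral>\<^sup>+x. ennreal (x powr (- a)) \<partial>M) = (\<integral>\<^sup>+x. ennreal (Gamma a) * ennreal (x powr (- a)) \<partial>M)"
    by (subst nn_integral_cmult) auto
  also have "\<dots> = (\<integral>\<^sup>+x. \<integral>\<^sup>+r. ennreal (r powr (a - 1) * exp (- (x * r powr 1))) * indicator {0<..} r \<partial>lborel \<partial>M)"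
    by (intro nn_integral_cong_AE, use AE_pos in eventually_elim)
       (use a nn_integral_powr_exp_neg_powr[OF a, of 1] in \<open>simp add: ennreal_mult' Gamma_real_nonneg\<close>)
  also have "\<dots> = (\<integral>\<^sup>+r. \<integral>\<^sup>+x. ennreal (r powr (a - 1) * exp (- (x * r powr 1))) * indicator {0<..} r \<partial>M \<partial>lborel)"
    by (rule P.Fubini'[symmetric]) measurable
  also have "\<dots> = (\<integral>\<^sup>+r. ennreal (r powr (a - 1) * exp (- (1 * r powr b))) * indicator {0<..} r \<partial>lborel)"
  proof (intro nn_integral_cong)
    fix r :: real
    have "(\<integral>\<^sup>+x. ennreal (r powr (a - 1) * exp (- (x * r powr 1))) * indicator {0<..} r \<partial>M)
      = (\<integral>\<^sup>+x. ennreal (r powr (a - 1)) * indicator {0<..} r * ennreal (exp (- (r * x))) \<partial>M)"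
      by (intro nn_integral_cong) (auto simp: ennreal_mult indicator_def mult_ac)
    then show "(\<integral>\<^sup>+x. ennreal (r powr (a - 1) * exp (- (x * r powr 1))) * indicator {0<..} r \<partial>M)
      = ennreal (r powr (a - 1) * exp (- (1 * r powr b))) * indicator {0<..} r"
      by (subst (asm) nn_integral_cmult) (auto simp: nn_laplace ennreal_mult indicator_def)
  qed
  also have "\<dots> = ennreal (Gamma (a / b) / b)"
    by (subst nn_integral_powr_exp_neg_powr) (use a b_pos in auto)
  finally have "ennreal (Gamma a) * (\<integral>\<^sup>+x. ennreal (x powr (- a)) \<partial>M) = ennreal (Gamma (a / b) / b)" .
  then have "(\<integral>\<^sup>+x. ennreal (x powr (- a)) \<partial>M) = ennreal (Gamma (a / b) / b) / ennreal (Gamma a)"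
    using Gamma_real_pos[OF a] by (metis ennreal_eq_0_iff ennreal_mult_divide_eq ennreal_neq_top mult.commute not_le)
  then show ?thesis
    using Gamma_real_pos[OF a] a b_pos by (simp add: divide_ennreal Gamma_real_nonneg)
qed

text \<open>The same exchange with 1 - exp(-x r) against \<open>k * r powr (- 1 - k)\<close>. The
  restriction \<open>k < b\<close> matches a tail of order \<open>b\<close>, and
  \<open>Gamma (1 - k / b)\<close> blows up as \<open>k\<close> approaches \<open>b\<close>.\<close>

lemma nn_integral_powr_pos:
  assumes k: "0 < k" "k < b"
  shows "(\<integral>\<^sup>+x. ennreal (x powr k) \<partial>M) = ennreal (Gamma (1 - k / b) / Gamma (1 - k))"
proof -
  interpret P: pair_sigma_finite M lborel ..
  have k1: "k < 1" using k b_less_1 by simp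
  then have G: "0 < Gamma (1 - k)" by (intro Gamma_real_pos) simp
  have "ennreal (Gamma (1 - k)) * (\<integral>\<^sup>+x. ennreal (x powr k) \<partial>M) = (\<integral>\<^sup>+x. ennreal (Gamma (1 - k)) * ennreal (x powr k) \<partial>M)"
    by (subst nn_integral_cmult) auto
  also have "\<dots> = (\<integral>\<^sup>+x. \<integral>\<^sup>+r. ennreal (k * r powr (- 1 - k) * (1 - exp (- (x * r powr 1)))) * indicator {0<..} r \<partial>lborel \<partial>M)"
    by (intro nn_integral_cong_AE, use AE_pos in eventually_elim)
       (use k k1 G nn_integral_powr_one_minus_exp[OF k(1), of 1] in \<open>simp add: ennreal_mult'\<close>)
  also have "\<dots> = (\<integral>\<^sup>+r. \<integral>\<^sup>+x. ennreal (k * r powr (- 1 - k) * (1 - exp (- (x * r powr 1)))) * indicator {0<..} r \<partial>M \<partial>lborel)"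
    by (rule P.Fubini'[symmetric]) measurable
  also have "\<dots> = (\<integral>\<^sup>+r. ennreal (k * r powr (- 1 - k) * (1 - exp (- (1 * r powr b)))) * indicator {0<..} r \<partial>lborel)"
  proof (intro nn_integral_cong)
    fix r :: real
    have "(\<integral>\<^sup>+x. ennreal (1 - exp (- (r * x))) \<partial>M) = ennreal (1 - exp (- (r powr b)))" if "0 < r"
    proof (subst nn_integral_eq_integral)
      show "integrable M (\<lambda>x. 1 - exp (- (r * x)))"
        using that integrable_exp[of r] by simp
      show "AE x in M. 0 \<le> 1 - exp (- (r * x))"
        using AE_nonneg by eventually_elim (use that in simp)
      show "ennreal (\<integral>x. 1 - exp (- (r * x)) \<partial>M) = ennreal (1 - exp (- (r powr b)))"
        using that integrable_exp[of r] prob_space[unfolded space_eq_univ] by (simp add: laplace)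
    qed
    moreover have "(\<integral>\<^sup>+x. ennreal (k * r powr (- 1 - k) * (1 - exp (- (x * r powr 1)))) * indicator {0<..} r \<partial>M)
      = (\<integral>\<^sup>+x. ennreal (k * r powr (- 1 - k)) * indicator {0<..} r * ennreal (1 - exp (- (r * x))) \<partial>M)"
      by (intro nn_integral_cong) (use k in \<open>auto simp: ennreal_mult' indicator_def mult_ac\<close>)
    ultimately show "(\<integral>\<^sup>+x. ennreal (k * r powr (- 1 - k) * (1 - exp (- (x * r powr 1)))) * indicator {0<..} r \<partial>M)
      = ennreal (k * r powr (- 1 - k) * (1 - exp (- (1 * r powr b)))) * indicator {0<..} r"
      using k by (simp add: nn_integral_cmult ennreal_mult' indicator_def)
  qed
  also have "\<dots> = ennreal (Gamma (1 - k / b))"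
    by (subst nn_integral_powr_one_minus_exp) (use k in auto)
  finally have "ennreal (Gamma (1 - k)) * (\<integral>\<^sup>+x. ennreal (x powr k) \<partial>M) = ennreal (Gamma (1 - k / b))" .
  then have "(\<integral>\<^sup>+x. ennreal (x powr k) \<partial>M) = ennreal (Gamma (1 - k / b)) / ennreal (Gamma (1 - k))"
    using G by (metis ennreal_eq_0_iff ennreal_mult_divide_eq ennreal_neq_top mult.commute not_le)
  then show ?thesis
    using G k by (simp add: divide_ennreal Gamma_real_nonneg)
qed

lemma tail_bound:
  assumes "0 < x"
  shows "prob {x<..} \<le> x powr (- b) / (1 - exp (- 1))"
proof -
  have "(1 - exp (- 1)) * prob {x<..} \<le> 1 - exp (- ((1 / x) powr b))"
    using laplace_tail_bound[OF real_distribution_axioms AE_nonneg assms] laplace[of "1 / x"] assms by simp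
  also have "\<dots> \<le> (1 / x) powr b"
    using exp_ge_add_one_self[of "- ((1 / x) powr b)"] by simp
  also have "\<dots> = x powr (- b)"
    using assms by (simp add: powr_divide powr_minus field_simps)
  finally show ?thesis
    by (simp add: field_simps)
qed

lemma laplace_nonneg: "0 \<le> r \<Longrightarrow> (\<integral>x. exp (- (r * x)) \<partial>M) = exp (- (r powr b))"
  using laplace[of r] prob_space[unfolded space_eq_univ] by (cases "r = 0") auto

text \<open>
  The weight \<open>1 - exp (- x)\<close> tames the singularity of the limiting density \<open>b * x powr (- 1 - b)\<close> at \<open>0\<close>,
  and against it the powers of \<open>exp (- x)\<close> integrate to differences of Laplace transforms.
\<close>

lemma tendsto_smoothed_tail:
  assumes \<phi>: "continuous_on UNIV \<phi>"
  shows "((\<lambda>R. \<integral>x. \<bar>R\<bar> powr b * (1 - exp (- (\<bar>x\<bar> / \<bar>R\<bar>))) * \<phi> (exp (- (\<bar>x\<bar> / \<bar>R\<bar>))) \<partial>M) \<longlongrightarrow>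
    (\<integral>x. indicator {0<..} x * (b * x powr (- 1 - b) * (1 - exp (- x)) / Gamma (1 - b)) * \<phi> (exp (- \<bar>x\<bar>)) \<partial>lborel)) at_top"
proof -
  \<comment> \<open>\<open>h c\<close> integrates to \<open>Gamma (1 - b) * c powr b\<close>.
    Consecutive differences in \<open>c\<close> are the limiting weight times powers of
    \<open>exp (- x)\<close>, so the limiting moments are
    \<open>(real k + 1) powr b - real k powr b\<close>.\<close>
  define h where "h c x = b * x powr (- 1 - b) * (1 - exp (- (c * x))) * indicator {0<..} x" for c x :: real
  define v where "v x = indicator {0<..} x * (b * x powr (- 1 - b) * (1 - exp (- x)) / Gamma (1 - b))" for x :: real
  have G: "0 < Gamma (1 - b)" using b_less_1 by (intro Gamma_real_pos) simp
  have h: "has_bochner_integral lborel (h c) (Gamma (1 - b) * c powr b)" if "0 \<le> c" for c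
  proof (cases "c = 0")
    case False
    show ?thesis
    proof (rule has_bochner_integral_nn_integral)
      have "(\<integral>\<^sup>+x. ennreal (h c x) \<partial>lborel)
        = (\<integral>\<^sup>+x. ennreal (b * x powr (- 1 - b) * (1 - exp (- (c * x powr 1)))) * indicator {0<..} x \<partial>lborel)"
        by (intro nn_integral_cong) (auto simp: h_def indicator_def)
      then show "(\<integral>\<^sup>+x. ennreal (h c x) \<partial>lborel) = ennreal (Gamma (1 - b) * c powr b)"
        using nn_integral_powr_one_minus_exp[of b 1 c] that False b_pos b_less_1 by simp
      show "AE x in lborel. 0 \<le> h c x"
        using that b_pos by (auto simp: h_def indicator_def)
    qed (use G that in \<open>auto simp: h_def[abs_def]\<close>)
  qed (simp add: h_def[abs_def] has_bochner_integral_zero)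
  have v_eq: "v x * exp (- \<bar>x\<bar>) ^ k = (h (real k + 1) x - h (real k) x) / Gamma (1 - b)" for x and k :: nat
  proof (cases "0 < x")
    case True
    have "exp (- \<bar>x\<bar>) ^ k = exp (- (real k * x))" "exp (- ((real k + 1) * x)) = exp (- (real k * x)) * exp (- x)"
      using True by (auto simp: exp_of_nat_mult[symmetric] exp_add[symmetric] algebra_simps)
    then show ?thesis using True by (simp add: v_def h_def diff_divide_distrib algebra_simps)
  qed (simp add: v_def h_def)
  have v_int: "has_bochner_integral lborel (\<lambda>x. v x * exp (- \<bar>x\<bar>) ^ k) ((real k + 1) powr b - real k powr b)" for k
  proof -
    have "has_bochner_integral lborel (\<lambda>x. (h (real k + 1) x - h (real k) x) / Gamma (1 - b))
      ((Gamma (1 - b) * (real k + 1) powr b - Gamma (1 - b) * real k powr b) / Gamma (1 - b))"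
      by (intro has_bochner_integral_divide has_bochner_integral_diff h) auto
    then show ?thesis using G unfolding v_eq by (simp add: right_diff_distrib[symmetric])
  qed
  \<comment> \<open>First-order expansion of 1 - exp(-s) at
    \<open>s = (c / R) powr b\<close>.\<close>
  have lim: "((\<lambda>R. R powr b * (1 - exp (- ((c / R) powr b)))) \<longlongrightarrow> c powr b) at_top" if "0 \<le> c" for c
  proof (cases "c = 0")
    case False
    then have "0 < c" using that by simp
    have "((\<lambda>y::real. y * (1 - exp (- (1 / y)))) \<longlongrightarrow> 1) at_top"
      by real_asymp
    moreover have "filterlim (\<lambda>R. (R / c) powr b) at_top at_top"
      using \<open>0 < c\<close> b_pos by real_asymp
    ultimately have "((\<lambda>R. (R / c) powr b * (1 - exp (- (1 / (R / c) powr b)))) \<longlongrightarrow> 1) at_top"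
      by (rule filterlim_compose)
    then have "((\<lambda>R. c powr b * ((R / c) powr b * (1 - exp (- (1 / (R / c) powr b))))) \<longlongrightarrow> c powr b * 1) at_top"
      by (intro tendsto_intros)
    moreover have "\<forall>\<^sub>F R in at_top. c powr b * ((R / c) powr b * (1 - exp (- (1 / (R / c) powr b)))) = R powr b * (1 - exp (- ((c / R) powr b)))"
      using eventually_gt_at_top[of 0] by eventually_elim (use \<open>0 < c\<close> in \<open>simp add: powr_divide\<close>)
    ultimately show ?thesis
      by (simp add: tendsto_cong)
  qed simp
  have moments: "((\<lambda>R. \<integral>x. \<bar>R\<bar> powr b * (1 - exp (- (\<bar>x\<bar> / \<bar>R\<bar>))) * exp (- (\<bar>x\<bar> / \<bar>R\<bar>)) ^ k \<partial>M)
      \<longlongrightarrow> (\<integral>x. v x * exp (- \<bar>x\<bar>) ^ k \<partial>lborel)) at_top" for k :: nat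
  proof -
    have "((\<lambda>R. R powr b * (1 - exp (- (((real k + 1) / R) powr b))) - R powr b * (1 - exp (- ((real k / R) powr b))))
        \<longlongrightarrow> (real k + 1) powr b - real k powr b) at_top"
      by (intro tendsto_diff lim) auto
    moreover have "\<forall>\<^sub>F R in at_top. R powr b * (1 - exp (- (((real k + 1) / R) powr b))) - R powr b * (1 - exp (- ((real k / R) powr b)))
        = (\<integral>x. \<bar>R\<bar> powr b * (1 - exp (- (\<bar>x\<bar> / \<bar>R\<bar>))) * exp (- (\<bar>x\<bar> / \<bar>R\<bar>)) ^ k \<partial>M)"
      using eventually_gt_at_top[of 0]
    proof eventually_elim
      case (elim R)
      have "(\<integral>x. \<bar>R\<bar> powr b * (1 - exp (- (\<bar>x\<bar> / \<bar>R\<bar>))) * exp (- (\<bar>x\<bar> / \<bar>R\<bar>)) ^ k \<partial>M)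
        = (\<integral>x. R powr b * (exp (- (real k / R * x)) - exp (- ((real k + 1) / R * x))) \<partial>M)"
      proof (rule integral_cong_AE)
        show "AE x in M. \<bar>R\<bar> powr b * (1 - exp (- (\<bar>x\<bar> / \<bar>R\<bar>))) * exp (- (\<bar>x\<bar> / \<bar>R\<bar>)) ^ k
          = R powr b * (exp (- (real k / R * x)) - exp (- ((real k + 1) / R * x)))"
          using AE_nonneg
          by eventually_elim
            (use elim in \<open>simp add: exp_of_nat_mult[symmetric] left_diff_distrib exp_add[symmetric] add_divide_distrib distrib_right algebra_simps\<close>)
      qed measurable
      also have "\<dots> = R powr b * (exp (- ((real k / R) powr b)) - exp (- (((real k + 1) / R) powr b)))"
        using elim integrable_exp[of "real k / R"] integrable_exp[of "(real k + 1) / R"]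
          laplace_nonneg[of "real k / R"] laplace_nonneg[of "(real k + 1) / R"] by simp
      finally show ?case by (simp add: algebra_simps)
    qed
    ultimately show ?thesis
      using v_int[of k] by (simp add: has_bochner_integral_integral_eq tendsto_cong)
  qed
  have "((\<lambda>R. \<integral>x. \<bar>R\<bar> powr b * (1 - exp (- (\<bar>x\<bar> / \<bar>R\<bar>))) * \<phi> (exp (- (\<bar>x\<bar> / \<bar>R\<bar>))) \<partial>M) \<longlongrightarrow>
    (\<integral>x. v x * \<phi> (exp (- \<bar>x\<bar>)) \<partial>lborel)) at_top"
  \<comment> \<open>The absolute values serve here: nonnegative weights and arguments in [0,1] are
    required for every \<open>R\<close>, and on the Lebesgue side for negative \<open>x\<close> as
    well.\<close>
  proof (rule tendsto_integral_of_moments[OF _ _ _ _ _ _ _ _ moments \<phi>])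
    show "integrable lborel v"
      using v_int[of 0] by (simp add: has_bochner_integral_iff)
    show "integrable M (\<lambda>x. \<bar>R\<bar> powr b * (1 - exp (- (\<bar>x\<bar> / \<bar>R\<bar>))))" for R
      by (intro integrable_mult_right Bochner_Integration.integrable_diff integrable_const integrable_const_bound[of _ 1])
         auto
    show "AE x in lborel. 0 \<le> v x"
      using G b_pos by (auto simp: v_def indicator_def)
  qed auto
  then show ?thesis by (simp add: v_def)
qed

text \<open>Ramps in exp(-x/R) squeeze the tail indicator. Divided by the weight 1 - exp(-x/R), a
  ramp becomes a continuous test function to which the smoothed limit applies. Its limit lies
  between \<open>p powr (- b) / Gamma (1 - b)\<close> and
  \<open>q powr (- b) / Gamma (1 - b)\<close>, and only afterwards do \<open>p\<close> and
  \<open>q\<close> approach 1.\<close>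

lemma tail_tendsto: "((\<lambda>R. R powr b * prob {R<..}) \<longlongrightarrow> 1 / Gamma (1 - b)) at_top"
proof -
  \<comment> \<open>The ramp vanishes for \<open>u \<ge> exp (- q)\<close>, and for smaller
    \<open>u\<close> the maximum equals \<open>1 - u\<close>. The floor thus leaves the quotient by
    \<open>1 - u\<close> unaltered while keeping the denominator away from 0 near
    \<open>u = 1\<close>.\<close>
  define \<phi> where "\<phi> p q u = cts_step (exp (- p)) (exp (- q)) u / max (1 - u) (1 - exp (- q))" for p q u :: real
  define I where "I p q R = (\<integral>x. \<bar>R\<bar> powr b * (1 - exp (- (\<bar>x\<bar> / \<bar>R\<bar>))) * \<phi> p q (exp (- (\<bar>x\<bar> / \<bar>R\<bar>))) \<partial>M)" for p q R
  define \<Lambda> where "\<Lambda> p q = (\<integral>x. indicator {0<..} x * (b * x powr (- 1 - b) * (1 - exp (- x)) / Gamma (1 - b)) * \<phi> p q (exp (- \<bar>x\<bar>)) \<partial>lborel)" for p q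
  have G: "0 < Gamma (1 - b)" using b_less_1 by (intro Gamma_real_pos) simp
  have \<phi>_mult: "(1 - u) * \<phi> p q u = cts_step (exp (- p)) (exp (- q)) u" if "0 < q" "q < p" "u \<le> 1" for p q u
  proof (cases "u < exp (- q)")
    case True
    then have "max (1 - u) (1 - exp (- q)) = 1 - u" "1 - u \<noteq> 0"
      using that(1) by (auto simp: max_def)
    then show ?thesis by (simp add: \<phi>_def)
  next
    case False
    moreover have "exp (- p) < exp (- q)" using that by simp
    ultimately have "\<not> u \<le> exp (- p)" "exp (- q) \<le> u" by linarith+
    then show ?thesis by (simp add: \<phi>_def cts_step_def)
  qed
  have \<phi>_cont: "continuous_on UNIV (\<phi> p q)" if "0 < q" "q < p" for p q
  proof -
    have "max (1 - u) (1 - exp (- q)) \<noteq> 0" for u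
      using that(1) by (smt (verit) exp_less_one_iff)
    then show ?thesis
      unfolding \<phi>_def using that by (intro continuous_intros continuous_on_cts_step) auto
  qed
  have I_lim: "(I p q \<longlongrightarrow> \<Lambda> p q) at_top" if "0 < q" "q < p" for p q
    unfolding I_def \<Lambda>_def by (rule tendsto_smoothed_tail[OF \<phi>_cont[OF that]])
  have I_eq: "I p q R = R powr b * (\<integral>x. cts_step (exp (- p)) (exp (- q)) (exp (- (\<bar>x\<bar> / R))) \<partial>M)"
    if "0 < q" "q < p" "0 < R" for p q R
    using that by (simp add: I_def mult.assoc \<phi>_mult)
  have step_int: "integrable M (\<lambda>x. cts_step (exp (- p)) (exp (- q)) (exp (- (\<bar>x\<bar> / R))))" if "q < p" for p q R
  proof -
    have [measurable]: "cts_step (exp (- p)) (exp (- q)) \<in> borel_measurable borel"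
      using that by (intro borel_measurable_continuous_onI continuous_on_cts_step) simp
    show ?thesis
      using that by (intro integrable_const_bound[of _ 1]) (auto simp: cts_step_nonneg cts_step_le_1)
  qed
  have powr_int: "has_bochner_integral lborel (\<lambda>x. b * x powr (- 1 - b) * indicator {c<..} x / Gamma (1 - b)) (c powr (- b) / Gamma (1 - b))"
    if "0 < c" for c
  proof (intro has_bochner_integral_divide has_bochner_integral_nn_integral)
    have "(\<integral>\<^sup>+x. ennreal (b * x powr (- 1 - b) * indicator {c<..} x) \<partial>lborel)
      = (\<integral>\<^sup>+x. ennreal b * (ennreal (x powr (- 1 - b)) * indicator {c<..} x) \<partial>lborel)"
      using b_pos by (intro nn_integral_cong) (auto simp: indicator_def ennreal_mult)
    also have "\<dots> = ennreal (c powr (- b))"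
      using that b_pos by (subst nn_integral_cmult, measurable, subst nn_integral_powr_greaterThan)
        (auto simp: ennreal_mult[symmetric])
    finally show "(\<integral>\<^sup>+x. ennreal (b * x powr (- 1 - b) * indicator {c<..} x) \<partial>lborel) = ennreal (c powr (- b))" .
  qed (use b_pos in auto)
  have \<Lambda>_eq: "\<Lambda> p q = (\<integral>x. indicator {0<..} x * (b * x powr (- 1 - b) / Gamma (1 - b)) * cts_step (exp (- p)) (exp (- q)) (exp (- x)) \<partial>lborel)"
    if "0 < q" "q < p" for p q
    unfolding \<Lambda>_def
  proof (rule Bochner_Integration.integral_cong)
    fix x :: real
    show "indicator {0<..} x * (b * x powr (- 1 - b) * (1 - exp (- x)) / Gamma (1 - b)) * \<phi> p q (exp (- \<bar>x\<bar>))
      = indicator {0<..} x * (b * x powr (- 1 - b) / Gamma (1 - b)) * cts_step (exp (- p)) (exp (- q)) (exp (- x))"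
      using \<phi>_mult[OF that, of "exp (- x)", symmetric] by (simp add: indicator_def)
  qed simp
  have step_le: "indicator {0<..} x * (b * x powr (- 1 - b) / Gamma (1 - b)) * cts_step (exp (- p)) (exp (- q)) (exp (- x))
      \<le> b * x powr (- 1 - b) * indicator {q<..} x / Gamma (1 - b)" if "0 < q" "q < p" for p q x
  proof (cases "q < x")
    case True
    have "b * x powr (- 1 - b) / Gamma (1 - b) * cts_step (exp (- p)) (exp (- q)) (exp (- x)) \<le> b * x powr (- 1 - b) / Gamma (1 - b)"
      using that G b_pos by (intro mult_left_le cts_step_le_1) auto
    then show ?thesis using True that by simp
  next
    case False
    then have "cts_step (exp (- p)) (exp (- q)) (exp (- x)) = 0"
      using cts_step_exp_bounds(2)[OF that(2), of x] cts_step_nonneg[of "exp (- p)" "exp (- q)" "exp (- x)"] that(2)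
      by simp
    then show ?thesis using False by simp
  qed
  have \<Lambda>_int: "integrable lborel (\<lambda>x. indicator {0<..} x * (b * x powr (- 1 - b) / Gamma (1 - b)) * cts_step (exp (- p)) (exp (- q)) (exp (- x)))"
    if "0 < q" "q < p" for p q
  proof (rule Bochner_Integration.integrable_bound)
    have [measurable]: "cts_step (exp (- p)) (exp (- q)) \<in> borel_measurable borel"
      using that by (intro borel_measurable_continuous_onI continuous_on_cts_step) simp
    show "integrable lborel (\<lambda>x. b * x powr (- 1 - b) * indicator {q<..} x / Gamma (1 - b))"
      using powr_int[OF that(1)] by (simp add: has_bochner_integral_iff)
    show "AE x in lborel. norm (indicator {0<..} x * (b * x powr (- 1 - b) / Gamma (1 - b)) * cts_step (exp (- p)) (exp (- q)) (exp (- x)))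
      \<le> norm (b * x powr (- 1 - b) * indicator {q<..} x / Gamma (1 - b))"
    proof (rule AE_I2)
      fix x :: real
      have "0 \<le> indicator {0<..} x * (b * x powr (- 1 - b) / Gamma (1 - b)) * cts_step (exp (- p)) (exp (- q)) (exp (- x))"
        using that G b_pos by (simp add: cts_step_nonneg)
      then show "norm (indicator {0<..} x * (b * x powr (- 1 - b) / Gamma (1 - b)) * cts_step (exp (- p)) (exp (- q)) (exp (- x)))
        \<le> norm (b * x powr (- 1 - b) * indicator {q<..} x / Gamma (1 - b))"
        using step_le[OF that, of x] by (simp only: real_norm_def)
    qed
    show "(\<lambda>x. indicator {0<..} x * (b * x powr (- 1 - b) / Gamma (1 - b)) * cts_step (exp (- p)) (exp (- q)) (exp (- x))) \<in> borel_measurable lborel"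
      by measurable
  qed
  have \<Lambda>_le: "\<Lambda> p q \<le> q powr (- b) / Gamma (1 - b)" and \<Lambda>_ge: "p powr (- b) / Gamma (1 - b) \<le> \<Lambda> p q" if "0 < q" "q < p" for p q
  proof -
    have p: "0 < p" using that by simp
    note q' = powr_int[OF that(1), unfolded has_bochner_integral_iff]
    note p' = powr_int[OF p, unfolded has_bochner_integral_iff]
    have "\<Lambda> p q \<le> (\<integral>x. b * x powr (- 1 - b) * indicator {q<..} x / Gamma (1 - b) \<partial>lborel)"
      unfolding \<Lambda>_eq[OF that]
    proof (rule integral_mono)
      show "indicator {0<..} x * (b * x powr (- 1 - b) / Gamma (1 - b)) * cts_step (exp (- p)) (exp (- q)) (exp (- x))
        \<le> b * x powr (- 1 - b) * indicator {q<..} x / Gamma (1 - b)" for x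
        by (rule step_le[OF that])
    qed (use \<Lambda>_int[OF that] q' in auto)
    then show "\<Lambda> p q \<le> q powr (- b) / Gamma (1 - b)" by (simp only: conjunct2[OF q'])
    have "(\<integral>x. b * x powr (- 1 - b) * indicator {p<..} x / Gamma (1 - b) \<partial>lborel) \<le> \<Lambda> p q"
      unfolding \<Lambda>_eq[OF that]
    proof (rule integral_mono)
      show "b * x powr (- 1 - b) * indicator {p<..} x / Gamma (1 - b) \<le>
        indicator {0<..} x * (b * x powr (- 1 - b) / Gamma (1 - b)) * cts_step (exp (- p)) (exp (- q)) (exp (- x))" for x
      proof (cases "p < x")
        case True
        then have "cts_step (exp (- p)) (exp (- q)) (exp (- x)) = 1" by (simp add: cts_step_def)
        then show ?thesis using True p by simp
      qed (use that G b_pos in \<open>auto simp: cts_step_nonneg indicator_def\<close>)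
    qed (use \<Lambda>_int[OF that] p' in auto)
    then show "p powr (- b) / Gamma (1 - b) \<le> \<Lambda> p q" by (simp only: conjunct2[OF p'])
  qed
  have cts: "isCont (\<lambda>q. q powr (- b) / Gamma (1 - b)) 1"
    using G by (auto intro!: continuous_intros)
  show ?thesis
  proof (rule order_tendstoI)
    \<comment> \<open>Upper estimate: a ramp that reaches 1 at \<open>p = 1\<close> and starts at
      \<open>q < 1\<close> dominates the indicator; \<open>q\<close> is taken so close to 1 that the
      limit stays below \<open>a\<close>.\<close>
    fix a assume a: "1 / Gamma (1 - b) < a"
    have "((\<lambda>q. q powr (- b) / Gamma (1 - b)) \<longlongrightarrow> 1 powr (- b) / Gamma (1 - b)) (at_left 1)"
      using cts by (simp add: isCont_def filterlim_at_split)
    then have "\<forall>\<^sub>F q in at_left 1. q powr (- b) / Gamma (1 - b) < a"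
      using a by (auto dest: order_tendstoD)
    moreover have "\<forall>\<^sub>F q in at_left (1::real). 0 < q \<and> q < 1"
      by (auto simp: eventually_at_left_field intro!: exI[of _ 0])
    ultimately obtain q where q: "q powr (- b) / Gamma (1 - b) < a" "0 < q" "q < 1"
      using eventually_happens[OF eventually_conj] by (metis (no_types, lifting) trivial_limit_at_left_real)
    have "\<forall>\<^sub>F R in at_top. I 1 q R < a"
      using I_lim[OF q(2,3)] \<Lambda>_le[OF q(2,3)] q(1) by (auto dest!: order_tendstoD(2))
    then show "\<forall>\<^sub>F R in at_top. R powr b * prob {R<..} < a"
      using eventually_gt_at_top[of 0]
    proof eventually_elim
      case (elim R)
      have "prob {R<..} = (\<integral>x. indicator {R<..} x \<partial>M)" by simp
      also have "\<dots> \<le> (\<integral>x. cts_step (exp (- 1)) (exp (- q)) (exp (- (\<bar>x\<bar> / R))) \<partial>M)"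
      proof (rule integral_mono)
        show "indicator {R<..} x \<le> cts_step (exp (- 1)) (exp (- q)) (exp (- (\<bar>x\<bar> / R)))" for x
          using order_trans[OF _ cts_step_exp_bounds(1)[OF q(3)], of "indicator {R<..} x" "\<bar>x\<bar> / R"] elim(2)
          by (auto simp: indicator_def field_simps)
      qed (use step_int[OF q(3)] in \<open>auto intro: integrable_real_indicator simp: emeasure_eq_measure\<close>)
      finally have "R powr b * prob {R<..} \<le> I 1 q R"
        using I_eq[OF q(2,3) elim(2)] by (simp add: mult_left_mono)
      then show ?case using elim(1) by simp
    qed
  next
    \<comment> \<open>Lower estimate: a ramp that starts at \<open>q = 1\<close> and reaches 1 at
      some \<open>p > 1\<close> lies below the indicator.\<close>
    fix a assume a: "a < 1 / Gamma (1 - b)"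
    have "((\<lambda>q. q powr (- b) / Gamma (1 - b)) \<longlongrightarrow> 1 powr (- b) / Gamma (1 - b)) (at_right 1)"
      using cts by (simp add: isCont_def filterlim_at_split)
    then have "\<forall>\<^sub>F p in at_right 1. a < p powr (- b) / Gamma (1 - b)"
      using a by (auto dest: order_tendstoD)
    moreover have "\<forall>\<^sub>F p in at_right (1::real). 1 < p"
      by (auto simp: eventually_at_right_field intro!: exI[of _ 2])
    ultimately obtain p where p: "a < p powr (- b) / Gamma (1 - b)" "1 < p"
      using eventually_happens[OF eventually_conj] by (metis (no_types, lifting) trivial_limit_at_right_real)
    have "\<forall>\<^sub>F R in at_top. a < I p 1 R"
      using I_lim[of 1 p] \<Lambda>_ge[of 1 p] p by (auto dest!: order_tendstoD(1))
    then show "\<forall>\<^sub>F R in at_top. a < R powr b * prob {R<..}"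
      using eventually_gt_at_top[of 0]
    proof eventually_elim
      case (elim R)
      have "(\<integral>x. cts_step (exp (- p)) (exp (- 1)) (exp (- (\<bar>x\<bar> / R))) \<partial>M) \<le> (\<integral>x. indicator {R<..} x \<partial>M)"
      proof (rule integral_mono_AE)
        show "AE x in M. cts_step (exp (- p)) (exp (- 1)) (exp (- (\<bar>x\<bar> / R))) \<le> indicator {R<..} x"
          using AE_nonneg
        proof eventually_elim
          case (elim x)
          then show ?case
            using order_trans[OF cts_step_exp_bounds(2)[OF p(2)], of "\<bar>x\<bar> / R" "indicator {R<..} x"] \<open>0 < R\<close>
            by (auto simp: indicator_def field_simps)
        qed
      qed (use step_int[OF p(2)] in \<open>auto intro: integrable_real_indicator simp: emeasure_eq_measure\<close>)
      then have "I p 1 R \<le> R powr b * prob {R<..}"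
        using I_eq[of 1 p R] elim(2) p(2) by (simp add: mult_left_mono)
      then show ?case using elim(1) by simp
    qed
  qed
qed

end

section \<open>Existence of one-sided stable laws\<close>

text \<open>Up to the constant \<open>Gamma (1 - g)\<close>, this is the Levy density of the stable
  law of index \<open>g\<close>, cut off at 1, where the remaining mass is 1.\<close>

definition pareto_measure :: "real \<Rightarrow> real measure" where
  "pareto_measure g = density lborel (\<lambda>x. ennreal (g * x powr (- 1 - g)) * indicator {1<..} x)"

lemma sets_pareto_measure [simp, measurable_cong]: "sets (pareto_measure g) = sets borel"
  and space_pareto_measure [simp]: "space (pareto_measure g) = UNIV"
  by (simp_all add: pareto_measure_def)

lemma prob_space_pareto_measure:
  assumes "0 < g"
  shows "prob_space (pareto_measure g)"
proof
  have "emeasure (pareto_measure g) (space (pareto_measure g))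
    = (\<integral>\<^sup>+x. ennreal g * (ennreal (x powr (- 1 - g)) * indicator {1<..} x) \<partial>lborel)"
    unfolding pareto_measure_def
    using assms by (simp add: emeasure_density) (auto simp: ennreal_mult mult.assoc intro!: nn_integral_cong)
  also have "\<dots> = 1"
    using assms by (subst nn_integral_cmult, measurable, subst nn_integral_powr_greaterThan)
      (auto simp: ennreal_mult[symmetric])
  finally show "emeasure (pareto_measure g) (space (pareto_measure g)) = 1" .
qed

text \<open>Without the cut-off the integral would be exactly
  \<open>Gamma (1 - g) * r powr g\<close>. By 1 - exp(-s) \<le> s, the missing part over (0,1) is at
  most \<open>r * g / (1 - g)\<close>, which is of smaller order as \<open>r\<close> tends to 0
  because \<open>g < 1\<close>.\<close>

lemma pareto_laplace_bounds:
  assumes g: "0 < g" "g < 1" and r: "0 < r"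
  shows "(\<integral>x. 1 - exp (- (r * \<bar>x\<bar>)) \<partial>pareto_measure g) \<le> Gamma (1 - g) * r powr g"
    and "Gamma (1 - g) * r powr g - r * g / (1 - g) \<le> (\<integral>x. 1 - exp (- (r * \<bar>x\<bar>)) \<partial>pareto_measure g)"
proof -
  interpret prob_space "pareto_measure g" by (rule prob_space_pareto_measure) fact
  define c where "c = (\<integral>x. 1 - exp (- (r * \<bar>x\<bar>)) \<partial>pareto_measure g)"
  define f where "f x = ennreal (g * x powr (- 1 - g) * (1 - exp (- (r * x powr 1))))" for x
  have G: "0 < Gamma (1 - g)" using g by (intro Gamma_real_pos) simp
  have int: "integrable (pareto_measure g) (\<lambda>x. 1 - exp (- (r * \<bar>x\<bar>)))"
    using r by (intro integrable_const_bound[of _ 1]) auto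
  have "ennreal c = (\<integral>\<^sup>+x. ennreal (1 - exp (- (r * \<bar>x\<bar>))) \<partial>pareto_measure g)"
    unfolding c_def using int r by (subst nn_integral_eq_integral) auto
  also have "\<dots> = (\<integral>\<^sup>+x. f x * indicator {1<..} x \<partial>lborel)"
    unfolding pareto_measure_def f_def using g
    by (subst nn_integral_density) (auto intro!: nn_integral_cong simp: ennreal_mult' indicator_def)
  finally have c: "ennreal c = (\<integral>\<^sup>+x. f x * indicator {1<..} x \<partial>lborel)" .
  have c0: "0 \<le> c" unfolding c_def using r by (intro integral_nonneg_AE) auto
  have [measurable]: "f \<in> borel_measurable borel" by (simp add: f_def[abs_def])
  have total: "(\<integral>\<^sup>+x. f x * indicator {0<..} x \<partial>lborel) = ennreal (Gamma (1 - g) * r powr g)"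
    using nn_integral_powr_one_minus_exp[of g 1 r] g r by (simp add: f_def)
  have "(\<integral>\<^sup>+x. f x * indicator {1<..} x \<partial>lborel) \<le> (\<integral>\<^sup>+x. f x * indicator {0<..} x \<partial>lborel)"
    by (intro nn_integral_mono) (auto simp: indicator_def)
  then show "c \<le> Gamma (1 - g) * r powr g"
    using G unfolding c[symmetric] total by (subst (asm) ennreal_le_iff) auto
  have "(\<integral>\<^sup>+x. f x * indicator {0<..<1} x \<partial>lborel)
    \<le> (\<integral>\<^sup>+x. ennreal (r * g) * (ennreal (x powr (1 - g - 1)) * indicator {0<..<1} x) \<partial>lborel)"
  proof (intro nn_integral_mono)
    fix x :: real
    show "f x * indicator {0<..<1} x \<le> ennreal (r * g) * (ennreal (x powr (1 - g - 1)) * indicator {0<..<1} x)"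
    proof (cases "0 < x \<and> x < 1")
      case True
      have "g * x powr (- 1 - g) * (1 - exp (- (r * x))) \<le> g * x powr (- 1 - g) * (r * x)"
        using exp_ge_add_one_self[of "- (r * x)"] g by (intro mult_left_mono) auto
      also have "\<dots> = r * g * (x powr 1 * x powr (- 1 - g))" using True by simp
      also have "\<dots> = r * g * x powr (1 - g - 1)" unfolding powr_add[symmetric] by simp
      finally show ?thesis
        using True r g by (simp add: f_def ennreal_mult[symmetric])
    qed (auto simp: indicator_def)
  qed
  also have "\<dots> = ennreal (r * g / (1 - g))"
    using g r by (subst nn_integral_cmult, measurable, subst nn_integral_powr_lessThan)
      (auto simp: ennreal_mult[symmetric])
  finally have small: "(\<integral>\<^sup>+x. f x * indicator {0<..<1} x \<partial>lborel) \<le> ennreal (r * g / (1 - g))" .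
  have "(\<integral>\<^sup>+x. f x * indicator {0<..} x \<partial>lborel)
    = (\<integral>\<^sup>+x. f x * indicator {0<..<1} x + f x * indicator {1<..} x \<partial>lborel)"
    by (intro nn_integral_cong_AE, use AE_lborel_singleton[of 1] in eventually_elim) (auto simp: indicator_def)
  also have "\<dots> = (\<integral>\<^sup>+x. f x * indicator {0<..<1} x \<partial>lborel) + ennreal c"
    unfolding c by (rule nn_integral_add) auto
  also have "\<dots> \<le> ennreal (r * g / (1 - g)) + ennreal c"
    by (rule add_right_mono[OF small])
  also have "\<dots> = ennreal (r * g / (1 - g) + c)"
    using r g c0 by simp
  finally show "Gamma (1 - g) * r powr g - r * g / (1 - g) \<le> c"
    unfolding total using r g c0 G by (subst (asm) ennreal_le_iff) auto
qed

text \<open>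
  Pareto variables lie in the domain of attraction of the stable law; it arises here as a weak limit
  of their normalised sums.
\<close>

theorem one_sided_stable_exists:
  assumes g: "0 < g" "g < 1"
  shows "\<exists>M. one_sided_stable M g"
proof -
  let ?P = "pareto_measure g"
  interpret P: prob_space ?P by (rule prob_space_pareto_measure) fact
  interpret PS: product_sigma_finite "\<lambda>_::nat. ?P" ..
  \<comment> \<open>Norming: \<open>Suc m\<close> contributions of size
    \<open>Gamma (1 - g) * (r / s (Suc m)) powr g\<close> add up to \<open>r powr g\<close>. The
    sums below have \<open>Suc m\<close> terms because \<open>s 0 = 0\<close>.\<close>
  define s where "s m = (Gamma (1 - g) * real m) powr (1 / g)" for m :: nat
  define N where "N m = distr (\<Pi>\<^sub>M i\<in>{..<Suc m}. ?P) borel (\<lambda>x. (\<Sum>i<Suc m. \<bar>x i\<bar>) / s (Suc m))" for m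
  define c where "c r = (\<integral>x. 1 - exp (- (r * \<bar>x\<bar>)) \<partial>?P)" for r
  have G: "0 < Gamma (1 - g)" using g by (intro Gamma_real_pos) simp
  have s_pos: "0 < s (Suc m)" for m using G by (simp add: s_def)
  have s_powr: "s (Suc m) powr g = Gamma (1 - g) * real (Suc m)" for m
    using G g by (simp add: s_def powr_powr)
  have [measurable]: "(\<lambda>x. (\<Sum>i<Suc m. \<bar>x i\<bar>) / s (Suc m)) \<in> borel_measurable (\<Pi>\<^sub>M i\<in>{..<Suc m}. ?P)" for m
    by measurable
  have N_dist: "real_distribution (N m)" for m
  proof -
    interpret Q: prob_space "\<Pi>\<^sub>M i\<in>{..<Suc m}. ?P" by (intro prob_space_PiM P.prob_space_axioms)
    show ?thesis unfolding N_def by (rule Q.real_distribution_distr) measurable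
  qed
  have N_nonneg: "AE y in N m. 0 \<le> y" for m
    unfolding N_def using s_pos[of m] by (subst AE_distr_iff) (auto intro!: sum_nonneg divide_nonneg_pos)
  have exp_int: "integrable ?P (\<lambda>x. exp (- (r * \<bar>x\<bar>)))" if "0 < r" for r
    using that by (intro P.integrable_const_bound[of _ 1]) auto
  have N_laplace: "(\<integral>y. exp (- (r * y)) \<partial>N m) = (1 - c (r / s (Suc m))) ^ Suc m" if "0 < r" for r m
  proof -
    define t where "t = r / s (Suc m)"
    have t: "0 < t" using that s_pos by (simp add: t_def)
    have prod: "exp (- (r * ((\<Sum>i<Suc m. \<bar>x i\<bar>) / s (Suc m)))) = (\<Prod>i<Suc m. exp (- (t * \<bar>x i\<bar>)))" for x :: "nat \<Rightarrow> real"
    proof -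
      have "- (r * ((\<Sum>i<Suc m. \<bar>x i\<bar>) / s (Suc m))) = (\<Sum>i<Suc m. - (t * \<bar>x i\<bar>))"
        unfolding t_def sum_negf sum_distrib_left[symmetric] by simp
      then show ?thesis by (simp only: exp_sum finite_lessThan)
    qed
    have "(\<integral>y. exp (- (r * y)) \<partial>N m) = (\<integral>x. (\<Prod>i<Suc m. exp (- (t * \<bar>x i\<bar>))) \<partial>(\<Pi>\<^sub>M i\<in>{..<Suc m}. ?P))"
      unfolding N_def
      by (subst integral_distr) (simp_all only: prod, measurable)
    also have "\<dots> = (\<Prod>i<Suc m. (\<integral>x. exp (- (t * \<bar>x\<bar>)) \<partial>?P))"
      by (rule PS.product_integral_prod) (use exp_int[OF t] in auto)
    also have "(\<integral>x. exp (- (t * \<bar>x\<bar>)) \<partial>?P) = 1 - c t"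
      using exp_int[OF t] P.prob_space by (simp add: c_def)
    finally show ?thesis by (simp add: t_def)
  qed
  have c_le: "real (Suc m) * c (r / s (Suc m)) \<le> r powr g" if "0 < r" for r m
  proof -
    have "c (r / s (Suc m)) \<le> Gamma (1 - g) * (r / s (Suc m)) powr g"
      unfolding c_def using that s_pos[of m] by (intro pareto_laplace_bounds g) simp
    also have "\<dots> = r powr g / real (Suc m)"
      using that s_pos[of m] s_powr[of m] G by (simp add: powr_divide)
    finally show ?thesis by (simp add: field_simps)
  qed
  have c_ge: "r powr g - real (Suc m) * (r / s (Suc m) * g / (1 - g)) \<le> real (Suc m) * c (r / s (Suc m))" if "0 < r" for r m
  proof -
    have "r powr g / real (Suc m) - r / s (Suc m) * g / (1 - g) = Gamma (1 - g) * (r / s (Suc m)) powr g - r / s (Suc m) * g / (1 - g)"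
      using that s_pos[of m] s_powr[of m] G by (simp add: powr_divide)
    also have "\<dots> \<le> c (r / s (Suc m))"
      unfolding c_def using that s_pos[of m] by (intro pareto_laplace_bounds g) simp
    finally have "real (Suc m) * (r powr g / real (Suc m) - r / s (Suc m) * g / (1 - g)) \<le> real (Suc m) * c (r / s (Suc m))"
      by (intro mult_left_mono) auto
    then show ?thesis by (simp only: right_diff_distrib) simp
  qed
  have c_bounds: "0 \<le> c r" "c r \<le> 1" if "0 < r" for r
  proof -
    show "0 \<le> c r" unfolding c_def using that by (intro integral_nonneg_AE) auto
    have "0 \<le> (\<integral>x. exp (- (r * \<bar>x\<bar>)) \<partial>?P)" by (intro integral_nonneg_AE) auto
    then show "c r \<le> 1" using exp_int[OF that] P.prob_space by (simp add: c_def)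
  qed
  have laplace_lim: "(\<lambda>m. \<integral>y. exp (- (r * y)) \<partial>N m) \<longlonglongrightarrow> exp (- (r powr g))" if r: "0 < r" for r
  proof -
    let ?a = "r powr g"
    have "(\<lambda>m. ?a - real (Suc m) * (r / s (Suc m) * g / (1 - g))) \<longlonglongrightarrow> ?a - 0"
    proof (intro tendsto_diff tendsto_const)
      \<comment> \<open>The exponent \<open>1 - 1 / g\<close> is negative, so the effect of cutting
        off at 1 disappears under the norming.\<close>
      have "(\<lambda>m. real (Suc m) powr (1 - 1 / g) * (r * g / (1 - g) / Gamma (1 - g) powr (1 / g))) \<longlonglongrightarrow> 0"
        using g by real_asymp
      moreover have "real (Suc m) * (r / s (Suc m) * g / (1 - g)) = real (Suc m) powr (1 - 1 / g) * (r * g / (1 - g) / Gamma (1 - g) powr (1 / g))" for m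
      proof -
        have "s (Suc m) = Gamma (1 - g) powr (1 / g) * real (Suc m) powr (1 / g)"
          "real (Suc m) powr (1 - 1 / g) = real (Suc m) / real (Suc m) powr (1 / g)"
          using G by (simp_all only: s_def powr_mult powr_diff powr_one of_nat_0_le_iff less_imp_le)
        then show ?thesis by (simp only: times_divide_eq_left times_divide_eq_right divide_divide_eq_left mult_ac)
      qed
      ultimately show "(\<lambda>m. real (Suc m) * (r / s (Suc m) * g / (1 - g))) \<longlonglongrightarrow> 0" by simp
    qed
    then have lower: "(\<lambda>m. ?a - real (Suc m) * (r / s (Suc m) * g / (1 - g))) \<longlonglongrightarrow> ?a" by (simp only: diff_0_right)
    have mc: "(\<lambda>m. real (Suc m) * c (r / s (Suc m))) \<longlonglongrightarrow> ?a"
    proof (rule tendsto_sandwich[OF _ _ lower tendsto_const])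
      show "\<forall>\<^sub>F m in sequentially. ?a - real (Suc m) * (r / s (Suc m) * g / (1 - g)) \<le> real (Suc m) * c (r / s (Suc m))"
        by (intro always_eventually allI c_ge[OF r])
      show "\<forall>\<^sub>F m in sequentially. real (Suc m) * c (r / s (Suc m)) \<le> ?a"
        by (intro always_eventually allI c_le[OF r])
    qed
    \<comment> \<open>For factors of modulus at most 1, the difference of two k-th powers is at most
      k times the difference of the bases. This compares the product with the exponential one factor
      at a time and leaves a second-order error.\<close>
    have "(\<lambda>m. (1 - c (r / s (Suc m))) ^ Suc m - exp (- (?a / real (Suc m))) ^ Suc m) \<longlonglongrightarrow> 0"
    proof (rule Lim_null_comparison)
      show "\<forall>\<^sub>F m in sequentially. norm ((1 - c (r / s (Suc m))) ^ Suc m - exp (- (?a / real (Suc m))) ^ Suc m)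
        \<le> \<bar>?a - real (Suc m) * c (r / s (Suc m))\<bar> + real (Suc m) * \<bar>1 - ?a / real (Suc m) - exp (- (?a / real (Suc m)))\<bar>"
      proof (intro always_eventually allI)
        fix m
        have "norm ((1 - c (r / s (Suc m))) ^ Suc m - exp (- (?a / real (Suc m))) ^ Suc m)
          \<le> real (Suc m) * norm ((1 - c (r / s (Suc m))) - exp (- (?a / real (Suc m))))"
          using c_bounds[of "r / s (Suc m)"] r s_pos[of m] by (intro norm_power_diff) auto
        also have "\<dots> = \<bar>real (Suc m) * (?a / real (Suc m) - c (r / s (Suc m))) + real (Suc m) * (1 - ?a / real (Suc m) - exp (- (?a / real (Suc m))))\<bar>"
        proof -
          have "real (Suc m) * norm ((1 - c (r / s (Suc m))) - exp (- (?a / real (Suc m)))) = \<bar>real (Suc m) * ((1 - c (r / s (Suc m))) - exp (- (?a / real (Suc m))))\<bar>"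
            by (simp only: abs_mult abs_of_nat real_norm_def)
          also have "real (Suc m) * ((1 - c (r / s (Suc m))) - exp (- (?a / real (Suc m))))
            = real (Suc m) * (?a / real (Suc m) - c (r / s (Suc m))) + real (Suc m) * (1 - ?a / real (Suc m) - exp (- (?a / real (Suc m))))"
            by (simp add: algebra_simps del: of_nat_Suc)
          finally show ?thesis .
        qed
        also have "\<dots> \<le> \<bar>real (Suc m) * (?a / real (Suc m) - c (r / s (Suc m)))\<bar> + real (Suc m) * \<bar>1 - ?a / real (Suc m) - exp (- (?a / real (Suc m)))\<bar>"
          by (rule order_trans[OF abs_triangle_ineq]) (simp add: abs_mult)
        also have "real (Suc m) * (?a / real (Suc m) - c (r / s (Suc m))) = ?a - real (Suc m) * c (r / s (Suc m))"
          by (simp add: right_diff_distrib)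
        finally show "norm ((1 - c (r / s (Suc m))) ^ Suc m - exp (- (?a / real (Suc m))) ^ Suc m)
          \<le> \<bar>?a - real (Suc m) * c (r / s (Suc m))\<bar> + real (Suc m) * \<bar>1 - ?a / real (Suc m) - exp (- (?a / real (Suc m)))\<bar>" .
      qed
      have "((\<lambda>x. x * (1 - a / x - exp (- (a / x)))) \<longlongrightarrow> 0) at_top" if "0 < a" for a :: real
        using that by real_asymp
      then have "((\<lambda>x. x * (1 - ?a / x - exp (- (?a / x)))) \<longlongrightarrow> 0) at_top"
        using r by simp
      then have "(\<lambda>m. real (Suc m) * (1 - ?a / real (Suc m) - exp (- (?a / real (Suc m))))) \<longlonglongrightarrow> 0"
        by (rule filterlim_compose) real_asymp
      then have "(\<lambda>m. real (Suc m) * \<bar>1 - ?a / real (Suc m) - exp (- (?a / real (Suc m)))\<bar>) \<longlonglongrightarrow> 0"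
        by (subst (asm) tendsto_rabs_zero_iff[symmetric]) (simp only: abs_mult abs_of_nat)
      moreover have "(\<lambda>m. \<bar>?a - real (Suc m) * c (r / s (Suc m))\<bar>) \<longlonglongrightarrow> \<bar>?a - ?a\<bar>"
        by (intro tendsto_intros mc)
      ultimately show "(\<lambda>m. \<bar>?a - real (Suc m) * c (r / s (Suc m))\<bar> + real (Suc m) * \<bar>1 - ?a / real (Suc m) - exp (- (?a / real (Suc m)))\<bar>) \<longlonglongrightarrow> 0"
        using tendsto_add by fastforce
    qed
    moreover have "exp (- (?a / real (Suc m))) ^ Suc m = exp (- ?a)" for m
      by (simp only: exp_of_nat_mult[symmetric]) simp
    ultimately show ?thesis
      using N_laplace[OF r] by (simp add: LIM_zero_iff del: power_Suc)
  qed
  have tail: "measure (N m) {K<..} \<le> K powr (- g) / (1 - exp (- 1))" if K: "0 < K" for K m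
  proof -
    have "(1 - exp (- 1)) * measure (N m) {K<..} \<le> 1 - (1 - c (1 / K / s (Suc m))) ^ Suc m"
      using laplace_tail_bound[OF N_dist N_nonneg K, of m] N_laplace[of "1 / K" m] K by simp
    also have "\<dots> \<le> real (Suc m) * c (1 / K / s (Suc m))"
      using Bernoulli_inequality[of "- c (1 / K / s (Suc m))" "Suc m"] c_bounds[of "1 / K / s (Suc m)"] K s_pos[of m]
      by (simp del: power_Suc)
    also have "\<dots> \<le> (1 / K) powr g" by (rule c_le) (use K in simp)
    also have "\<dots> = K powr (- g)" using K by (simp add: powr_divide powr_minus field_simps)
    finally show ?thesis by (simp add: field_simps)
  qed
  \<comment> \<open>The upper tails are bounded uniformly in \<open>m\<close> by the Laplace bound;
    any negative left endpoint works, as the laws do not charge the negative axis.\<close>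
  have "tight N"
    unfolding tight_def
  proof (intro conjI allI impI N_dist)
    fix \<epsilon> :: real assume \<epsilon>: "0 < \<epsilon>"
    have "((\<lambda>K. K powr (- g) / (1 - exp (- 1))) \<longlongrightarrow> 0) at_top"
      using g by real_asymp
    then have "\<forall>\<^sub>F K in at_top. K powr (- g) / (1 - exp (- 1)) < \<epsilon>"
      using \<epsilon> by (rule order_tendstoD)
    then have "\<forall>\<^sub>F K in at_top. K powr (- g) / (1 - exp (- 1)) < \<epsilon> \<and> 0 < K"
      using eventually_gt_at_top[of 0] by (rule eventually_conj)
    then obtain K where K: "K powr (- g) / (1 - exp (- 1)) < \<epsilon>" "0 < K"
      using eventually_happens by (metis (no_types, lifting) trivial_limit_at_top_linorder)
    have "1 - \<epsilon> < measure (N m) {- 1<..K}" for m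
    proof -
      interpret N: real_distribution "N m" by (rule N_dist)
      have "1 - measure (N m) {K<..} = measure (N m) {..K}"
        using N.prob_compl[of "{K<..}"] by (simp add: Compl_eq_Diff_UNIV[symmetric])
      also have "\<dots> = measure (N m) {- 1<..K}"
      proof (rule N.finite_measure_eq_AE)
        show "AE y in N m. y \<in> {..K} \<longleftrightarrow> y \<in> {- 1<..K}"
          using N_nonneg[of m] by eventually_elim auto
      qed auto
      finally show ?thesis using tail[OF K(2), of m] K(1) by linarith
    qed
    then show "\<exists>a b. a < b \<and> (\<forall>m. 1 - \<epsilon> < measure (N m) {a<..b})"
      using K(2) by (intro exI[of _ "- 1"] exI[of _ K]) auto
  qed
  \<comment> \<open>A subsequential weak limit is enough for existence, since
    \<open>laplace_lim\<close> holds along every subsequence.\<close>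
  from tight_imp_convergent_subsubsequence[OF this strict_mono_id]
  obtain \<rho> L where \<rho>: "strict_mono (\<rho> :: nat \<Rightarrow> nat)" and L: "real_distribution L" "weak_conv_m (N \<circ> id \<circ> \<rho>) L"
    by blast
  interpret L: real_distribution L by fact
  \<comment> \<open>\<open>exp (- (r * y))\<close> is unbounded on the negative axis;
    \<open>max 0\<close> makes it a bounded continuous test function without changing its integral
    under \<open>N m\<close>. Pushing the limit forward under \<open>max 0\<close> then also secures
    nonnegativity.\<close>
  have L_laplace: "(\<integral>y. exp (- (r * max 0 y)) \<partial>L) = exp (- (r powr g))" if "0 < r" for r
  proof -
    have "(\<lambda>m. \<integral>y. exp (- (r * max 0 y)) \<partial>(N \<circ> id \<circ> \<rho>) m) \<longlonglongrightarrow> (\<integral>y. exp (- (r * max 0 y)) \<partial>L)"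
    proof (rule weak_conv_imp_integral_bdd_continuous_conv[OF _ L, of _ 1])
      show "real_distribution ((N \<circ> id \<circ> \<rho>) m)" for m by (simp add: N_dist)
      show "isCont (\<lambda>y. exp (- (r * max 0 y))) y" for y by (intro continuous_intros)
    qed (use that in auto)
    moreover have "(\<integral>y. exp (- (r * max 0 y)) \<partial>N m) = (\<integral>y. exp (- (r * y)) \<partial>N m)" for m
    proof (rule integral_cong_AE)
      interpret N: real_distribution "N m" by (rule N_dist)
      show "(\<lambda>y. exp (- (r * max 0 y))) \<in> borel_measurable (N m)" "(\<lambda>y. exp (- (r * y))) \<in> borel_measurable (N m)"
        by measurable
      show "AE y in N m. exp (- (r * max 0 y)) = exp (- (r * y))"
        using N_nonneg[of m] by eventually_elim simp
    qed
    ultimately have "(\<lambda>m. \<integral>y. exp (- (r * y)) \<partial>N (\<rho> m)) \<longlonglongrightarrow> (\<integral>y. exp (- (r * max 0 y)) \<partial>L)" by simp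
    moreover have "(\<lambda>m. \<integral>y. exp (- (r * y)) \<partial>N (\<rho> m)) \<longlonglongrightarrow> exp (- (r powr g))"
      using LIMSEQ_subseq_LIMSEQ[OF laplace_lim[OF that] \<rho>] by (simp add: o_def)
    ultimately show ?thesis by (rule LIMSEQ_unique)
  qed
  have "real_distribution (distr L borel (max 0))"
    by (rule L.real_distribution_distr) measurable
  then have "one_sided_stable (distr L borel (max 0)) g"
    unfolding one_sided_stable_def one_sided_stable_axioms_def
    using g by (auto simp: AE_distr_iff integral_distr L_laplace)
  then show ?thesis by blast
qed

section \<open>Scaling limits of Gamma-kernel expectations\<close>

lemma has_bochner_integral_Gamma:
  assumes "0 < s"
  shows "has_bochner_integral lborel (\<lambda>t. indicator {0<..} t * (t powr (s - 1) * exp (- t))) (Gamma (s::real))"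
proof (rule has_bochner_integral_nn_integral)
  show "(\<integral>\<^sup>+t. ennreal (indicator {0<..} t * (t powr (s - 1) * exp (- t))) \<partial>lborel) = ennreal (Gamma s)"
    using nn_integral_Gamma[OF assms] by (simp add: ennreal_mult' ennreal_indicator mult.commute)
qed (use Gamma_real_pos[OF assms] in auto)

text \<open>For m = n/2 and u = |z|^2 / (4 v) this is the n-dimensional heat kernel at time v and
  point z, up to the factor |z|^(-n) \<pi>^(-n/2).\<close>

definition gamma_kernel :: "real \<Rightarrow> real \<Rightarrow> real" where
  "gamma_kernel m u = u powr m * exp (- u)"

definition gamma_kernel_deriv :: "real \<Rightarrow> real \<Rightarrow> real" where
  "gamma_kernel_deriv m u = m * (u powr (m - 1) * exp (- u)) - u powr m * exp (- u)"

lemma borel_measurable_gamma_kernel [measurable]: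
  "gamma_kernel m \<in> borel_measurable borel" "gamma_kernel_deriv m \<in> borel_measurable borel"
  unfolding gamma_kernel_def[abs_def] gamma_kernel_deriv_def[abs_def] by measurable

text \<open>The recursion gives
  \<open>m * Gamma (m + a) - Gamma (m + a + 1) = - a * Gamma (m + a)\<close>. Upper tails use
  \<open>a = - \<gamma>\<close>, lower tails \<open>a = \<gamma>\<close>; this is the origin of
  \<Gamma>(n/2 - \<gamma>) and \<Gamma>(n/2 + \<gamma>), and \<open>0 < m + a\<close> is the
  dimension condition n > 2 \<gamma> in the first case.\<close>

lemma gamma_kernel_deriv_moment:
  assumes "0 < m + a"
  shows "has_bochner_integral lborel (\<lambda>u. indicator {0<..} u * (gamma_kernel_deriv m u * u powr a)) (- a * Gamma (m + a))"
proof -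
  have "has_bochner_integral lborel (\<lambda>u. m * (indicator {0<..} u * (u powr (m + a - 1) * exp (- u)))
      - indicator {0<..} u * (u powr (m + a + 1 - 1) * exp (- u))) (m * Gamma (m + a) - Gamma (m + a + 1))"
    using assms by (intro has_bochner_integral_diff has_bochner_integral_mult_right has_bochner_integral_Gamma) auto
  moreover have "Gamma (m + a + 1) = (m + a) * Gamma (m + a)"
    using assms by (intro Gamma_plus1) (auto dest!: nonpos_Ints_nonpos)
  moreover have "m * (indicator {0<..} u * (u powr (m + a - 1) * exp (- u)))
      - indicator {0<..} u * (u powr (m + a + 1 - 1) * exp (- u)) = indicator {0<..} u * (gamma_kernel_deriv m u * u powr a)" for u :: real
    by (auto simp: gamma_kernel_deriv_def indicator_def powr_add powr_diff field_simps)
  ultimately show ?thesis by (simp add: algebra_simps)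
qed

lemma integrable_gamma_kernel_deriv:
  assumes "0 < m"
  shows "has_bochner_integral lborel (\<lambda>u. indicator {0<..} u * gamma_kernel_deriv m u) 0"
proof -
  have eq: "indicator {0<..} u * (gamma_kernel_deriv m u * u powr 0) = indicator {0<..} u * gamma_kernel_deriv m u" for u :: real
    by (auto simp: indicator_def)
  show ?thesis using gamma_kernel_deriv_moment[of m 0] assms unfolding eq by simp
qed

lemma integral_gamma_kernel_deriv_below:
  assumes m: "0 < m" and y: "0 < y"
  shows "(\<integral>u. indicator {0<..} u * gamma_kernel_deriv m u * indicator {..<y} u \<partial>lborel) = gamma_kernel m y"
proof -
  have "(gamma_kernel_deriv m has_integral gamma_kernel m y - gamma_kernel m 0) {0..y}"
  proof (rule fundamental_theorem_of_calculus_interior)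
    show "continuous_on {0..y} (gamma_kernel m)"
      unfolding gamma_kernel_def[abs_def] using m by (intro continuous_intros continuous_on_powr') auto
    show "(gamma_kernel m has_vector_derivative gamma_kernel_deriv m x) (at x)" if "x \<in> {0<..<y}" for x
      unfolding has_real_derivative_iff_has_vector_derivative[symmetric] gamma_kernel_def[abs_def] gamma_kernel_deriv_def
      using that by (auto intro!: derivative_eq_intros simp: powr_diff)
  qed (use y in simp)
  then have ftc: "integral {0..y} (gamma_kernel_deriv m) = gamma_kernel m y"
    by (auto dest!: integral_unique simp: gamma_kernel_def)
  have int: "integrable lborel (\<lambda>u. indicator {0<..} u * gamma_kernel_deriv m u * indicator {..<y} u)"
    using integrable_gamma_kernel_deriv[OF m]
    by (auto simp: has_bochner_integral_iff integrable_real_mult_indicator)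
  have ae: "AE u in lborel. indicator {0<..} u * gamma_kernel_deriv m u * indicator {..<y} u
      = indicator {0..y} u *\<^sub>R gamma_kernel_deriv m u"
    using AE_lborel_singleton[of y] AE_lborel_singleton[of 0]
    by eventually_elim (auto simp: indicator_def)
  have "set_integrable lborel {0..y} (gamma_kernel_deriv m)"
    unfolding set_integrable_def using int ae by (subst integrable_cong_AE[OF _ _ ae, symmetric]) auto
  then have "(LBINT u:{0..y}. gamma_kernel_deriv m u) = gamma_kernel m y"
    using set_borel_integral_eq_integral(2) ftc by metis
  then show ?thesis
    unfolding set_lebesgue_integral_def by (subst integral_cong_AE[OF _ _ ae]) auto
qed

text \<open>The kernel vanishes at 0 and at infinity, so its derivative has integral 0 and the part
  above \<open>y\<close> is minus the part below.\<close>

lemma integral_gamma_kernel_deriv_above: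
  assumes m: "0 < m" and y: "0 < y"
  shows "(\<integral>u. indicator {0<..} u * gamma_kernel_deriv m u * indicator {y<..} u \<partial>lborel) = - gamma_kernel m y"
proof -
  have total: "has_bochner_integral lborel (\<lambda>u. indicator {0<..} u * gamma_kernel_deriv m u) 0"
    by (rule integrable_gamma_kernel_deriv[OF m])
  then have int: "integrable lborel (\<lambda>u. indicator {0<..} u * gamma_kernel_deriv m u * indicator A u)" if "A \<in> sets borel" for A
    using that by (auto simp: has_bochner_integral_iff integrable_real_mult_indicator)
  have "(\<integral>u. indicator {0<..} u * gamma_kernel_deriv m u * indicator {..<y} u \<partial>lborel)
      + (\<integral>u. indicator {0<..} u * gamma_kernel_deriv m u * indicator {y<..} u \<partial>lborel)
    = (\<integral>u. indicator {0<..} u * gamma_kernel_deriv m u * indicator {..<y} u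
      + indicator {0<..} u * gamma_kernel_deriv m u * indicator {y<..} u \<partial>lborel)"
    by (rule Bochner_Integration.integral_add[symmetric]) (intro int; simp)+
  also have "\<dots> = (\<integral>u. indicator {0<..} u * gamma_kernel_deriv m u \<partial>lborel)"
    by (intro integral_cong_AE, measurable, use AE_lborel_singleton[of y] in eventually_elim) (auto simp: indicator_def)
  finally show ?thesis
    using total integral_gamma_kernel_deriv_below[OF m y] by (simp add: has_bochner_integral_iff)
qed

section \<open>Kernel expectations as integrals of tail probabilities\<close>

context prob_space
begin

text \<open>The kernel is the integral of its derivative from the left and minus that integral from
  the right. The first version reads off upper tails and suits small \<open>e\<close>, the second
  reads off lower tails and suits large \<open>e\<close>. The derivative changes sign, so Fubini
  rests on its integrability over the half-line.\<close>

lemma expectation_gamma_kernel: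
  assumes m: "0 < m" and e: "0 < e" and [measurable]: "T \<in> borel_measurable M" and pos: "AE x in M. 0 < T x"
  shows "expectation (\<lambda>x. gamma_kernel m (e * T x))
      = (\<integral>u. indicator {0<..} u * gamma_kernel_deriv m u * prob {x \<in> space M. u / e < T x} \<partial>lborel)" (is ?above)
    and "expectation (\<lambda>x. gamma_kernel m (e * T x))
      = - (\<integral>u. indicator {0<..} u * gamma_kernel_deriv m u * prob {x \<in> space M. T x < u / e} \<partial>lborel)" (is ?below)
proof -
  interpret P: pair_sigma_finite M lborel ..
  have int_k: "integrable lborel (\<lambda>u. indicator {0<..} u * gamma_kernel_deriv m u)"
    using integrable_gamma_kernel_deriv[OF m] by (simp add: has_bochner_integral_iff)
  have fubini: "(\<integral>x. \<integral>u. indicator {0<..} u * gamma_kernel_deriv m u * indicator (B x) u \<partial>lborel \<partial>M)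
      = (\<integral>u. indicator {0<..} u * gamma_kernel_deriv m u * prob {x \<in> space M. u \<in> B x} \<partial>lborel)"
    if B: "Measurable.pred (M \<Otimes>\<^sub>M lborel) (\<lambda>(x, u). u \<in> B x)" for B
  proof -
    have [measurable]: "(\<lambda>p. indicator (B (fst p)) (snd p) :: real) \<in> borel_measurable (M \<Otimes>\<^sub>M lborel)"
    proof -
      have "(\<lambda>p. indicator (B (fst p)) (snd p) :: real) = (\<lambda>p. indicator {p. snd p \<in> B (fst p)} p)"
        by (auto simp: indicator_def)
      also have "\<dots> \<in> borel_measurable (M \<Otimes>\<^sub>M lborel)"
        using B sets_pair_measure_cong[OF refl[of "sets M"] sets_lborel]
        by (intro borel_measurable_indicator') (auto simp: case_prod_beta pred_def)
      finally show ?thesis .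
    qed
    define f where "f p = indicator {0<..} (snd p) * gamma_kernel_deriv m (snd p) * indicator (B (fst p)) (snd p)" for p
    have f_meas: "f \<in> borel_measurable (M \<Otimes>\<^sub>M lborel)" unfolding f_def[abs_def] by measurable
    have "integrable (M \<Otimes>\<^sub>M lborel) f"
    proof (rule Bochner_Integration.integrable_bound[OF _ f_meas])
      show "integrable (M \<Otimes>\<^sub>M lborel) (\<lambda>p. indicator {0<..} (snd p) * gamma_kernel_deriv m (snd p))"
        by (rule P.Fubini_integrable) (use int_k in auto)
      show "AE p in M \<Otimes>\<^sub>M lborel. norm (f p) \<le> norm (indicator {0<..} (snd p) * gamma_kernel_deriv m (snd p))"
        by (intro AE_I2) (auto simp: f_def indicator_def)
    qed
    then have "integrable (M \<Otimes>\<^sub>M lborel) (\<lambda>(x, u). indicator {0<..} u * gamma_kernel_deriv m u * indicator (B x) u)"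
      by (simp add: f_def[abs_def] case_prod_beta')
    from P.Fubini_integral[OF this]
    have "(\<integral>x. \<integral>u. indicator {0<..} u * gamma_kernel_deriv m u * indicator (B x) u \<partial>lborel \<partial>M)
      = (\<integral>u. \<integral>x. indicator {0<..} u * gamma_kernel_deriv m u * indicator (B x) u \<partial>M \<partial>lborel)" by simp
    also have "\<dots> = (\<integral>u. indicator {0<..} u * gamma_kernel_deriv m u * prob {x \<in> space M. u \<in> B x} \<partial>lborel)"
    proof (rule Bochner_Integration.integral_cong[OF refl])
      fix u :: real
      have "(\<integral>x. indicator (B x) u \<partial>M) = (\<integral>x. indicator {x \<in> space M. u \<in> B x} x \<partial>M)"
        by (rule Bochner_Integration.integral_cong) (auto simp: indicator_def)
      also have "\<dots> = prob {x \<in> space M. u \<in> B x}"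
        by (simp add: Int_absorb2)
      finally show "(\<integral>x. indicator {0<..} u * gamma_kernel_deriv m u * indicator (B x) u \<partial>M)
        = indicator {0<..} u * gamma_kernel_deriv m u * prob {x \<in> space M. u \<in> B x}" by simp
    qed
    finally show ?thesis .
  qed
  have "expectation (\<lambda>x. gamma_kernel m (e * T x))
      = (\<integral>x. \<integral>u. indicator {0<..} u * gamma_kernel_deriv m u * indicator {..<e * T x} u \<partial>lborel \<partial>M)"
  proof (rule integral_cong_AE)
    show "(\<lambda>x. \<integral>u. indicator {0<..} u * gamma_kernel_deriv m u * indicator {..<e * T x} u \<partial>lborel) \<in> borel_measurable M"
      unfolding indicator_def lessThan_iff greaterThan_iff by measurable
    show "AE x in M. gamma_kernel m (e * T x) = (\<integral>u. indicator {0<..} u * gamma_kernel_deriv m u * indicator {..<e * T x} u \<partial>lborel)"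
      using pos by eventually_elim (use m e in \<open>simp add: integral_gamma_kernel_deriv_below\<close>)
  qed measurable
  also have "\<dots> = (\<integral>u. indicator {0<..} u * gamma_kernel_deriv m u * prob {x \<in> space M. u \<in> {..<e * T x}} \<partial>lborel)"
    by (rule fubini) simp
  also have "\<dots> = (\<integral>u. indicator {0<..} u * gamma_kernel_deriv m u * prob {x \<in> space M. u / e < T x} \<partial>lborel)"
    using e by (simp add: field_simps)
  finally show ?above .
  have "expectation (\<lambda>x. gamma_kernel m (e * T x))
      = (\<integral>x. - (\<integral>u. indicator {0<..} u * gamma_kernel_deriv m u * indicator {e * T x<..} u \<partial>lborel) \<partial>M)"
  proof (rule integral_cong_AE)
    show "(\<lambda>x. - (\<integral>u. indicator {0<..} u * gamma_kernel_deriv m u * indicator {e * T x<..} u \<partial>lborel)) \<in> borel_measurable M"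
      unfolding indicator_def lessThan_iff greaterThan_iff by measurable
    show "AE x in M. gamma_kernel m (e * T x) = - (\<integral>u. indicator {0<..} u * gamma_kernel_deriv m u * indicator {e * T x<..} u \<partial>lborel)"
      using pos by eventually_elim (use m e in \<open>simp add: integral_gamma_kernel_deriv_above\<close>)
  qed measurable
  also have "\<dots> = - (\<integral>u. indicator {0<..} u * gamma_kernel_deriv m u * prob {x \<in> space M. u \<in> {e * T x<..}} \<partial>lborel)"
    by (subst fubini[symmetric]) simp_all
  also have "\<dots> = - (\<integral>u. indicator {0<..} u * gamma_kernel_deriv m u * prob {x \<in> space M. T x < u / e} \<partial>lborel)"
    using e by (simp add: field_simps)
  finally show ?below .
qed

end

text \<open>Dominated convergence with majorant \<open>C * \<bar>w u\<bar>\<close>, available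
  because \<open>G\<close> is bounded at all positive arguments. The profile \<open>h u\<close> is
  \<open>u\<close> for upper tails and \<open>1 / u\<close> for lower tails.\<close>

lemma tendsto_integral_dilation:
  fixes G h w :: "real \<Rightarrow> real"
  assumes w: "integrable lborel (\<lambda>u. indicator {0<..} u * w u)"
    and [measurable]: "G \<in> borel_measurable borel" "h \<in> borel_measurable borel"
    and G: "(G \<longlongrightarrow> c) at_top" "\<And>x. 0 < x \<Longrightarrow> \<bar>G x\<bar> \<le> C"
    and h: "\<And>u. 0 < u \<Longrightarrow> 0 < h u"
  shows "((\<lambda>R. \<integral>u. indicator {0<..} u * w u * G (R * h u) \<partial>lborel) \<longlongrightarrow> (\<integral>u. indicator {0<..} u * w u \<partial>lborel) * c) at_top"
proof -
  have [measurable]: "(\<lambda>u. indicator {0<..} u * w u) \<in> borel_measurable borel"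
    using w by auto
  have "((\<lambda>R. \<integral>u. indicator {0<..} u * w u * G (R * h u) \<partial>lborel) \<longlongrightarrow> (\<integral>u. indicator {0<..} u * w u * c \<partial>lborel)) at_top"
  proof (rule integral_dominated_convergence_at_top[where w = "\<lambda>u. C * \<bar>indicator {0<..} u * w u\<bar>"])
    show "AE u in lborel. ((\<lambda>R. indicator {0<..} u * w u * G (R * h u)) \<longlongrightarrow> indicator {0<..} u * w u * c) at_top"
    proof (rule AE_I2)
      fix u :: real
      show "((\<lambda>R. indicator {0<..} u * w u * G (R * h u)) \<longlongrightarrow> indicator {0<..} u * w u * c) at_top"
      proof (cases "0 < u")
        case True
        have "filterlim (\<lambda>R. R * h u) at_top at_top"
          using h[OF True] by (intro filterlim_at_top_mult_tendsto_pos[OF tendsto_const]) (auto intro: filterlim_ident)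
        then show ?thesis by (intro tendsto_mult tendsto_const filterlim_compose[OF G(1)])
      qed simp
    qed
    show "\<forall>\<^sub>F R in at_top. AE u in lborel. norm (indicator {0<..} u * w u * G (R * h u)) \<le> C * \<bar>indicator {0<..} u * w u\<bar>"
      using eventually_gt_at_top[of 0]
    proof eventually_elim
      case (elim R)
      show ?case
      proof (rule AE_I2)
        fix u :: real
        show "norm (indicator {0<..} u * w u * G (R * h u)) \<le> C * \<bar>indicator {0<..} u * w u\<bar>"
        proof (cases "0 < u")
          case True
          then have "\<bar>w u\<bar> * \<bar>G (R * h u)\<bar> \<le> \<bar>w u\<bar> * C"
            using G(2)[of "R * h u"] h elim by (intro mult_left_mono) auto
          then show ?thesis using True by (simp add: abs_mult mult.commute)
        qed simp
      qed
    qed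
  qed (use w in auto)
  then show ?thesis by simp
qed

text \<open>Here the weight \<open>exp (- u) / u\<close> is not integrable at 0. Below
  \<open>1 / R\<close> the bound \<open>G x \<le> x powr m\<close> takes over and leaves at most
  \<open>1 / m\<close>; above 1 at most \<open>C * exp (- 1)\<close> remains. On
  \<open>[1 / R, 1]\<close> the measure du/u has mass \<open>ln R\<close>, and for most of it
  \<open>R * u\<close> is large, where \<open>G\<close> is close to \<open>c\<close>.\<close>

lemma tendsto_integral_dilation_log:
  fixes G :: "real \<Rightarrow> real"
  assumes [measurable]: "G \<in> borel_measurable borel"
    and G: "(G \<longlongrightarrow> c) at_top" "\<And>x. 0 < x \<Longrightarrow> \<bar>G x\<bar> \<le> C" "\<And>x. 0 < x \<Longrightarrow> \<bar>G x\<bar> \<le> x powr m" and m: "0 < m"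
  shows "((\<lambda>R. (\<integral>u. indicator {0<..} u * (exp (- u) / u * G (R * u)) \<partial>lborel) / ln R) \<longlongrightarrow> c) at_top"
proof -
  define f where "f R u = exp (- u) / u * G (R * u)" for R u
  have [measurable]: "f R \<in> borel_measurable borel" for R unfolding f_def[abs_def] by measurable
  have C: "0 \<le> C" using G(2)[of 1] by simp
  have low: "has_bochner_integral lborel (\<lambda>u. R powr m * (u powr (m - 1) * indicator {0<..<1 / R} u)) (1 / m)" if R: "0 < R" for R
  proof -
    have "has_bochner_integral lborel (\<lambda>u. R powr m * (u powr (m - 1) * indicator {0<..<1 / R} u)) (R powr m * ((1 / R) powr m / m))"
      using nn_integral_powr_lessThan[of m "1 / R"] R m
      by (intro has_bochner_integral_mult_right has_bochner_integral_nn_integral) (auto simp: ennreal_mult' ennreal_indicator)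
    then show ?thesis using R by (simp add: powr_divide)
  qed
  have high: "has_bochner_integral lborel (\<lambda>u. C * (exp (- u) * indicator {1<..} u)) (C * exp (- 1))"
    using nn_integral_exp_greaterThan[of 1]
    by (intro has_bochner_integral_mult_right has_bochner_integral_nn_integral) (auto simp: ennreal_mult' ennreal_indicator)
  have f_low: "\<bar>f R u\<bar> \<le> R powr m * u powr (m - 1)" if "0 < R" "0 < u" for R u
  proof -
    have "\<bar>f R u\<bar> \<le> 1 / u * (R * u) powr m"
      unfolding f_def abs_mult using that G(3)[of "R * u"]
      by (intro mult_mono) (auto simp: abs_mult divide_right_mono)
    also have "\<dots> = R powr m * u powr (m - 1)"
      using that by (simp add: powr_mult powr_diff)
    finally show ?thesis .
  qed
  have f_high: "\<bar>f R u\<bar> \<le> C * exp (- u)" if "0 < R" "1 < u" for R u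
  proof -
    have "\<bar>f R u\<bar> \<le> exp (- u) * C"
      unfolding f_def abs_mult using that G(2)[of "R * u"] C
      by (intro mult_mono) (auto simp: abs_mult divide_le_eq)
    then show ?thesis by (simp add: mult.commute)
  qed
  have mid: "set_integrable lborel {1 / R..1} (f R)" if R: "1 < R" for R
    unfolding set_integrable_def
  proof (rule Bochner_Integration.integrable_bound)
    show "integrable lborel (\<lambda>u. R * C * indicator {1 / R..1} u)"
      by (intro integrable_mult_right integrable_real_indicator) (auto simp: emeasure_lborel_Icc_eq)
    show "AE u in lborel. norm (indicator {1 / R..1} u *\<^sub>R f R u) \<le> norm (R * C * indicator {1 / R..1} u)"
    proof (rule AE_I2)
      fix u :: real
      show "norm (indicator {1 / R..1} u *\<^sub>R f R u) \<le> norm (R * C * indicator {1 / R..1} u)"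
      proof (cases "u \<in> {1 / R..1}")
        case True
        then have u: "0 < u" using R by (auto intro: less_le_trans[rotated])
        have "exp (- u) / u \<le> 1 / (1 / R)" using True u R by (intro frac_le) auto
        then have "\<bar>f R u\<bar> \<le> R * C"
          unfolding f_def abs_mult using u G(2)[of "R * u"] R C by (intro mult_mono) auto
        then show ?thesis using True R C by simp
      qed simp
    qed
  qed auto
  have low_int: "integrable lborel (\<lambda>u. f R u * indicator {0<..<1 / R} u)"
    and low_le: "\<bar>\<integral>u. f R u * indicator {0<..<1 / R} u \<partial>lborel\<bar> \<le> 1 / m" if R: "1 < R" for R
  proof -
    note low' = low[of R, OF order.strict_trans[OF zero_less_one R]]
    have bnd: "norm (f R u * indicator {0<..<1 / R} u) \<le> R powr m * (u powr (m - 1) * indicator {0<..<1 / R} u)" for u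
      using f_low[of R u] R by (auto simp: indicator_def)
    show *: "integrable lborel (\<lambda>u. f R u * indicator {0<..<1 / R} u)"
      by (rule Bochner_Integration.integrable_bound[OF integrable.intros[OF low']])
         (use bnd order_trans[OF bnd abs_ge_self] in auto)
    have "\<bar>\<integral>u. f R u * indicator {0<..<1 / R} u \<partial>lborel\<bar> \<le> (\<integral>u. \<bar>f R u * indicator {0<..<1 / R} u\<bar> \<partial>lborel)"
      by (rule integral_abs_bound)
    also have "\<dots> \<le> (\<integral>u. R powr m * (u powr (m - 1) * indicator {0<..<1 / R} u) \<partial>lborel)"
      using bnd low[of R] R * by (intro integral_mono) (auto simp: has_bochner_integral_iff)
    also have "\<dots> = 1 / m" by (rule has_bochner_integral_integral_eq[OF low]) (use R in simp)
    finally show "\<bar>\<integral>u. f R u * indicator {0<..<1 / R} u \<partial>lborel\<bar> \<le> 1 / m" .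
  qed
  have high_int: "integrable lborel (\<lambda>u. f R u * indicator {1<..} u)"
    and high_le: "\<bar>\<integral>u. f R u * indicator {1<..} u \<partial>lborel\<bar> \<le> C * exp (- 1)" if R: "1 < R" for R
  proof -
    have bnd: "norm (f R u * indicator {1<..} u) \<le> C * (exp (- u) * indicator {1<..} u)" for u
      using f_high[of R u] R by (auto simp: indicator_def)
    show *: "integrable lborel (\<lambda>u. f R u * indicator {1<..} u)"
      by (rule Bochner_Integration.integrable_bound[OF integrable.intros[OF high]])
         (use bnd order_trans[OF bnd abs_ge_self] in auto)
    have "\<bar>\<integral>u. f R u * indicator {1<..} u \<partial>lborel\<bar> \<le> (\<integral>u. \<bar>f R u * indicator {1<..} u\<bar> \<partial>lborel)"
      by (rule integral_abs_bound)
    also have "\<dots> \<le> (\<integral>u. C * (exp (- u) * indicator {1<..} u) \<partial>lborel)"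
      using bnd high * by (intro integral_mono) (auto simp: has_bochner_integral_iff)
    also have "\<dots> = C * exp (- 1)" by (rule has_bochner_integral_integral_eq[OF high])
    finally show "\<bar>\<integral>u. f R u * indicator {1<..} u \<partial>lborel\<bar> \<le> C * exp (- 1)" .
  qed
  \<comment> \<open>Only \<open>1/R \<le> u \<le> 1\<close> contributes to leading order; \<open>u = R\<^sup>t\<^sup>-\<^sup>1\<close> maps it to \<open>0 \<le> t \<le> 1\<close>.\<close>
  define J where "J R = (\<integral>t. indicator {0..1} t * (exp (- (R powr (t - 1))) * G (R powr t)) \<partial>lborel)" for R
  have mid_eq: "(LBINT u:{1 / R..1}. f R u) = ln R * J R" if R: "1 < R" for R
  proof -
    have "(LBINT u. f R u * indicator {R powr (0 - 1)..R powr (1 - 1)} u)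
      = (LBINT t. f R (R powr (t - 1)) * (ln R * R powr (t - 1)) * indicator {0..1} t)"
    proof (rule integral_substitution)
      show "set_integrable lborel {R powr (0 - 1)..R powr (1 - 1)} (f R)"
        using mid[OF R] R by (simp add: powr_minus field_simps)
      show "((\<lambda>t. R powr (t - 1)) has_real_derivative ln R * R powr (t - 1)) (at t)" for t
        using R by (auto intro!: derivative_eq_intros)
      show "continuous_on {0..1} (\<lambda>t. ln R * R powr (t - 1))"
        using R by (intro continuous_intros) auto
    qed (use R in auto)
    also have "\<dots> = (LBINT t. ln R * (indicator {0..1} t * (exp (- (R powr (t - 1))) * G (R powr t))))"
    proof (rule Bochner_Integration.integral_cong[OF refl])
      fix t :: real
      have "R * R powr (t - 1) = R powr t" using R by (simp add: powr_diff)
      then show "f R (R powr (t - 1)) * (ln R * R powr (t - 1)) * indicator {0..1} t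
        = ln R * (indicator {0..1} t * (exp (- (R powr (t - 1))) * G (R powr t)))"
        using R by (simp add: f_def)
    qed
    also have "\<dots> = ln R * J R" by (simp add: J_def)
    finally show ?thesis
      using R by (simp add: set_lebesgue_integral_def powr_minus field_simps)
  qed
  have "(J \<longlongrightarrow> (\<integral>t. indicator {0..1::real} t * c \<partial>lborel)) at_top"
    unfolding J_def[abs_def]
  proof (rule integral_dominated_convergence_at_top[where w = "\<lambda>t::real. C * indicator {0..1} t"])
    show "AE t in lborel. ((\<lambda>R. indicator {0..1} t * (exp (- (R powr (t - 1))) * G (R powr t))) \<longlongrightarrow> indicator {0..1} t * c) at_top"
      using AE_lborel_singleton[of 0] AE_lborel_singleton[of 1]
    proof eventually_elim
      case (elim t)
      show ?case
      proof (cases "t \<in> {0..1}")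
        case True
        then have t: "0 < t" "t < 1" using elim by auto
        have "((\<lambda>R. exp (- (R powr (t - 1)))) \<longlongrightarrow> 1) at_top" using t by real_asymp
        moreover have "filterlim (\<lambda>R. R powr t) at_top at_top" using t by real_asymp
        ultimately have "((\<lambda>R. exp (- (R powr (t - 1))) * G (R powr t)) \<longlongrightarrow> 1 * c) at_top"
          by (intro tendsto_mult filterlim_compose[OF G(1)])
        then show ?thesis using True by simp
      qed simp
    qed
    show "\<forall>\<^sub>F R in at_top. AE t in lborel. norm (indicator {0..1} t * (exp (- (R powr (t - 1))) * G (R powr t))) \<le> C * indicator {0..1} t"
      using eventually_gt_at_top[of 0]
    proof eventually_elim
      case (elim R)
      have "exp (- (R powr (t - 1))) * \<bar>G (R powr t)\<bar> \<le> 1 * C" for t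
        using G(2)[of "R powr t"] elim C by (intro mult_mono) auto
      then show ?case by (intro AE_I2) (auto simp: indicator_def abs_mult)
    qed
  qed auto
  then have J: "(J \<longlongrightarrow> c) at_top" by simp
  have "((\<lambda>R. ((\<integral>u. indicator {0<..} u * f R u \<partial>lborel) - ln R * J R) / ln R) \<longlongrightarrow> 0) at_top"
  proof (rule Lim_null_comparison)
    show "((\<lambda>R. (1 / m + C * exp (- 1)) / ln R) \<longlongrightarrow> 0) at_top" by real_asymp
    show "\<forall>\<^sub>F R in at_top. norm (((\<integral>u. indicator {0<..} u * f R u \<partial>lborel) - ln R * J R) / ln R) \<le> (1 / m + C * exp (- 1)) / ln R"
      using eventually_gt_at_top[of 1]
    proof eventually_elim
      case (elim R)
      have "(\<integral>u. indicator {0<..} u * f R u \<partial>lborel)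
        = (\<integral>u. f R u * indicator {0<..<1 / R} u + indicator {1 / R..1} u *\<^sub>R f R u + f R u * indicator {1<..} u \<partial>lborel)"
      proof (rule Bochner_Integration.integral_cong[OF refl])
        fix u :: real
        have split: "indicator {0<..} u = indicator {0<..<q} u + indicator {q..1} u + (indicator {1<..} u :: real)" if "0 < q" "q < 1" for q
          using that by (auto simp: indicator_def)
        show "indicator {0<..} u * f R u = f R u * indicator {0<..<1 / R} u + indicator {1 / R..1} u *\<^sub>R f R u + f R u * indicator {1<..} u"
          using elim by (subst split[of "1 / R"]) (simp_all add: algebra_simps)
      qed
      also have "\<dots> = (\<integral>u. f R u * indicator {0<..<1 / R} u \<partial>lborel) + ln R * J R + (\<integral>u. f R u * indicator {1<..} u \<partial>lborel)"
        using mid_eq[OF elim] mid[OF elim] low_int[OF elim] high_int[OF elim]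
        by (simp add: set_lebesgue_integral_def set_integrable_def)
      finally have "\<bar>(\<integral>u. indicator {0<..} u * f R u \<partial>lborel) - ln R * J R\<bar> \<le> 1 / m + C * exp (- 1)"
        using low_le[OF elim] high_le[OF elim] by linarith
      then show ?case using elim by (simp add: divide_right_mono)
    qed
  qed
  from tendsto_add[OF this J]
  have "((\<lambda>R. ((\<integral>u. indicator {0<..} u * f R u \<partial>lborel) - ln R * J R) / ln R + J R) \<longlongrightarrow> c) at_top" by simp
  moreover have "\<forall>\<^sub>F R in at_top. ((\<integral>u. indicator {0<..} u * f R u \<partial>lborel) - ln R * J R) / ln R + J R
      = (\<integral>u. indicator {0<..} u * f R u \<partial>lborel) / ln R"
    using eventually_gt_at_top[of 1] by eventually_elim (simp add: field_simps)
  ultimately show ?thesis by (simp add: f_def tendsto_cong)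
qed

section \<open>Scaling limits from tails, moments and products\<close>

context prob_space
begin

lemma borel_measurable_upper_tail [measurable]:
  assumes [measurable]: "T \<in> borel_measurable M"
  shows "(\<lambda>u::real. prob {x \<in> space M. u < T x}) \<in> borel_measurable borel"
proof -
  have "mono (\<lambda>u. - prob {x \<in> space M. u < T x})"
    by (intro monoI) (auto intro!: finite_measure_mono)
  then have "(\<lambda>u. - (- prob {x \<in> space M. u < T x})) \<in> borel_measurable borel"
    by (intro borel_measurable_uminus borel_measurable_mono)
  then show ?thesis by simp
qed

lemma borel_measurable_lower_tail [measurable]:
  assumes [measurable]: "T \<in> borel_measurable M"
  shows "(\<lambda>u::real. prob {x \<in> space M. T x < u}) \<in> borel_measurable borel"
  by (intro borel_measurable_mono monoI) (auto intro!: finite_measure_mono)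

text \<open>Writing the tail at \<open>R * u\<close> as
  \<open>(R * u) powr (- k) * G (R * u)\<close> extracts \<open>R powr (- k)\<close>. The remaining
  weight \<open>gamma_kernel_deriv m u * u powr (- k)\<close> is integrable at 0 because
  \<open>k < m\<close>.\<close>

lemma gamma_kernel_upper_tail_limit:
  assumes m: "0 < m" and [measurable]: "T \<in> borel_measurable M" and pos: "AE x in M. 0 < T x"
    and k: "k < m"
    and lim: "((\<lambda>x. x powr k * prob {\<omega> \<in> space M. x < T \<omega>}) \<longlongrightarrow> c) at_top"
    and bound: "\<And>x. 0 < x \<Longrightarrow> x powr k * prob {\<omega> \<in> space M. x < T \<omega>} \<le> C"
  shows "((\<lambda>R. R powr k * expectation (\<lambda>x. gamma_kernel m (1 / R * T x))) \<longlongrightarrow> c * k * Gamma (m - k)) at_top"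
proof -
  define G where "G x = x powr k * prob {\<omega> \<in> space M. x < T \<omega>}" for x
  have [measurable]: "G \<in> borel_measurable borel" unfolding G_def[abs_def] by measurable
  have moment: "has_bochner_integral lborel (\<lambda>u. indicator {0<..} u * (gamma_kernel_deriv m u * u powr (- k))) (- (- k) * Gamma (m + - k))"
    by (rule gamma_kernel_deriv_moment) (use k in simp)
  have "((\<lambda>R. \<integral>u. indicator {0<..} u * (gamma_kernel_deriv m u * u powr (- k)) * G (R * u) \<partial>lborel)
      \<longlongrightarrow> (\<integral>u. indicator {0<..} u * (gamma_kernel_deriv m u * u powr (- k)) \<partial>lborel) * c) at_top"
    using moment lim bound
    by (intro tendsto_integral_dilation[where C = C]) (auto simp: has_bochner_integral_iff G_def[abs_def])
  moreover have "\<forall>\<^sub>F R in at_top. (\<integral>u. indicator {0<..} u * (gamma_kernel_deriv m u * u powr (- k)) * G (R * u) \<partial>lborel)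
      = R powr k * expectation (\<lambda>x. gamma_kernel m (1 / R * T x))"
    using eventually_gt_at_top[of 0]
  proof eventually_elim
    case (elim R)
    have "R powr k * expectation (\<lambda>x. gamma_kernel m (1 / R * T x))
      = (\<integral>u. R powr k * (indicator {0<..} u * gamma_kernel_deriv m u * prob {x \<in> space M. u / (1 / R) < T x}) \<partial>lborel)"
      using expectation_gamma_kernel(1)[OF m _ _ pos, of "1 / R"] elim by simp
    also have "\<dots> = (\<integral>u. indicator {0<..} u * (gamma_kernel_deriv m u * u powr (- k)) * G (R * u) \<partial>lborel)"
    proof (rule Bochner_Integration.integral_cong[OF refl])
      fix u :: real
      have "u powr (- k) * (R * u) powr k = R powr k" if "0 < u"
        using that elim by (simp add: powr_mult powr_minus)
      then show "R powr k * (indicator {0<..} u * gamma_kernel_deriv m u * prob {x \<in> space M. u / (1 / R) < T x})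
        = indicator {0<..} u * (gamma_kernel_deriv m u * u powr (- k)) * G (R * u)"
        by (auto simp: G_def indicator_def mult_ac)
    qed
    finally show ?case by simp
  qed
  ultimately show ?thesis
    using moment by (simp add: has_bochner_integral_iff tendsto_cong mult_ac)
qed

text \<open>The weight now gains \<open>u powr k\<close> and the dilation acts through
  \<open>1 / u\<close>. The minus sign of the lower-tail formula cancels that of the moment.
  Positive \<open>k\<close> improves convergence at 0, so one formula serves all dimensions.\<close>

lemma gamma_kernel_lower_tail_limit:
  assumes m: "0 < m" and [measurable]: "T \<in> borel_measurable M" and pos: "AE x in M. 0 < T x"
    and k: "0 < k"
    and lim: "((\<lambda>x. x powr k * prob {\<omega> \<in> space M. T \<omega> < 1 / x}) \<longlongrightarrow> c) at_top"
    and bound: "\<And>x. 0 < x \<Longrightarrow> x powr k * prob {\<omega> \<in> space M. T \<omega> < 1 / x} \<le> C"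
  shows "((\<lambda>R. R powr k * expectation (\<lambda>x. gamma_kernel m (R * T x))) \<longlongrightarrow> c * k * Gamma (m + k)) at_top"
proof -
  define G where "G x = x powr k * prob {\<omega> \<in> space M. T \<omega> < 1 / x}" for x
  have [measurable]: "(\<lambda>x. prob {\<omega> \<in> space M. T \<omega> < 1 / x}) \<in> borel_measurable borel"
    by (rule measurable_compose[of "\<lambda>x::real. 1 / x" borel borel]) measurable
  have [measurable]: "G \<in> borel_measurable borel" unfolding G_def[abs_def] by measurable
  have moment: "has_bochner_integral lborel (\<lambda>u. indicator {0<..} u * (gamma_kernel_deriv m u * u powr k)) (- k * Gamma (m + k))"
    by (rule gamma_kernel_deriv_moment) (use k m in simp)
  have "((\<lambda>R. \<integral>u. indicator {0<..} u * (gamma_kernel_deriv m u * u powr k) * G (R * (1 / u)) \<partial>lborel)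
      \<longlongrightarrow> (\<integral>u. indicator {0<..} u * (gamma_kernel_deriv m u * u powr k) \<partial>lborel) * c) at_top"
    using moment lim bound
    by (intro tendsto_integral_dilation[where C = C]) (auto simp: has_bochner_integral_iff G_def[abs_def])
  then have "((\<lambda>R. - (\<integral>u. indicator {0<..} u * (gamma_kernel_deriv m u * u powr k) * G (R * (1 / u)) \<partial>lborel))
      \<longlongrightarrow> - ((\<integral>u. indicator {0<..} u * (gamma_kernel_deriv m u * u powr k) \<partial>lborel) * c)) at_top"
    by (rule tendsto_minus)
  moreover have "\<forall>\<^sub>F R in at_top. - (\<integral>u. indicator {0<..} u * (gamma_kernel_deriv m u * u powr k) * G (R * (1 / u)) \<partial>lborel)
      = R powr k * expectation (\<lambda>x. gamma_kernel m (R * T x))"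
    using eventually_gt_at_top[of 0]
  proof eventually_elim
    case (elim R)
    have "R powr k * expectation (\<lambda>x. gamma_kernel m (R * T x))
      = - (\<integral>u. R powr k * (indicator {0<..} u * gamma_kernel_deriv m u * prob {x \<in> space M. T x < u / R}) \<partial>lborel)"
      using expectation_gamma_kernel(2)[OF m elim _ pos] by simp
    also have "(\<integral>u. R powr k * (indicator {0<..} u * gamma_kernel_deriv m u * prob {x \<in> space M. T x < u / R}) \<partial>lborel)
      = (\<integral>u. indicator {0<..} u * (gamma_kernel_deriv m u * u powr k) * G (R * (1 / u)) \<partial>lborel)"
    proof (rule Bochner_Integration.integral_cong[OF refl])
      fix u :: real
      have "u powr k * (R / u) powr k = R powr k" if "0 < u"
        using that elim by (simp add: powr_divide)
      then show "R powr k * (indicator {0<..} u * gamma_kernel_deriv m u * prob {x \<in> space M. T x < u / R})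
        = indicator {0<..} u * (gamma_kernel_deriv m u * u powr k) * G (R * (1 / u))"
        by (auto simp: G_def indicator_def mult_ac)
    qed
    finally show ?case by simp
  qed
  ultimately show ?thesis
    using moment by (simp add: has_bochner_integral_iff tendsto_cong mult_ac)
qed

text \<open>With tail index equal to \<open>m\<close>, the term \<open>m * u powr (m - 1)\<close> of
  the derivative produces the weight \<open>m * exp (- u) / u\<close> and hence the logarithm; the
  other term has a bounded integral, which division by \<open>ln R\<close> kills.\<close>

lemma gamma_kernel_upper_tail_log_limit:
  assumes m: "0 < m" and [measurable]: "T \<in> borel_measurable M" and pos: "AE x in M. 0 < T x"
    and lim: "((\<lambda>x. x powr m * prob {\<omega> \<in> space M. x < T \<omega>}) \<longlongrightarrow> c) at_top"
    and bound: "\<And>x. 0 < x \<Longrightarrow> x powr m * prob {\<omega> \<in> space M. x < T \<omega>} \<le> C"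
  shows "((\<lambda>R. R powr m * expectation (\<lambda>x. gamma_kernel m (1 / R * T x)) / ln R) \<longlongrightarrow> m * c) at_top"
proof -
  define G where "G x = x powr m * prob {\<omega> \<in> space M. x < T \<omega>}" for x
  have [measurable]: "G \<in> borel_measurable borel" unfolding G_def[abs_def] by measurable
  have G0: "0 \<le> G x" for x by (simp add: G_def)
  have G1: "G x \<le> x powr m" for x by (simp add: G_def mult_left_le)
  have G2: "0 < x \<Longrightarrow> G x \<le> C" for x using bound by (simp add: G_def)
  have "((\<lambda>R. (\<integral>u. indicator {0<..} u * (exp (- u) / u * G (R * u)) \<partial>lborel) / ln R) \<longlongrightarrow> c) at_top"
    using lim G0 G1 G2 m by (intro tendsto_integral_dilation_log[where C = C and m = m]) (auto simp: G_def[abs_def])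
  moreover have exp1: "has_bochner_integral lborel (\<lambda>u::real. indicator {0<..} u * exp (- u)) 1"
  proof -
    have "indicator {0<..} u * (u powr (1 - 1) * exp (- u)) = indicator {0<..} u * exp (- u)" for u :: real
      by (auto simp: indicator_def)
    then show ?thesis using has_bochner_integral_Gamma[of 1] by (simp only:) simp
  qed
  have "((\<lambda>R. (\<integral>u. indicator {0<..} u * exp (- u) * G (R * u) \<partial>lborel)) \<longlongrightarrow> (\<integral>u. indicator {0<..} u * exp (- u) \<partial>lborel) * c) at_top"
    using exp1 lim G0 G2
    by (intro tendsto_integral_dilation[where C = C]) (auto simp: has_bochner_integral_iff G_def[abs_def])
  then have "((\<lambda>R. (\<integral>u. indicator {0<..} u * exp (- u) * G (R * u) \<partial>lborel) / ln R) \<longlongrightarrow> 0) at_top"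
    by (rule tendsto_divide_0) (auto intro: filterlim_at_top_imp_at_infinity ln_at_top)
  ultimately have "((\<lambda>R. m * ((\<integral>u. indicator {0<..} u * (exp (- u) / u * G (R * u)) \<partial>lborel) / ln R)
      - (\<integral>u. indicator {0<..} u * exp (- u) * G (R * u) \<partial>lborel) / ln R) \<longlongrightarrow> m * c - 0) at_top"
    by (intro tendsto_intros)
  moreover have "\<forall>\<^sub>F R in at_top. m * ((\<integral>u. indicator {0<..} u * (exp (- u) / u * G (R * u)) \<partial>lborel) / ln R)
      - (\<integral>u. indicator {0<..} u * exp (- u) * G (R * u) \<partial>lborel) / ln R
      = R powr m * expectation (\<lambda>x. gamma_kernel m (1 / R * T x)) / ln R"
    using eventually_gt_at_top[of 0]
  proof eventually_elim
    case (elim R)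
    have int2: "integrable lborel (\<lambda>u. indicator {0<..} u * exp (- u) * G (R * u))"
    proof (rule Bochner_Integration.integrable_bound)
      show "integrable lborel (\<lambda>u. C * (indicator {0<..} u * exp (- u)))"
        using exp1 by (simp add: has_bochner_integral_iff)
      show "AE u in lborel. norm (indicator {0<..} u * exp (- u) * G (R * u)) \<le> norm (C * (indicator {0<..} u * exp (- u)))"
        using G0 G2 elim by (intro AE_I2) (auto simp: indicator_def abs_mult mult.commute intro!: mult_right_mono order_trans[OF _ abs_ge_self])
    qed measurable
    have int1: "integrable lborel (\<lambda>u. indicator {0<..} u * (exp (- u) / u * G (R * u)))"
    proof (rule Bochner_Integration.integrable_bound)
      show "integrable lborel (\<lambda>u. R powr m * (indicator {0<..} u * (u powr (m - 1) * exp (- u))))"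
        using has_bochner_integral_Gamma[OF m] by (simp add: has_bochner_integral_iff)
      show "AE u in lborel. norm (indicator {0<..} u * (exp (- u) / u * G (R * u))) \<le> norm (R powr m * (indicator {0<..} u * (u powr (m - 1) * exp (- u))))"
      proof (rule AE_I2)
        fix u :: real
        have "exp (- u) / u * G (R * u) \<le> exp (- u) / u * (R * u) powr m" if "0 < u"
          using that G1 by (intro mult_left_mono) auto
        then show "norm (indicator {0<..} u * (exp (- u) / u * G (R * u))) \<le> norm (R powr m * (indicator {0<..} u * (u powr (m - 1) * exp (- u))))"
          using G0 elim by (auto simp: indicator_def abs_mult powr_mult powr_diff mult_ac)
      qed
    qed measurable
    have "R powr m * expectation (\<lambda>x. gamma_kernel m (1 / R * T x))
      = (\<integral>u. R powr m * (indicator {0<..} u * gamma_kernel_deriv m u * prob {x \<in> space M. u / (1 / R) < T x}) \<partial>lborel)"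
      using expectation_gamma_kernel(1)[OF m _ _ pos, of "1 / R"] elim by simp
    also have "\<dots> = (\<integral>u. m * (indicator {0<..} u * (exp (- u) / u * G (R * u))) - indicator {0<..} u * exp (- u) * G (R * u) \<partial>lborel)"
    proof (rule Bochner_Integration.integral_cong[OF refl])
      fix u :: real
      show "R powr m * (indicator {0<..} u * gamma_kernel_deriv m u * prob {x \<in> space M. u / (1 / R) < T x})
        = m * (indicator {0<..} u * (exp (- u) / u * G (R * u))) - indicator {0<..} u * exp (- u) * G (R * u)"
        using elim by (auto simp: G_def indicator_def gamma_kernel_deriv_def powr_mult powr_diff field_simps)
    qed
    also have "\<dots> = m * (\<integral>u. indicator {0<..} u * (exp (- u) / u * G (R * u)) \<partial>lborel) - (\<integral>u. indicator {0<..} u * exp (- u) * G (R * u) \<partial>lborel)"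
      using int1 int2 by (simp only: Bochner_Integration.integral_diff integrable_mult_right integral_mult_right_zero)
    finally show ?case by (simp add: diff_divide_distrib)
  qed
  ultimately show ?thesis by (simp add: tendsto_cong)
qed

text \<open>The power \<open>T powr m\<close> is itself integrable, so the exponential factor of the
  kernel simply tends to 1 under a fixed majorant.\<close>

lemma gamma_kernel_small_argument_limit:
  assumes m: "0 < m" and [measurable]: "T \<in> borel_measurable M" and pos: "AE x in M. 0 < T x"
    and int: "integrable M (\<lambda>x. T x powr m)"
  shows "((\<lambda>R. R powr m * expectation (\<lambda>x. gamma_kernel m (1 / R * T x))) \<longlongrightarrow> expectation (\<lambda>x. T x powr m)) at_top"
proof -
  have "((\<lambda>R. expectation (\<lambda>x. T x powr m * exp (- (T x / R)))) \<longlongrightarrow> expectation (\<lambda>x. T x powr m)) at_top"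
  proof (rule integral_dominated_convergence_at_top[where w = "\<lambda>x. T x powr m"])
    show "AE x in M. ((\<lambda>R. T x powr m * exp (- (T x / R))) \<longlongrightarrow> T x powr m) at_top"
    proof (rule AE_I2)
      fix x
      have "((\<lambda>R. T x / R) \<longlongrightarrow> 0) at_top" by real_asymp
      then have "((\<lambda>R. T x powr m * exp (- (T x / R))) \<longlongrightarrow> T x powr m * exp (- 0)) at_top"
        by (intro tendsto_intros)
      then show "((\<lambda>R. T x powr m * exp (- (T x / R))) \<longlongrightarrow> T x powr m) at_top" by simp
    qed
    show "\<forall>\<^sub>F R in at_top. AE x in M. norm (T x powr m * exp (- (T x / R))) \<le> T x powr m"
      using eventually_gt_at_top[of 0]
    proof eventually_elim
      case (elim R)
      show ?case using pos by eventually_elim (use elim in \<open>auto simp: abs_mult intro!: mult_left_le\<close>)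
    qed
  qed (use int in auto)
  moreover have "\<forall>\<^sub>F R in at_top. expectation (\<lambda>x. T x powr m * exp (- (T x / R)))
      = R powr m * expectation (\<lambda>x. gamma_kernel m (1 / R * T x))"
    using eventually_gt_at_top[of 0]
  proof eventually_elim
    case (elim R)
    have "R powr m * expectation (\<lambda>x. gamma_kernel m (1 / R * T x)) = expectation (\<lambda>x. R powr m * gamma_kernel m (1 / R * T x))"
      by simp
    also have "\<dots> = expectation (\<lambda>x. T x powr m * exp (- (T x / R)))"
    proof (rule integral_cong_AE)
      show "AE x in M. R powr m * gamma_kernel m (1 / R * T x) = T x powr m * exp (- (T x / R))"
        using pos by eventually_elim (use elim in \<open>auto simp: gamma_kernel_def powr_divide\<close>)
    qed measurable
    finally show ?case by simp
  qed
  ultimately show ?thesis by (simp add: tendsto_cong)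
qed

text \<open>Breiman's principle: with \<open>F\<close> the tail of an independent factor, the
  expectation is the tail of its product with \<open>Y\<close>. Each value of \<open>Y\<close>
  contributes \<open>c * Y powr k\<close>; the bound \<open>C\<close> at all arguments, not only
  large ones, makes \<open>C * Y powr k\<close> a majorant.\<close>

lemma product_tail_limit:
  fixes F :: "real \<Rightarrow> real"
  assumes [measurable]: "F \<in> borel_measurable borel" "Y \<in> borel_measurable M" and pos: "AE y in M. 0 < Y y"
    and F: "((\<lambda>x. x powr k * F x) \<longlongrightarrow> c) at_top" "\<And>x. 0 < x \<Longrightarrow> \<bar>x powr k * F x\<bar> \<le> C"
    and int: "integrable M (\<lambda>y. Y y powr k)"
  shows "((\<lambda>x. x powr k * expectation (\<lambda>y. F (x / Y y))) \<longlongrightarrow> c * expectation (\<lambda>y. Y y powr k)) at_top"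
    and "0 < x \<Longrightarrow> x powr k * expectation (\<lambda>y. F (x / Y y)) \<le> C * expectation (\<lambda>y. Y y powr k)"
proof -
  define G where "G x = x powr k * F x" for x
  have [measurable]: "G \<in> borel_measurable borel" unfolding G_def[abs_def] by measurable
  have eq: "x powr k * expectation (\<lambda>y. F (x / Y y)) = expectation (\<lambda>y. Y y powr k * G (x / Y y))" if "0 < x" for x
  proof -
    have "x powr k * expectation (\<lambda>y. F (x / Y y)) = expectation (\<lambda>y. x powr k * F (x / Y y))" by simp
    also have "\<dots> = expectation (\<lambda>y. Y y powr k * G (x / Y y))"
      by (rule integral_cong_AE, measurable, use pos in eventually_elim)
         (use that in \<open>auto simp: G_def powr_divide\<close>)
    finally show ?thesis .
  qed
  have dom: "AE y in M. norm (Y y powr k * G (x / Y y)) \<le> Y y powr k * C" if "0 < x" for x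
    using pos by eventually_elim (use F(2)[of "x / _", folded G_def] that in \<open>auto simp: abs_mult intro!: mult_left_mono\<close>)
  have "((\<lambda>x. expectation (\<lambda>y. Y y powr k * G (x / Y y))) \<longlongrightarrow> expectation (\<lambda>y. Y y powr k * c)) at_top"
  proof (rule integral_dominated_convergence_at_top[where w = "\<lambda>y. Y y powr k * C"])
    show "AE y in M. ((\<lambda>x. Y y powr k * G (x / Y y)) \<longlongrightarrow> Y y powr k * c) at_top"
      using pos
    proof eventually_elim
      case (elim y)
      have "filterlim (\<lambda>x. x / Y y) at_top at_top" using elim by real_asymp
      then show ?case
        by (intro tendsto_mult tendsto_const filterlim_compose[OF F(1), folded G_def])
    qed
    show "\<forall>\<^sub>F x in at_top. AE y in M. norm (Y y powr k * G (x / Y y)) \<le> Y y powr k * C"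
      using eventually_gt_at_top[of 0] by eventually_elim (rule dom)
  qed (use int in auto)
  moreover have "\<forall>\<^sub>F x in at_top. expectation (\<lambda>y. Y y powr k * G (x / Y y)) = x powr k * expectation (\<lambda>y. F (x / Y y))"
    using eventually_gt_at_top[of 0] by eventually_elim (simp add: eq)
  ultimately show "((\<lambda>x. x powr k * expectation (\<lambda>y. F (x / Y y))) \<longlongrightarrow> c * expectation (\<lambda>y. Y y powr k)) at_top"
    by (simp add: tendsto_cong mult.commute)
  assume x: "0 < x"
  have "expectation (\<lambda>y. Y y powr k * G (x / Y y)) \<le> expectation (\<lambda>y. Y y powr k * C)"
  proof (rule integral_mono_AE)
    show "integrable M (\<lambda>y. Y y powr k * G (x / Y y))"
    proof (rule Bochner_Integration.integrable_bound)
      show "AE y in M. norm (Y y powr k * G (x / Y y)) \<le> norm (Y y powr k * C)"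
        using dom[OF x] by eventually_elim (auto intro: order_trans[OF _ abs_ge_self])
    qed (use int in auto)
    show "AE y in M. Y y powr k * G (x / Y y) \<le> Y y powr k * C"
      using dom[OF x] by eventually_elim auto
  qed (use int in auto)
  then show "x powr k * expectation (\<lambda>y. F (x / Y y)) \<le> C * expectation (\<lambda>y. Y y powr k)"
    using eq[OF x] by (simp add: mult.commute)
qed

end

section \<open>Symmetric stable densities as Gaussian mixtures\<close>

lemma has_bochner_integral_gaussian_iexp_real:
  assumes a: "0 < a"
  shows "has_bochner_integral lborel (\<lambda>x. complex_of_real (exp (- (a * x\<^sup>2))) * iexp (x * w))
    (complex_of_real (sqrt (pi / a) * exp (- (w\<^sup>2 / (4 * a)))))"
proof -
  \<comment> \<open>Dilation by \<open>c\<close> turns the Gaussian into the standard normal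
    density, whose characteristic function is known.\<close>
  define c where "c = sqrt (2 * a)"
  have c: "0 < c" "c\<^sup>2 = 2 * a" using a by (auto simp: c_def)
  define t where "t = w / c"
  define f where "f x = std_normal_density x *\<^sub>R iexp (t * x)" for x
  have std_int: "integrable lborel (\<lambda>x. std_normal_density x)" by simp
  have f_int: "integrable lborel f"
    by (rule Bochner_Integration.integrable_bound[OF std_int])
       (auto simp: f_def[abs_def] intro!: AE_I2)
  have f_eq: "integral\<^sup>L lborel f = complex_of_real (exp (- (t\<^sup>2) / 2))"
  proof -
    have "integral\<^sup>L lborel f = char std_normal_distribution t"
      unfolding char_def f_def by (subst integral_density) auto
    then show ?thesis by (simp add: char_std_normal_distribution)
  qed
  have point: "complex_of_real (exp (- (a * x\<^sup>2))) * iexp (x * w) = complex_of_real (sqrt (2 * pi)) * f (0 + c * x)" for x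
    using c a by (simp add: f_def std_normal_density_def power_mult_distrib t_def scaleR_conv_of_real mult_ac)
  have int: "integrable lborel (\<lambda>x. f (0 + c * x))"
    using lborel_integrable_real_affine[OF f_int, of c 0] c by simp
  have "integral\<^sup>L lborel f = \<bar>c\<bar> *\<^sub>R (\<integral>x. f (0 + c * x) \<partial>lborel)"
    by (rule lborel_integral_real_affine) (use c in simp)
  then have "(\<integral>x. f (0 + c * x) \<partial>lborel) = complex_of_real (exp (- (t\<^sup>2) / 2) / c)"
    using c by (simp add: f_eq scaleR_conv_of_real field_simps)
  then have "(\<integral>x. complex_of_real (sqrt (2 * pi)) * f (0 + c * x) \<partial>lborel)
    = complex_of_real (sqrt (2 * pi) / c * exp (- (t\<^sup>2) / 2))"
    by simp
  moreover have "sqrt (2 * pi) / c = sqrt (pi / a)" "t\<^sup>2 / 2 = w\<^sup>2 / (4 * a)"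
    using c a by (simp_all add: t_def power_divide c_def real_sqrt_divide[symmetric])
  ultimately show ?thesis
    unfolding point has_bochner_integral_iff using int by simp
qed

lemma has_bochner_integral_gaussian_iexp:
  fixes w :: "'a::euclidean_space"
  assumes a: "0 < a"
  shows "has_bochner_integral lborel (\<lambda>\<xi>. complex_of_real (exp (- (a * (norm \<xi>)\<^sup>2))) * iexp (\<xi> \<bullet> w))
    (complex_of_real ((pi / a) powr (DIM('a) / 2) * exp (- ((norm w)\<^sup>2 / (4 * a)))))"
proof -
  interpret P: product_sigma_finite "\<lambda>_::'a. lborel :: real measure" ..
  define g where "g b x = complex_of_real (exp (- (a * x\<^sup>2))) * iexp (x * (w \<bullet> b))" for b :: 'a and x
  have [measurable]: "g b \<in> borel_measurable borel" for b unfolding g_def[abs_def] by measurable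
  have g: "has_bochner_integral lborel (g b) (complex_of_real (sqrt (pi / a) * exp (- ((w \<bullet> b)\<^sup>2 / (4 * a)))))" for b
    unfolding g_def by (rule has_bochner_integral_gaussian_iexp_real[OF a])
  have norm_sq: "(norm u)\<^sup>2 = (\<Sum>b\<in>Basis. (u \<bullet> b)\<^sup>2)" for u :: 'a
    by (subst power2_norm_eq_inner, subst euclidean_inner) (simp add: power2_eq_square)
  have point: "complex_of_real (exp (- (a * (norm \<xi>)\<^sup>2))) * iexp (\<xi> \<bullet> w) = (\<Prod>b\<in>Basis. g b (\<xi> \<bullet> b))" for \<xi> :: 'a
  proof -
    have "a * (norm \<xi>)\<^sup>2 = (\<Sum>b\<in>Basis. a * (\<xi> \<bullet> b)\<^sup>2)"
      by (simp only: norm_sq sum_distrib_left)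
    moreover have "\<i> * complex_of_real (\<xi> \<bullet> w) = (\<Sum>b\<in>Basis. \<i> * complex_of_real ((\<xi> \<bullet> b) * (w \<bullet> b)))"
      by (simp add: euclidean_inner[of \<xi> w] sum_distrib_left)
    ultimately show ?thesis
      by (simp add: g_def prod.distrib exp_sum sum_negf[symmetric] del: of_real_mult)
  qed
  have meas: "(\<lambda>f. \<Sum>b\<in>Basis. f b *\<^sub>R b) \<in> measurable (\<Pi>\<^sub>M b\<in>Basis. lborel) (borel :: 'a measure)" by measurable
  have comp: "(\<Prod>b\<in>Basis. g b ((\<Sum>i\<in>Basis. f i *\<^sub>R i) \<bullet> b)) = (\<Prod>b\<in>Basis. g b (f b))" for f
    by (intro prod.cong) auto
  have int: "integrable lborel (\<lambda>\<xi>::'a. \<Prod>b\<in>Basis. g b (\<xi> \<bullet> b))"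
    unfolding lborel_eq[where 'a = 'a]
    by (subst integrable_distr_eq[OF meas]) (auto simp: comp intro!: P.product_integrable_prod integrable.intros[OF g])
  have "integral\<^sup>L lborel (\<lambda>\<xi>::'a. \<Prod>b\<in>Basis. g b (\<xi> \<bullet> b)) = (\<Prod>b\<in>Basis. integral\<^sup>L lborel (g b))"
    unfolding lborel_eq[where 'a = 'a]
    by (subst integral_distr[OF meas]) (auto simp: comp intro!: P.product_integral_prod integrable.intros[OF g])
  also have "\<dots> = complex_of_real (\<Prod>b\<in>Basis. sqrt (pi / a) * exp (- ((w \<bullet> b)\<^sup>2 / (4 * a))))"
    by (simp only: has_bochner_integral_integral_eq[OF g] of_real_prod)
  also have "(\<Prod>b\<in>Basis. sqrt (pi / a) * exp (- ((w \<bullet> b)\<^sup>2 / (4 * a)))) = sqrt (pi / a) ^ DIM('a) * exp (- ((norm w)\<^sup>2 / (4 * a)))"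
    by (simp add: prod.distrib exp_sum[symmetric] sum_negf sum_divide_distrib[symmetric] norm_sq)
  also have "sqrt (pi / a) ^ DIM('a) = (pi / a) powr (DIM('a) / 2)"
    using a by (simp add: powr_half_sqrt[symmetric] powr_realpow[symmetric] powr_powr)
  finally show ?thesis
    unfolding point has_bochner_integral_iff using int by blast
qed

text \<open>The centred Gaussian density with variance \<open>2 * a\<close> in each coordinate, so
  normalised that its characteristic function is exp(-a |\<xi>|^2); under convolution the parameters
  \<open>a\<close> add.\<close>

definition heat_kernel :: "real \<Rightarrow> 'a::euclidean_space \<Rightarrow> real" where
  "heat_kernel a z = (4 * pi * a) powr (- (DIM('a) / 2)) * exp (- ((norm z)\<^sup>2 / (4 * a)))"

lemma borel_measurable_heat_kernel [measurable]: "heat_kernel a \<in> borel_measurable borel"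
  unfolding heat_kernel_def[abs_def] by measurable

lemma heat_kernel_nonneg: "0 \<le> heat_kernel a z"
  by (simp add: heat_kernel_def)

lemma heat_kernel_fourier:
  fixes z :: "'a::euclidean_space"
  assumes a: "0 < a"
  shows "complex_of_real (heat_kernel a z)
    = complex_of_real ((2 * pi) powr (- real DIM('a))) * (\<integral>\<xi>. complex_of_real (exp (- (a * (norm \<xi>)\<^sup>2))) * iexp (\<xi> \<bullet> z) \<partial>lborel)"
proof -
  have "(2 * pi) powr (- real DIM('a)) = ((2 * pi) powr 2) powr (- (DIM('a) / 2))"
    by (simp only: powr_powr) simp
  also have "\<dots> * (pi / a) powr (DIM('a) / 2) = (4 * pi * a) powr (- (DIM('a) / 2))"
  proof -
    have "(pi / a) powr (DIM('a) / 2) = (a / pi) powr (- (DIM('a) / 2))"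
      using a by (simp add: powr_minus powr_divide)
    then show ?thesis
      using a by (simp only: powr_mult[symmetric]) (simp add: power2_eq_square field_simps)
  qed
  finally have "(2 * pi) powr (- real DIM('a)) * (pi / a) powr (DIM('a) / 2) = (4 * pi * a) powr (- (DIM('a) / 2))" .
  then show ?thesis
    unfolding has_bochner_integral_integral_eq[OF has_bochner_integral_gaussian_iexp[OF a]] heat_kernel_def
    by (simp only: of_real_mult[symmetric] mult.assoc[symmetric])
qed

lemma has_bochner_integral_heat_kernel:
  fixes y0 :: "'a::euclidean_space"
  assumes a: "0 < a"
  shows "has_bochner_integral lborel (\<lambda>y. heat_kernel a (y - y0)) 1"
proof -
  define c where "c = 1 / (4 * a)"
  have c: "0 < c" using a by (simp add: c_def)
  have "has_bochner_integral lborel (\<lambda>\<xi>::'a. complex_of_real (exp (- (c * (norm \<xi>)\<^sup>2)))) (complex_of_real ((pi / c) powr (DIM('a) / 2)))"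
    using has_bochner_integral_gaussian_iexp[OF c, of "0::'a"] by simp
  then have "has_bochner_integral lborel (\<lambda>\<xi>::'a. (pi / c) powr (- (DIM('a) / 2)) * exp (- (c * (norm \<xi>)\<^sup>2)))
      ((pi / c) powr (- (DIM('a) / 2)) * (pi / c) powr (DIM('a) / 2))"
    by (intro has_bochner_integral_mult_right)
       (simp only: has_bochner_integral_iff complex_of_real_integrable_eq integral_complex_of_real of_real_eq_iff)
  moreover have "(pi / c) powr (- (DIM('a) / 2)) * (pi / c) powr (DIM('a) / 2) = 1"
    using c by (simp add: powr_minus)
  moreover have "(pi / c) powr (- (DIM('a) / 2)) * exp (- (c * (norm \<xi>)\<^sup>2)) = heat_kernel a \<xi>" for \<xi> :: 'a
    using a by (simp add: heat_kernel_def c_def mult_ac)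
  ultimately have "has_bochner_integral lborel (\<lambda>\<xi>::'a. heat_kernel a \<xi>) 1" by simp
  then have "has_bochner_integral (distr lborel borel ((+) (- y0))) (heat_kernel a) 1"
    by (simp add: lborel_distr_plus)
  then show ?thesis
    by (simp add: has_bochner_integral_iff integrable_distr_eq integral_distr)
qed

text \<open>\<open>Q\<close> is continuous and integrable but possibly unbounded, so away from
  \<open>y0\<close> its two contributions are treated separately: the mass of \<open>Q\<close> is
  multiplied by a small supremum of the kernel, and the constant \<open>Q y0\<close> by a small mass
  of the kernel.\<close>

lemma tendsto_heat_kernel_smoothing:
  fixes Q :: "'a::euclidean_space \<Rightarrow> real"
  assumes Q: "continuous_on UNIV Q" "\<And>y. 0 \<le> Q y" "has_bochner_integral lborel Q 1"
  shows "((\<lambda>R. \<integral>y. Q y * heat_kernel (1 / R) (y - y0) \<partial>lborel) \<longlongrightarrow> Q y0) at_top"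
proof (rule tendstoI)
  fix e :: real assume e: "0 < e"
  have [measurable]: "Q \<in> borel_measurable borel" using Q(1) by (rule borel_measurable_continuous_onI)
  have "isCont Q y0" using Q(1) by (simp add: continuous_on_eq_continuous_at)
  then obtain d where d: "0 < d" "\<And>y. dist y y0 < d \<Longrightarrow> dist (Q y) (Q y0) < e / 2"
    using e unfolding continuous_at_eps_delta by (metis half_gt_zero)
  \<comment> \<open>\<open>B R\<close> bounds the kernel outside the ball of radius
    \<open>d\<close>. \<open>D R\<close> bounds there its ratio to the wider kernel of parameter
    \<open>2 / R\<close>: half of the exponent is given up to \<open>d\<close>, the other half stays
    in the wider kernel, whose integral is 1.\<close>
  define B where "B R = (4 * pi * (1 / R)) powr (- (DIM('a) / 2)) * exp (- (d\<^sup>2 * R / 4))" for R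
  define D where "D R = 2 powr (DIM('a) / 2) * exp (- (d\<^sup>2 * R / 8))" for R
  have bound: "\<bar>(\<integral>y. Q y * heat_kernel (1 / R) (y - y0) \<partial>lborel) - Q y0\<bar> \<le> e / 2 + B R + Q y0 * D R" if R: "0 < R" for R
  proof -
    have h: "has_bochner_integral lborel (\<lambda>y. heat_kernel (1 / R) (y - y0)) 1"
      "has_bochner_integral lborel (\<lambda>y. heat_kernel (2 / R) (y - y0)) 1"
      using R by (auto intro!: has_bochner_integral_heat_kernel)
    have point: "\<bar>Q y - Q y0\<bar> * heat_kernel (1 / R) (y - y0)
      \<le> e / 2 * heat_kernel (1 / R) (y - y0) + B R * Q y + Q y0 * D R * heat_kernel (2 / R) (y - y0)" for y
    proof (cases "dist y y0 < d")
      case True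
      have "\<bar>Q y - Q y0\<bar> * heat_kernel (1 / R) (y - y0) \<le> e / 2 * heat_kernel (1 / R) (y - y0)"
        using d(2)[OF True] by (intro mult_right_mono heat_kernel_nonneg) (auto simp: dist_real_def)
      moreover have "0 \<le> B R * Q y" "0 \<le> Q y0 * D R * heat_kernel (2 / R) (y - y0)"
        using Q(2) by (auto simp: B_def D_def heat_kernel_nonneg)
      ultimately show ?thesis by linarith
    next
      case False
      then have dy: "d\<^sup>2 \<le> (norm (y - y0))\<^sup>2" using d(1) by (intro power_mono) (auto simp: dist_norm)
      have "heat_kernel (1 / R) (y - y0) \<le> B R"
        unfolding heat_kernel_def B_def using dy R by (intro mult_left_mono) auto
      then have "Q y * heat_kernel (1 / R) (y - y0) \<le> Q y * B R" using Q(2) by (intro mult_left_mono)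
      moreover have "heat_kernel (1 / R) (y - y0) \<le> D R * heat_kernel (2 / R) (y - y0)"
      proof -
        have "y powr (- s) = 2 powr s * (2 * y) powr (- s)" if "0 < y" for y s :: real
          using that by (simp add: powr_mult powr_minus field_simps)
        from this[of "4 * pi * (1 / R)" "DIM('a) / 2"]
        have "(4 * pi * (1 / R)) powr (- (DIM('a) / 2)) = 2 powr (DIM('a) / 2) * (4 * pi * (2 / R)) powr (- (DIM('a) / 2))"
          using R by simp
        moreover have "exp (- ((norm (y - y0))\<^sup>2 / (4 * (1 / R)))) \<le> exp (- (d\<^sup>2 * R / 8)) * exp (- ((norm (y - y0))\<^sup>2 / (4 * (2 / R))))"
        proof -
          have "d\<^sup>2 * R \<le> (norm (y - y0))\<^sup>2 * R" using dy R by (intro mult_right_mono) auto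
          then have "- ((norm (y - y0))\<^sup>2 / (4 * (1 / R))) \<le> - (d\<^sup>2 * R / 8) + - ((norm (y - y0))\<^sup>2 / (4 * (2 / R)))"
            by simp
          then show ?thesis unfolding exp_add[symmetric] by simp
        qed
        ultimately show ?thesis
          using mult_left_mono[of "exp (- ((norm (y - y0))\<^sup>2 / (4 * (1 / R))))" "exp (- (d\<^sup>2 * R / 8)) * exp (- ((norm (y - y0))\<^sup>2 / (4 * (2 / R))))"
              "2 powr (DIM('a) / 2) * (4 * pi * (2 / R)) powr (- (DIM('a) / 2))"]
          by (simp only: heat_kernel_def D_def mult_ac mult_nonneg_nonneg powr_ge_zero)
      qed
      then have "Q y0 * heat_kernel (1 / R) (y - y0) \<le> Q y0 * (D R * heat_kernel (2 / R) (y - y0))"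
        using Q(2) by (intro mult_left_mono)
      moreover have "\<bar>Q y - Q y0\<bar> * heat_kernel (1 / R) (y - y0) \<le> (Q y + Q y0) * heat_kernel (1 / R) (y - y0)"
        using Q(2)[of y] Q(2)[of y0] by (intro mult_right_mono heat_kernel_nonneg) auto
      moreover have "0 \<le> e / 2 * heat_kernel (1 / R) (y - y0)" using e by (simp add: heat_kernel_nonneg)
      ultimately show ?thesis by (simp add: algebra_simps)
    qed
    have int: "integrable lborel (\<lambda>y. e / 2 * heat_kernel (1 / R) (y - y0) + B R * Q y + Q y0 * D R * heat_kernel (2 / R) (y - y0))"
      using h Q(3) by (auto simp: has_bochner_integral_iff)
    have int': "integrable lborel (\<lambda>y. (Q y - Q y0) * heat_kernel (1 / R) (y - y0))"
      by (rule Bochner_Integration.integrable_bound[OF int])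
         (use point in \<open>auto simp: abs_mult heat_kernel_nonneg intro!: AE_I2 order_trans[OF _ abs_ge_self]\<close>)
    have "(\<integral>y. Q y * heat_kernel (1 / R) (y - y0) \<partial>lborel)
      = (\<integral>y. (Q y - Q y0) * heat_kernel (1 / R) (y - y0) + Q y0 * heat_kernel (1 / R) (y - y0) \<partial>lborel)"
      by (simp add: algebra_simps)
    also have "\<dots> = (\<integral>y. (Q y - Q y0) * heat_kernel (1 / R) (y - y0) \<partial>lborel) + Q y0"
      using int' h by (subst Bochner_Integration.integral_add) (auto simp: has_bochner_integral_iff)
    finally have "\<bar>(\<integral>y. Q y * heat_kernel (1 / R) (y - y0) \<partial>lborel) - Q y0\<bar> = \<bar>\<integral>y. (Q y - Q y0) * heat_kernel (1 / R) (y - y0) \<partial>lborel\<bar>"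
      by simp
    also have "\<dots> \<le> (\<integral>y. \<bar>(Q y - Q y0) * heat_kernel (1 / R) (y - y0)\<bar> \<partial>lborel)"
      by (rule integral_abs_bound)
    also have "\<dots> \<le> (\<integral>y. e / 2 * heat_kernel (1 / R) (y - y0) + B R * Q y + Q y0 * D R * heat_kernel (2 / R) (y - y0) \<partial>lborel)"
      by (rule integral_mono[OF integrable_abs[OF int'] int]) (use point in \<open>simp add: abs_mult heat_kernel_nonneg\<close>)
    also have "\<dots> = e / 2 + B R + Q y0 * D R"
      using h Q(3) by (simp add: has_bochner_integral_iff)
    finally show ?thesis .
  qed
  have "(B \<longlongrightarrow> 0) at_top" unfolding B_def[abs_def] using d(1) by real_asymp
  moreover have "(D \<longlongrightarrow> 0) at_top" unfolding D_def[abs_def] using d(1) by real_asymp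
  ultimately have "((\<lambda>R. e / 2 + B R + Q y0 * D R) \<longlongrightarrow> e / 2 + 0 + Q y0 * 0) at_top"
    by (intro tendsto_intros)
  then have "\<forall>\<^sub>F R in at_top. e / 2 + B R + Q y0 * D R < e"
    by (rule order_tendstoD(2)) (use e in simp)
  then show "\<forall>\<^sub>F R in at_top. dist (\<integral>y. Q y * heat_kernel (1 / R) (y - y0) \<partial>lborel) (Q y0) < e"
    using eventually_gt_at_top[of 0] by eventually_elim (use bound in \<open>fastforce simp: dist_real_def\<close>)
qed

section \<open>Identification of a density through Gaussian smoothing\<close>

lemma (in prob_space) integral_mult_expectation_swap:
  fixes K :: "'a \<Rightarrow> 'b::euclidean_space \<Rightarrow> complex" and f :: "'b \<Rightarrow> complex"
  assumes f: "integrable lborel f"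
    and K: "(\<lambda>p. K (fst p) (snd p)) \<in> borel_measurable (M \<Otimes>\<^sub>M lborel)" "\<And>x \<xi>. x \<in> space M \<Longrightarrow> norm (K x \<xi>) \<le> 1"
  shows "(\<integral>\<xi>. f \<xi> * (\<integral>x. K x \<xi> \<partial>M) \<partial>lborel) = (\<integral>x. (\<integral>\<xi>. f \<xi> * K x \<xi> \<partial>lborel) \<partial>M)"
proof -
  interpret P: pair_sigma_finite M "lborel :: 'b measure" ..
  have [measurable]: "f \<in> borel_measurable borel" using f by auto
  have meas: "(\<lambda>p. f (snd p) * K (fst p) (snd p)) \<in> borel_measurable (M \<Otimes>\<^sub>M lborel)"
    by (intro borel_measurable_times K(1)) measurable
  have "integrable (M \<Otimes>\<^sub>M lborel) (\<lambda>p. f (snd p) * K (fst p) (snd p))"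
  proof (rule Bochner_Integration.integrable_bound[OF _ meas])
    show "integrable (M \<Otimes>\<^sub>M lborel) (\<lambda>p. f (snd p))"
      by (rule P.Fubini_integrable) (use f in auto)
    show "AE p in M \<Otimes>\<^sub>M lborel. norm (f (snd p) * K (fst p) (snd p)) \<le> norm (f (snd p))"
      using K(2) by (intro AE_I2) (auto simp: norm_mult space_pair_measure intro!: mult_left_le)
  qed
  then have "integrable (M \<Otimes>\<^sub>M lborel) (\<lambda>(x, \<xi>). f \<xi> * K x \<xi>)"
    by (simp add: case_prod_beta')
  from P.Fubini_integral[OF this] show ?thesis by simp
qed

text \<open>Expanding the kernel as a Fourier integral brings in the characteristic function of
  \<open>X\<close>, which is replaced by the mixture. The factor exp(-a |\<xi>|^2) makes both
  exchanges of integrals absolutely convergent, and at the end the exponents \<open>a\<close> and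
  \<open>V \<theta>\<close> add.\<close>

lemma expectation_heat_kernel_shift:
  fixes X :: "'w \<Rightarrow> 'a::euclidean_space" and z :: 'a
  assumes M: "prob_space M" and N: "prob_space N"
    and X: "X \<in> borel_measurable M" and V: "V \<in> borel_measurable N" "\<And>\<theta>. \<theta> \<in> space N \<Longrightarrow> 0 \<le> V \<theta>"
    and char: "\<And>\<xi>. (CLINT \<omega>|M. iexp (\<xi> \<bullet> X \<omega>)) = complex_of_real (\<integral>\<theta>. exp (- (V \<theta> * (norm \<xi>)\<^sup>2)) \<partial>N)"
    and a: "0 < a"
  shows "(\<integral>\<omega>. heat_kernel a (X \<omega> - z) \<partial>M) = (\<integral>\<theta>. heat_kernel (a + V \<theta>) z \<partial>N)"
proof -
  interpret M: prob_space M by fact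
  interpret N: prob_space N by fact
  note [measurable] = X V(1)
  let ?C = "complex_of_real ((2 * pi) powr (- real DIM('a)))"
  define f where "f u \<xi> = complex_of_real (exp (- (a * (norm \<xi>)\<^sup>2))) * iexp (\<xi> \<bullet> u)" for u \<xi> :: 'a
  have f_int: "integrable lborel (f u)" for u
    using has_bochner_integral_gaussian_iexp[OF a] unfolding f_def[abs_def] by (auto simp: has_bochner_integral_iff)
  have iexp_split: "iexp (\<xi> \<bullet> (u - z)) = iexp (\<xi> \<bullet> (- z)) * iexp (\<xi> \<bullet> u)" for \<xi> u
    by (simp add: exp_add[symmetric] inner_diff_right ring_distribs)
  have "complex_of_real (\<integral>\<omega>. heat_kernel a (X \<omega> - z) \<partial>M) = (\<integral>\<omega>. complex_of_real (heat_kernel a (X \<omega> - z)) \<partial>M)"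
    by (rule integral_complex_of_real[symmetric])
  also have "\<dots> = (\<integral>\<omega>. ?C * (\<integral>\<xi>. f (- z) \<xi> * iexp (\<xi> \<bullet> X \<omega>) \<partial>lborel) \<partial>M)"
    unfolding heat_kernel_fourier[OF a] f_def
    by (simp only: iexp_split mult.assoc)
  also have "\<dots> = ?C * (\<integral>\<omega>. (\<integral>\<xi>. f (- z) \<xi> * iexp (\<xi> \<bullet> X \<omega>) \<partial>lborel) \<partial>M)"
    by simp
  also have "(\<integral>\<omega>. (\<integral>\<xi>. f (- z) \<xi> * iexp (\<xi> \<bullet> X \<omega>) \<partial>lborel) \<partial>M) = (\<integral>\<xi>. f (- z) \<xi> * (CLINT \<omega>|M. iexp (\<xi> \<bullet> X \<omega>)) \<partial>lborel)"
    by (rule M.integral_mult_expectation_swap[symmetric, OF f_int]) auto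
  also have "\<dots> = (\<integral>\<xi>. f (- z) \<xi> * (\<integral>\<theta>. complex_of_real (exp (- (V \<theta> * (norm \<xi>)\<^sup>2))) \<partial>N) \<partial>lborel)"
    by (simp add: char integral_complex_of_real)
  also have "\<dots> = (\<integral>\<theta>. (\<integral>\<xi>. f (- z) \<xi> * complex_of_real (exp (- (V \<theta> * (norm \<xi>)\<^sup>2))) \<partial>lborel) \<partial>N)"
    by (rule N.integral_mult_expectation_swap[OF f_int]) (use V(2) in auto)
  also have "?C * \<dots> = (\<integral>\<theta>. ?C * (\<integral>\<xi>. f (- z) \<xi> * complex_of_real (exp (- (V \<theta> * (norm \<xi>)\<^sup>2))) \<partial>lborel) \<partial>N)"
    by simp
  also have "\<dots> = (\<integral>\<theta>. complex_of_real (heat_kernel (a + V \<theta>) (- z)) \<partial>N)"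
  proof (rule Bochner_Integration.integral_cong[OF refl])
    fix \<theta> assume "\<theta> \<in> space N"
    then have pos: "0 < a + V \<theta>" using V(2) a by (simp add: add_pos_nonneg)
    have split: "complex_of_real (exp (- ((a + V \<theta>) * r))) = complex_of_real (exp (- (a * r))) * complex_of_real (exp (- (V \<theta> * r)))" for r
      by (simp add: distrib_right exp_add[symmetric] del: of_real_exp flip: of_real_mult)
    show "?C * (\<integral>\<xi>. f (- z) \<xi> * complex_of_real (exp (- (V \<theta> * (norm \<xi>)\<^sup>2))) \<partial>lborel) = complex_of_real (heat_kernel (a + V \<theta>) (- z))"
      unfolding heat_kernel_fourier[OF pos] f_def split by (simp only: mult_ac)
  qed
  also have "\<dots> = complex_of_real (\<integral>\<theta>. heat_kernel (a + V \<theta>) z \<partial>N)"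
    by (subst integral_complex_of_real) (simp add: heat_kernel_def)
  finally show ?thesis by (simp only: of_real_eq_iff)
qed

text \<open>Smooth at time \<open>1 / R\<close> and let \<open>R\<close> grow. On the left,
  continuity recovers the value of \<open>Q\<close> at the point \<open>y0\<close>; on the right,
  the kernel is dominated by its maximum at time \<open>V \<theta>\<close>, which is integrable by
  the assumption on the negative moment of \<open>V\<close>.\<close>

lemma density_eq_gaussian_mixture:
  fixes X :: "'w \<Rightarrow> 'a::euclidean_space" and x :: 'a
  assumes M: "prob_space M" and N: "prob_space N"
    and X: "X \<in> borel_measurable M" and V: "V \<in> borel_measurable N" "\<And>\<theta>. \<theta> \<in> space N \<Longrightarrow> 0 \<le> V \<theta>" "AE \<theta> in N. 0 < V \<theta>"
    and char: "\<And>\<xi>. (CLINT \<omega>|M. iexp (\<xi> \<bullet> X \<omega>)) = complex_of_real (\<integral>\<theta>. exp (- (V \<theta> * (norm \<xi>)\<^sup>2)) \<partial>N)"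
    and int: "integrable N (\<lambda>\<theta>. V \<theta> powr (- (DIM('a) / 2)))"
    and Q: "distributed M lborel (\<lambda>\<omega>. x + X \<omega>) (\<lambda>y. ennreal (Q y))" "continuous_on UNIV Q" "\<And>y. 0 \<le> Q y"
  shows "Q y0 = (\<integral>\<theta>. heat_kernel (V \<theta>) (y0 - x) \<partial>N)"
proof -
  interpret M: prob_space M by fact
  interpret N: prob_space N by fact
  note [measurable] = X V(1)
  have [measurable]: "Q \<in> borel_measurable borel" using Q(2) by (rule borel_measurable_continuous_onI)
  have Q1: "has_bochner_integral lborel Q 1"
  proof (rule has_bochner_integral_nn_integral)
    have "(\<integral>\<^sup>+y. ennreal (Q y) * 1 \<partial>lborel) = (\<integral>\<^sup>+\<omega>. 1 \<partial>M)"
      by (rule distributed_nn_integral[OF Q(1)]) simp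
    then show "(\<integral>\<^sup>+y. ennreal (Q y) \<partial>lborel) = ennreal 1" by (simp add: M.emeasure_space_1)
  qed (use Q in auto)
  have smooth: "(\<integral>y. Q y * heat_kernel (1 / R) (y - y0) \<partial>lborel) = (\<integral>\<theta>. heat_kernel (1 / R + V \<theta>) (y0 - x) \<partial>N)" if "0 < R" for R
  proof -
    have "(\<integral>y. Q y * heat_kernel (1 / R) (y - y0) \<partial>lborel) = (\<integral>\<omega>. heat_kernel (1 / R) (x + X \<omega> - y0) \<partial>M)"
      by (rule distributed_integral[OF Q(1)]) (use Q(3) in auto)
    also have "\<dots> = (\<integral>\<omega>. heat_kernel (1 / R) (X \<omega> - (y0 - x)) \<partial>M)"
      by (simp add: algebra_simps)
    also have "\<dots> = (\<integral>\<theta>. heat_kernel (1 / R + V \<theta>) (y0 - x) \<partial>N)"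
      by (rule expectation_heat_kernel_shift[OF M N X V(1,2) char]) (use that in auto)
    finally show ?thesis .
  qed
  have "((\<lambda>R. \<integral>\<theta>. heat_kernel (1 / R + V \<theta>) (y0 - x) \<partial>N) \<longlongrightarrow> (\<integral>\<theta>. heat_kernel (V \<theta>) (y0 - x) \<partial>N)) at_top"
  proof (rule integral_dominated_convergence_at_top[where w = "\<lambda>\<theta>. (4 * pi) powr (- (DIM('a) / 2)) * V \<theta> powr (- (DIM('a) / 2))"])
    show "AE \<theta> in N. ((\<lambda>R. heat_kernel (1 / R + V \<theta>) (y0 - x)) \<longlongrightarrow> heat_kernel (V \<theta>) (y0 - x)) at_top"
      using V(3)
    proof eventually_elim
      case (elim \<theta>)
      have "((\<lambda>R. 1 / R + V \<theta>) \<longlongrightarrow> V \<theta>) at_top" by real_asymp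
      then show ?case unfolding heat_kernel_def using elim by (intro tendsto_intros) auto
    qed
    show "\<forall>\<^sub>F R in at_top. AE \<theta> in N. norm (heat_kernel (1 / R + V \<theta>) (y0 - x)) \<le> (4 * pi) powr (- (DIM('a) / 2)) * V \<theta> powr (- (DIM('a) / 2))"
      using eventually_gt_at_top[of 0]
    proof eventually_elim
      case (elim R)
      show ?case
        using V(3)
      proof eventually_elim
        case (elim \<theta>)
        have "heat_kernel (1 / R + V \<theta>) (y0 - x) \<le> (4 * pi * (1 / R + V \<theta>)) powr (- (DIM('a) / 2))"
          unfolding heat_kernel_def using elim \<open>0 < R\<close> by (intro mult_left_le) auto
        also have "\<dots> \<le> (4 * pi * V \<theta>) powr (- (DIM('a) / 2))"
          using elim \<open>0 < R\<close> by (intro powr_mono2') auto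
        also have "\<dots> = (4 * pi) powr (- (DIM('a) / 2)) * V \<theta> powr (- (DIM('a) / 2))"
          using elim by (simp add: powr_mult)
        finally show ?case by (simp add: heat_kernel_nonneg)
      qed
    qed
  qed (use int in \<open>auto simp: heat_kernel_def\<close>)
  moreover have "\<forall>\<^sub>F R in at_top. (\<integral>\<theta>. heat_kernel (1 / R + V \<theta>) (y0 - x) \<partial>N) = (\<integral>y. Q y * heat_kernel (1 / R) (y - y0) \<partial>lborel)"
    using eventually_gt_at_top[of 0] by eventually_elim (simp add: smooth)
  ultimately have "((\<lambda>R. \<integral>y. Q y * heat_kernel (1 / R) (y - y0) \<partial>lborel) \<longlongrightarrow> (\<integral>\<theta>. heat_kernel (V \<theta>) (y0 - x) \<partial>N)) at_top"
    by (simp add: tendsto_cong)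
  with tendsto_heat_kernel_smoothing[OF Q(2,3) Q1] show ?thesis
    by (rule tendsto_unique[OF trivial_limit_at_top_linorder])
qed

section \<open>The inverse subordinator\<close>

text \<open>A countable description, for measurability. The set under the infimum is upward closed,
  so natural times detect that it is nonempty and rational times detect its infimum. The
  \<open>max 0\<close> keeps the time nonnegative for every \<open>q\<close>, where \<open>S\<close>
  is measurable; the last disjunct accounts for the default value \<open>Inf {}\<close>.\<close>

lemma inverse_subordinator_less_iff:
  assumes mono: "mono_on {0..} (\<lambda>t. S t \<omega>)"
  shows "inverse_subordinator S t \<omega> < a \<longleftrightarrow>
    (\<exists>n::nat. t < S (real n) \<omega>) \<and> (\<exists>q::rat. 0 \<le> q \<and> of_rat q < a \<and> t < S (max 0 (of_rat q)) \<omega>) \<or>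
    \<not> (\<exists>n::nat. t < S (real n) \<omega>) \<and> Inf {} < a"
proof -
  define A where "A = {s. 0 \<le> s \<and> S s \<omega> > t}"
  have inc: "S u \<omega> \<le> S v \<omega>" if "0 \<le> u" "u \<le> v" for u v
    using mono_onD[OF mono, of u v] that by simp
  have ne: "A \<noteq> {} \<longleftrightarrow> (\<exists>n::nat. t < S (real n) \<omega>)"
  proof
    assume "A \<noteq> {}"
    then obtain u where u: "0 \<le> u" "t < S u \<omega>" by (auto simp: A_def)
    obtain n :: nat where "u \<le> real n" using real_arch_simple by blast
    then show "\<exists>n::nat. t < S (real n) \<omega>" using inc[OF u(1)] u(2) less_le_trans by blast
  next
    assume "\<exists>n::nat. t < S (real n) \<omega>"
    then obtain n :: nat where "real n \<in> A" by (auto simp: A_def)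
    then show "A \<noteq> {}" by blast
  qed
  have bdd: "bdd_below A" by (auto simp: A_def intro!: bdd_belowI[of _ 0])
  have "(\<exists>u\<in>A. u < a) \<longleftrightarrow> (\<exists>q::rat. 0 \<le> q \<and> of_rat q < a \<and> t < S (max 0 (of_rat q)) \<omega>)"
  proof
    assume "\<exists>u\<in>A. u < a"
    then obtain u where u: "0 \<le> u" "t < S u \<omega>" "u < a" by (auto simp: A_def)
    obtain q :: rat where q: "u < of_rat q" "of_rat q < a" using of_rat_dense[OF u(3)] by blast
    have "0 < (of_rat q :: real)" using u(1) q(1) by linarith
    then show "\<exists>q::rat. 0 \<le> q \<and> of_rat q < a \<and> t < S (max 0 (of_rat q)) \<omega>"
      using q u inc[OF u(1), of "of_rat q"] by (intro exI[of _ q]) (auto simp: max_def)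
  next
    assume "\<exists>q::rat. 0 \<le> q \<and> of_rat q < a \<and> t < S (max 0 (of_rat q)) \<omega>"
    then obtain q :: rat where q: "0 \<le> q" "of_rat q < a" "t < S (max 0 (of_rat q)) \<omega>" by blast
    then have "of_rat q \<in> A" by (simp add: A_def)
    then show "\<exists>u\<in>A. u < a" using q(2) by blast
  qed
  moreover have "Inf A < a \<longleftrightarrow> (if A = {} then Inf {} < a else (\<exists>u\<in>A. u < a))"
    using cInf_less_iff[OF _ bdd] by auto
  ultimately show ?thesis
    unfolding inverse_subordinator_def A_def[symmetric] using ne by auto
qed

lemma borel_measurable_inverse_subordinator:
  assumes S: "\<And>t. 0 \<le> t \<Longrightarrow> S t \<in> borel_measurable M"
    and mono: "\<And>\<omega>. \<omega> \<in> space M \<Longrightarrow> mono_on {0..} (\<lambda>t. S t \<omega>)"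
  shows "inverse_subordinator S t \<in> borel_measurable M"
  unfolding borel_measurable_iff_less
proof
  fix a :: real
  have [measurable]: "S (real n) \<in> borel_measurable M" "S (max 0 x) \<in> borel_measurable M" for n x
    using S by auto
  have "{\<omega> \<in> space M. inverse_subordinator S t \<omega> < a} = {\<omega> \<in> space M.
    (\<exists>n::nat. t < S (real n) \<omega>) \<and> (\<exists>q::rat. 0 \<le> q \<and> of_rat q < a \<and> t < S (max 0 (of_rat q)) \<omega>) \<or>
    \<not> (\<exists>n::nat. t < S (real n) \<omega>) \<and> Inf {} < a}"
    using inverse_subordinator_less_iff[of S _ t a, OF mono] by blast
  also have "\<dots> \<in> sets M" by measurable
  finally show "{\<omega> \<in> space M. inverse_subordinator S t \<omega> < a} \<in> sets M" .
qed

lemma stable_subordinator_AE_nonneg: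
  assumes "stable_subordinator M \<beta> S" "0 \<le> s"
  shows "AE \<omega> in M. 0 \<le> S s \<omega>"
proof -
  have "AE \<omega> in M. S 0 \<omega> = 0" using assms(1) by (simp add: stable_subordinator_def levy_process_def)
  with AE_space show ?thesis
  proof eventually_elim
    case (elim \<omega>)
    then have "mono_on {0..} (\<lambda>t. S t \<omega>)" using assms(1) by (simp add: stable_subordinator_def)
    from mono_onD[OF this, of 0 s] show ?case using elim assms(2) by simp
  qed
qed

section \<open>The law of the inverse subordinator\<close>

context
  fixes M :: "'w measure" and S :: "real \<Rightarrow> 'w \<Rightarrow> real" and \<beta> :: real
  assumes M: "prob_space M" and \<beta>: "0 < \<beta>" "\<beta> < 1" and S: "stable_subordinator M \<beta> S"
begin

interpretation M: prob_space M by (rule M)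

lemma stable_subordinator_measurable: "0 \<le> s \<Longrightarrow> S s \<in> borel_measurable M"
  using S by (simp add: stable_subordinator_def levy_process_def)

lemma stable_subordinator_laplace:
  "0 \<le> s \<Longrightarrow> 0 < r \<Longrightarrow> (\<integral>\<omega>. exp (- (r * S s \<omega>)) \<partial>M) = exp (- (s * r powr \<beta>))"
  using S by (simp add: stable_subordinator_def)

lemma one_sided_stable_subordinator: "one_sided_stable (distr M borel (S 1)) \<beta>"
proof -
  have [measurable]: "S 1 \<in> borel_measurable M" by (rule stable_subordinator_measurable) simp
  have "real_distribution (distr M borel (S 1))" by (rule M.real_distribution_distr) measurable
  then show ?thesis
    unfolding one_sided_stable_def one_sided_stable_axioms_def
    using \<beta> stable_subordinator_AE_nonneg[OF S, of 1] stable_subordinator_laplace[of 1]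
    by (auto simp: AE_distr_iff integral_distr)
qed

text \<open>Scaling by \<open>s powr (1 / \<beta>)\<close> multiplies \<open>r powr \<beta>\<close>
  by \<open>s\<close>, so the Laplace transforms agree. This reduces all times to the single law of
  \<open>S 1\<close>.\<close>

lemma stable_subordinator_self_similar:
  assumes s: "0 < s"
  shows "distr M borel (S s) = distr (distr M borel (S 1)) borel (\<lambda>w. s powr (1 / \<beta>) * w)"
proof -
  let ?\<sigma> = "distr M borel (S 1)"
  interpret \<sigma>: one_sided_stable ?\<sigma> \<beta> by (rule one_sided_stable_subordinator)
  have [measurable]: "S s \<in> borel_measurable M" using s by (intro stable_subordinator_measurable) simp
  show ?thesis
  proof (rule laplace_transform_unique)
    show "real_distribution (distr M borel (S s))" by (rule M.real_distribution_distr) measurable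
    show "real_distribution (distr ?\<sigma> borel (\<lambda>w. s powr (1 / \<beta>) * w))" by (rule \<sigma>.real_distribution_distr) measurable
    show "AE x in distr M borel (S s). 0 \<le> x"
      using stable_subordinator_AE_nonneg[OF S, of s] s by (simp add: AE_distr_iff)
    have "AE w in ?\<sigma>. 0 \<le> s powr (1 / \<beta>) * w"
      using \<sigma>.AE_nonneg by eventually_elim simp
    then show "AE x in distr ?\<sigma> borel (\<lambda>w. s powr (1 / \<beta>) * w). 0 \<le> x"
      by (subst AE_distr_iff) (simp_all add: measurable_distr_eq1)
    fix r :: real assume r: "0 < r"
    have "(\<integral>w. exp (- (r * (s powr (1 / \<beta>) * w))) \<partial>?\<sigma>) = exp (- (s * r powr \<beta>))"
      using \<sigma>.laplace[of "r * s powr (1 / \<beta>)"] r s \<beta> by (simp add: powr_mult powr_powr mult_ac)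
    then have "(\<integral>x. exp (- (r * x)) \<partial>distr ?\<sigma> borel (\<lambda>w. s powr (1 / \<beta>) * w)) = exp (- (s * r powr \<beta>))"
      by (subst integral_distr) simp_all
    then show "(\<integral>x. exp (- (r * x)) \<partial>distr M borel (S s)) = (\<integral>x. exp (- (r * x)) \<partial>distr ?\<sigma> borel (\<lambda>w. s powr (1 / \<beta>) * w))"
      using stable_subordinator_laplace[of s r] s r by (simp add: integral_distr)
  qed
qed

text \<open>Chernoff bound: staying below \<open>t\<close> up to time n has probability at most
  \<open>exp t\<close> times the Laplace transform of \<open>S n\<close> at 1, which is
  exp(-n).\<close>

lemma stable_subordinator_unbounded: "AE \<omega> in M. \<exists>n::nat. t < S (real n) \<omega>"
proof -
  have [measurable]: "S (real n) \<in> borel_measurable M" for n by (rule stable_subordinator_measurable) simp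
  let ?N = "{\<omega> \<in> space M. \<forall>n::nat. S (real n) \<omega> \<le> t}"
  have le: "M.prob ?N \<le> exp t * exp (- real n)" for n
  proof -
    have int: "integrable M (\<lambda>\<omega>. exp t * exp (- (1 * S (real n) \<omega>)))"
      using stable_subordinator_AE_nonneg[OF S, of "real n"]
      by (intro integrable_mult_right M.integrable_const_bound[of _ 1]) auto
    have "M.prob ?N = (\<integral>\<omega>. indicator ?N \<omega> \<partial>M)" by (simp add: Int_absorb2)
    also have "\<dots> \<le> (\<integral>\<omega>. exp t * exp (- (1 * S (real n) \<omega>)) \<partial>M)"
    proof (rule integral_mono[OF _ int])
      show "integrable M (indicator ?N :: 'w \<Rightarrow> real)"
        by (auto intro!: integrable_real_indicator simp: M.emeasure_eq_measure)
      show "indicator ?N \<omega> \<le> exp t * exp (- (1 * S (real n) \<omega>))" for \<omega>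
        by (auto simp: indicator_def exp_add[symmetric])
    qed
    also have "\<dots> = exp t * exp (- real n)"
      using stable_subordinator_laplace[of "real n" 1] by simp
    finally show ?thesis .
  qed
  have "(\<lambda>n. exp t * exp (- real n)) \<longlonglongrightarrow> 0" by real_asymp
  then have "M.prob ?N \<le> 0"
    by (rule tendsto_lowerbound) (auto intro!: always_eventually le)
  then have "M.prob ?N = 0" by (simp add: measure_le_0_iff)
  then have "AE \<omega> in M. \<omega> \<notin> ?N" by (subst (asm) M.prob_eq_0) auto
  with AE_space show ?thesis by eventually_elim (auto simp: not_le)
qed

text \<open>With E the inverse at \<open>t\<close>, monotonicity gives E < s \<Longrightarrow> S s >
  t \<Longrightarrow> E \<le> s, the first implication almost surely. By self-similarity S s > t has
  the probability of \<open>(t / w) powr \<beta> < s\<close> under the law of \<open>S 1\<close>.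
  The strict and the weak inequality differ, so only interlaced distribution functions
  result.\<close>

lemma distr_inverse_subordinator:
  assumes t: "0 < t"
  shows "distr M borel (inverse_subordinator S t) = distr (distr M borel (S 1)) borel (\<lambda>w. (t / w) powr \<beta>)"
proof -
  let ?\<sigma> = "distr M borel (S 1)" and ?E = "inverse_subordinator S t"
  let ?D = "distr M borel ?E" and ?D' = "distr ?\<sigma> borel (\<lambda>w. (t / w) powr \<beta>)"
  interpret \<sigma>: one_sided_stable ?\<sigma> \<beta> by (rule one_sided_stable_subordinator)
  have mono: "mono_on {0..} (\<lambda>t. S t \<omega>)" if "\<omega> \<in> space M" for \<omega>
    using S that by (simp add: stable_subordinator_def)
  have [measurable]: "?E \<in> borel_measurable M"
    by (rule borel_measurable_inverse_subordinator[OF stable_subordinator_measurable mono])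
  have [measurable]: "(\<lambda>w. (t / w) powr \<beta>) \<in> borel_measurable ?\<sigma>" by measurable
  have D: "real_distribution ?D" by (rule M.real_distribution_distr) measurable
  have D': "real_distribution ?D'" by (rule \<sigma>.real_distribution_distr) measurable
  interpret D: real_distribution ?D by (rule D)
  interpret D': real_distribution ?D' by (rule D')
  have S_law: "M.prob {\<omega> \<in> space M. t < S s \<omega>} = measure ?D' {..<s}" if s: "0 < s" for s
  proof -
    have [measurable]: "S s \<in> borel_measurable M" using s by (intro stable_subordinator_measurable) simp
    have "M.prob {\<omega> \<in> space M. t < S s \<omega>} = measure (distr M borel (S s)) {t<..}"
      by (subst measure_distr) (auto intro!: arg_cong[of _ _ "measure M"])
    also have "\<dots> = measure ?\<sigma> {w. t < s powr (1 / \<beta>) * w}"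
      unfolding stable_subordinator_self_similar[OF s]
      by (subst measure_distr) (auto intro!: arg_cong[of _ _ "measure ?\<sigma>"])
    also have "\<dots> = measure ?\<sigma> {w. (t / w) powr \<beta> < s}"
    proof (rule \<sigma>.finite_measure_eq_AE)
      show "AE w in ?\<sigma>. (w \<in> {w. t < s powr (1 / \<beta>) * w}) = (w \<in> {w. (t / w) powr \<beta> < s})"
        using \<sigma>.AE_pos
      proof eventually_elim
        case (elim w)
        have "(t / w) powr \<beta> < s \<longleftrightarrow> (t / w) powr \<beta> < (s powr (1 / \<beta>)) powr \<beta>"
          using s \<beta> by (simp add: powr_powr)
        also have "\<dots> \<longleftrightarrow> t / w < s powr (1 / \<beta>)"
          using elim t \<beta> by (intro powr_less_iff_less) auto
        also have "\<dots> \<longleftrightarrow> t < s powr (1 / \<beta>) * w"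
          using elim by (simp add: divide_less_eq)
        finally show ?case by simp
      qed
    qed measurable
    also have "\<dots> = measure ?D' {..<s}"
      by (subst measure_distr) (auto intro!: arg_cong[of _ _ "measure ?\<sigma>"])
    finally show ?thesis .
  qed
  have le1: "measure ?D {..<s} \<le> measure ?D' {..<s}" if s: "0 < s" for s
  proof -
    have [measurable]: "S s \<in> borel_measurable M" using s by (intro stable_subordinator_measurable) simp
    have "measure ?D {..<s} = M.prob {\<omega> \<in> space M. ?E \<omega> < s}"
      by (subst measure_distr) (auto intro!: arg_cong[of _ _ "measure M"])
    also have "\<dots> \<le> M.prob {\<omega> \<in> space M. t < S s \<omega>}"
    proof (rule M.finite_measure_mono_AE)
      show "AE \<omega> in M. \<omega> \<in> {\<omega> \<in> space M. ?E \<omega> < s} \<longrightarrow> \<omega> \<in> {\<omega> \<in> space M. t < S s \<omega>}"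
        using stable_subordinator_unbounded[of t] AE_space
      proof eventually_elim
        case (elim \<omega>)
        show ?case
        proof
          assume "\<omega> \<in> {\<omega> \<in> space M. ?E \<omega> < s}"
          then obtain q :: rat where q: "0 \<le> q" "of_rat q < s" "t < S (max 0 (of_rat q)) \<omega>"
            using inverse_subordinator_less_iff[of S \<omega> t s, OF mono[OF elim(2)]] elim(1) by auto
          have "S (max 0 (of_rat q)) \<omega> \<le> S s \<omega>"
            using mono_onD[OF mono[OF elim(2)], of "max 0 (of_rat q)" s] q(2) s by auto
          then show "\<omega> \<in> {\<omega> \<in> space M. t < S s \<omega>}" using q(3) elim(2) by simp
        qed
      qed
    qed measurable
    finally show ?thesis using S_law[OF s] by simp
  qed
  have le2: "measure ?D' {..<s} \<le> measure ?D {..s}" if s: "0 < s" for s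
  proof -
    have [measurable]: "S s \<in> borel_measurable M" using s by (intro stable_subordinator_measurable) simp
    have "measure ?D' {..<s} \<le> M.prob {\<omega> \<in> space M. ?E \<omega> \<le> s}"
      unfolding S_law[OF s, symmetric]
    proof (rule M.finite_measure_mono)
      show "{\<omega> \<in> space M. t < S s \<omega>} \<subseteq> {\<omega> \<in> space M. ?E \<omega> \<le> s}"
        using s by (auto simp: inverse_subordinator_def intro!: cInf_lower bdd_belowI[of _ 0])
    qed measurable
    also have "\<dots> = measure ?D {..s}"
      by (subst measure_distr) (auto intro!: arg_cong[of _ _ "measure M"])
    finally show ?thesis .
  qed
  have E_nonneg: "AE \<omega> in M. 0 \<le> ?E \<omega>"
    using stable_subordinator_unbounded[of t]
  proof eventually_elim
    case (elim \<omega>)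
    then obtain n :: nat where "t < S (real n) \<omega>" by blast
    then have "{s. 0 \<le> s \<and> t < S s \<omega>} \<noteq> {}" by (auto intro!: exI[of _ "real n"])
    then show ?case unfolding inverse_subordinator_def by (intro cInf_greatest) auto
  qed
  \<comment> \<open>The inclusions concern positive times only; for \<open>y \<le> 0\<close> and
    \<open>x < y\<close> the comparison holds because neither law charges the negative axis.\<close>
  have neg: "cdf ?D x = 0" "cdf ?D' x = 0" if "x < 0" for x
  proof -
    have "cdf ?D x = M.prob {\<omega> \<in> space M. ?E \<omega> \<le> x}"
      unfolding cdf_def by (subst measure_distr) (auto intro!: arg_cong[of _ _ "measure M"])
    also have "\<dots> = M.prob {}"
      by (rule M.finite_measure_eq_AE) (use E_nonneg that in \<open>auto elim!: eventually_mono\<close>)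
    finally show "cdf ?D x = 0" by simp
    have "\<not> (t / w) powr \<beta> \<le> x" for w using that by (smt (verit) powr_ge_zero)
    then have "(\<lambda>w. (t / w) powr \<beta>) -` {..x} = {}" by auto
    then show "cdf ?D' x = 0" unfolding cdf_def by (subst measure_distr) auto
  qed
  show ?thesis
  proof (rule real_distribution_eqI_cdf_interlace[OF D D'])
    fix x y :: real assume xy: "x < y"
    show "cdf ?D x \<le> cdf ?D' y"
    proof (cases "0 < y")
      case True
      have "cdf ?D x \<le> measure ?D {..<y}" unfolding cdf_def using xy by (intro D.finite_measure_mono) auto
      also have "\<dots> \<le> measure ?D' {..<y}" by (rule le1[OF True])
      also have "\<dots> \<le> cdf ?D' y" unfolding cdf_def by (intro D'.finite_measure_mono) auto
      finally show ?thesis .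
    next
      case False
      then show ?thesis using xy neg(1)[of x] D'.cdf_nonneg[of y] by simp
    qed
    show "cdf ?D' x \<le> cdf ?D y"
    proof (cases "0 < y")
      case True
      have "cdf ?D' x \<le> measure ?D' {..<y}" unfolding cdf_def using xy by (intro D'.finite_measure_mono) auto
      also have "\<dots> \<le> cdf ?D y" unfolding cdf_def by (rule le2[OF True])
      finally show ?thesis .
    next
      case False
      then show ?thesis using xy neg(2)[of x] D.cdf_nonneg[of y] by simp
    qed
  qed
qed

end

section \<open>Tails of the ratio of stable variables\<close>

text \<open>Raise u/m \<le> exp(u/m) to the power \<open>m\<close>. The constant is crude, but
  boundedness is what Fubini on the product measure needs.\<close>

lemma gamma_kernel_bounds:
  assumes "0 < m" "0 \<le> u"
  shows "0 \<le> gamma_kernel m u" "gamma_kernel m u \<le> m powr m"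
proof -
  show "0 \<le> gamma_kernel m u" by (simp add: gamma_kernel_def)
  have "u \<le> m * exp (u / m)"
    using exp_ge_add_one_self[of "u / m"] assms by (simp add: field_simps)
  then have "u powr m \<le> (m * exp (u / m)) powr m"
    using assms by (intro powr_mono2) auto
  also have "\<dots> = m powr m * exp u"
    using assms by (simp add: powr_mult exp_powr_real)
  finally show "gamma_kernel m u \<le> m powr m"
    by (simp add: gamma_kernel_def exp_minus field_simps)
qed

lemma heat_kernel_eq_gamma_kernel:
  fixes z :: "'a::euclidean_space"
  assumes "z \<noteq> 0" "0 < v"
  shows "heat_kernel v z = norm z powr (- real DIM('a)) * pi powr (- (DIM('a) / 2)) * gamma_kernel (DIM('a) / 2) ((norm z)\<^sup>2 / (4 * v))"
proof -
  let ?m = "real DIM('a) / 2"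
  have "norm z powr (- real DIM('a)) = ((norm z)\<^sup>2) powr (- ?m)"
    using assms by (simp add: powr_powr flip: powr_numeral)
  then have "norm z powr (- real DIM('a)) * pi powr (- ?m) * ((norm z)\<^sup>2 / (4 * v)) powr ?m
    = (((norm z)\<^sup>2) powr (- ?m) * ((norm z)\<^sup>2) powr ?m) * (pi powr (- ?m) * (4 * v) powr (- ?m))"
    using assms by (simp add: powr_divide powr_minus field_simps)
  also have "\<dots> = (4 * pi * v) powr (- ?m)"
    using assms by (simp add: powr_minus powr_mult field_simps)
  finally show ?thesis
    by (simp add: heat_kernel_def gamma_kernel_def mult.assoc[symmetric])
qed

text \<open>
  The random variable \<open>T = S\<^sup>\<beta>\<^sup>/\<^sup>\<gamma> / (4 \<Theta>)\<close>, with \<open>S\<close> and \<open>\<Theta>\<close> independent one-sided stable of index \<open>\<beta>\<close>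
  and \<open>\<gamma>\<close>: its upper tail is governed by \<open>S\<close>, its lower tail by \<open>\<Theta>\<close>.
\<close>

locale stable_pair = \<sigma>: one_sided_stable \<sigma> \<beta> + \<eta>: one_sided_stable \<eta> \<gamma>
  for \<sigma> \<eta> :: "real measure" and \<beta> \<gamma> :: real
begin

definition T :: "real \<times> real \<Rightarrow> real" where
  "T p = fst p powr (\<beta> / \<gamma>) / (4 * snd p)"

lemma borel_measurable_T [measurable]: "T \<in> borel_measurable (\<sigma> \<Otimes>\<^sub>M \<eta>)"
proof -
  have "T \<in> borel_measurable (borel \<Otimes>\<^sub>M borel)" unfolding T_def[abs_def] by measurable
  then show ?thesis
    using measurable_cong_sets[OF sets_pair_measure_cong[OF \<sigma>.events_eq_borel \<eta>.events_eq_borel] refl] by blast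
qed

sublocale N: pair_prob_space \<sigma> \<eta> ..

lemma AE_pair_pos: "AE p in \<sigma> \<Otimes>\<^sub>M \<eta>. 0 < fst p \<and> 0 < snd p"
proof -
  have "AE x in \<sigma>. AE y in \<eta>. 0 < x \<and> 0 < y"
    using \<sigma>.AE_pos by eventually_elim (use \<eta>.AE_pos in auto)
  moreover have "{p \<in> space (\<sigma> \<Otimes>\<^sub>M \<eta>). 0 < fst p \<and> 0 < snd p} \<in> sets (\<sigma> \<Otimes>\<^sub>M \<eta>)"
  proof -
    have "{p \<in> space (\<sigma> \<Otimes>\<^sub>M \<eta>). 0 < fst p \<and> 0 < snd p} = {0<..} \<times> {0<..}"
      by (auto simp: space_pair_measure)
    also have "\<dots> \<in> sets (\<sigma> \<Otimes>\<^sub>M \<eta>)" by (rule pair_measureI) auto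
    finally show ?thesis .
  qed
  ultimately show ?thesis by (intro N.AE_pair_measure) auto
qed

lemma AE_T_pos: "AE p in \<sigma> \<Otimes>\<^sub>M \<eta>. 0 < T p"
  using AE_pair_pos by eventually_elim (auto simp: T_def)

lemma prob_pair_eq:
  assumes [measurable]: "A \<in> sets (\<sigma> \<Otimes>\<^sub>M \<eta>)"
  shows "N.prob A = (\<integral>x. \<eta>.prob {y. (x, y) \<in> A} \<partial>\<sigma>)" and "N.prob A = (\<integral>y. \<sigma>.prob {x. (x, y) \<in> A} \<partial>\<eta>)"
proof -
  have int: "integrable (\<sigma> \<Otimes>\<^sub>M \<eta>) (indicator A :: _ \<Rightarrow> real)"
    by (intro integrable_real_indicator assms) (simp add: N.emeasure_eq_measure)
  have prob: "N.prob A = integral\<^sup>L (\<sigma> \<Otimes>\<^sub>M \<eta>) (indicator A)"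
    using sets.sets_into_space[OF assms] by (simp add: Int_absorb2)
  have 1: "(\<integral>y. indicator A (x, y) \<partial>\<eta>) = \<eta>.prob {y. (x, y) \<in> A}" for x
  proof -
    have "(\<integral>y. indicator A (x, y) \<partial>\<eta>) = (\<integral>y. indicator {y. (x, y) \<in> A} y \<partial>\<eta> :: real)"
      by (intro Bochner_Integration.integral_cong) (auto simp: indicator_def)
    then show ?thesis by simp
  qed
  have 2: "(\<integral>x. indicator A (x, y) \<partial>\<sigma>) = \<sigma>.prob {x. (x, y) \<in> A}" for y
  proof -
    have "(\<integral>x. indicator A (x, y) \<partial>\<sigma>) = (\<integral>x. indicator {x. (x, y) \<in> A} x \<partial>\<sigma> :: real)"
      by (intro Bochner_Integration.integral_cong) (auto simp: indicator_def)
    then show ?thesis by simp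
  qed
  show "N.prob A = (\<integral>x. \<eta>.prob {y. (x, y) \<in> A} \<partial>\<sigma>)"
    unfolding prob N.integral_fst'[OF int, symmetric] 1 ..
  show "N.prob A = (\<integral>y. \<sigma>.prob {x. (x, y) \<in> A} \<partial>\<eta>)"
    unfolding prob 2[symmetric] using N.integral_snd[of "\<lambda>x y. indicator A (x, y) :: real"] int by simp
qed

lemma has_bochner_integral_powr_neg:
  "0 < a \<Longrightarrow> has_bochner_integral \<sigma> (\<lambda>x. x powr (- a)) (Gamma (a / \<beta>) / (\<beta> * Gamma a))"
  "0 < a \<Longrightarrow> has_bochner_integral \<eta> (\<lambda>x. x powr (- a)) (Gamma (a / \<gamma>) / (\<gamma> * Gamma a))"
  using \<sigma>.b_pos \<eta>.b_pos
  by (auto intro!: has_bochner_integral_nn_integral \<sigma>.nn_integral_powr_neg \<eta>.nn_integral_powr_neg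
      divide_nonneg_nonneg mult_nonneg_nonneg Gamma_real_nonneg)

text \<open>Large values come from the first component: its power of exponent
  \<open>\<beta> / \<gamma>\<close> turns tail index \<beta> into \<gamma>, with the same constant
  \<open>1 / Gamma (1 - \<beta>)\<close>. The factor \<open>1 / (4 * y)\<close> contributes its
  moment of order \<gamma>, that is \<open>4 powr (- \<gamma>)\<close> times the negative moment at
  \<open>a = \<gamma>\<close>, where \<open>Gamma (a / \<gamma>)\<close> is 1.\<close>

lemma T_upper_tail:
  defines "c \<equiv> 1 / Gamma (1 - \<beta>) * (4 powr (- \<gamma>) / (\<gamma> * Gamma \<gamma>))"
  shows "((\<lambda>x. x powr \<gamma> * N.prob {p \<in> space (\<sigma> \<Otimes>\<^sub>M \<eta>). x < T p}) \<longlongrightarrow> c) at_top"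
    and "\<exists>C. \<forall>x>0. x powr \<gamma> * N.prob {p \<in> space (\<sigma> \<Otimes>\<^sub>M \<eta>). x < T p} \<le> C"
proof -
  define F where "F v = \<sigma>.prob {w. v < w powr (\<beta> / \<gamma>)}" for v
  define Y where "Y y = 1 / (4 * y)" for y :: real
  note pos = \<sigma>.b_pos \<eta>.b_pos
  have [measurable]: "F \<in> borel_measurable borel"
    using \<sigma>.borel_measurable_upper_tail[of "\<lambda>w. w powr (\<beta> / \<gamma>)"] by (simp add: F_def[abs_def])
  have F_eq: "v powr \<gamma> * F v = (v powr (\<gamma> / \<beta>)) powr \<beta> * \<sigma>.prob {v powr (\<gamma> / \<beta>)<..}" if "0 < v" for v
  proof -
    have "F v = \<sigma>.prob {v powr (\<gamma> / \<beta>)<..}"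
      unfolding F_def
    proof (rule \<sigma>.finite_measure_eq_AE)
      show "AE w in \<sigma>. (w \<in> {w. v < w powr (\<beta> / \<gamma>)}) = (w \<in> {v powr (\<gamma> / \<beta>)<..})"
        using \<sigma>.AE_pos by eventually_elim (use powr_mult_less_iff(2)[of "\<beta> / \<gamma>" 1 _ v] pos that in simp)
    qed measurable
    then show ?thesis using pos that by (simp add: powr_powr)
  qed
  have "((\<lambda>v. (v powr (\<gamma> / \<beta>)) powr \<beta> * \<sigma>.prob {v powr (\<gamma> / \<beta>)<..}) \<longlongrightarrow> 1 / Gamma (1 - \<beta>)) at_top"
    using pos by (intro filterlim_compose[OF \<sigma>.tail_tendsto]) real_asymp
  moreover have "\<forall>\<^sub>F v in at_top. (v powr (\<gamma> / \<beta>)) powr \<beta> * \<sigma>.prob {v powr (\<gamma> / \<beta>)<..} = v powr \<gamma> * F v"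
    using eventually_gt_at_top[of 0] by eventually_elim (simp only: F_eq)
  ultimately have F_lim: "((\<lambda>v. v powr \<gamma> * F v) \<longlongrightarrow> 1 / Gamma (1 - \<beta>)) at_top"
    by (simp only: tendsto_cong)
  have F_bound: "\<bar>v powr \<gamma> * F v\<bar> \<le> 1 / (1 - exp (- 1))" if "0 < v" for v
  proof -
    have "(v powr (\<gamma> / \<beta>)) powr \<beta> * \<sigma>.prob {v powr (\<gamma> / \<beta>)<..}
      \<le> (v powr (\<gamma> / \<beta>)) powr \<beta> * ((v powr (\<gamma> / \<beta>)) powr (- \<beta>) / (1 - exp (- 1)))"
      using that by (intro mult_left_mono \<sigma>.tail_bound) auto
    also have "\<dots> = 1 / (1 - exp (- 1))" using that by (simp add: powr_minus)
    finally show ?thesis using F_eq[OF that] by (simp add: F_def)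
  qed
  have Y_pos: "AE y in \<eta>. 0 < Y y" using \<eta>.AE_pos by eventually_elim (simp add: Y_def)
  have [measurable]: "Y \<in> borel_measurable \<eta>" unfolding Y_def[abs_def] by measurable
  have "has_bochner_integral \<eta> (\<lambda>y. 4 powr (- \<gamma>) * y powr (- \<gamma>)) (4 powr (- \<gamma>) * (Gamma (\<gamma> / \<gamma>) / (\<gamma> * Gamma \<gamma>)))"
    using pos by (intro has_bochner_integral_mult_right has_bochner_integral_powr_neg)
  then have "has_bochner_integral \<eta> (\<lambda>y. Y y powr \<gamma>) (4 powr (- \<gamma>) * (Gamma (\<gamma> / \<gamma>) / (\<gamma> * Gamma \<gamma>)))"
  proof (subst has_bochner_integral_cong_AE)
    show "AE y in \<eta>. Y y powr \<gamma> = 4 powr (- \<gamma>) * y powr (- \<gamma>)"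
      using \<eta>.AE_pos by eventually_elim (simp add: Y_def powr_divide powr_mult powr_minus field_simps)
  qed measurable
  then have Y_int: "integrable \<eta> (\<lambda>y. Y y powr \<gamma>)" "(\<integral>y. Y y powr \<gamma> \<partial>\<eta>) = 4 powr (- \<gamma>) / (\<gamma> * Gamma \<gamma>)"
    using pos by (auto simp: has_bochner_integral_iff)
  have eq: "N.prob {p \<in> space (\<sigma> \<Otimes>\<^sub>M \<eta>). x < T p} = (\<integral>y. F (x / Y y) \<partial>\<eta>)" if "0 < x" for x
  proof -
    have [measurable]: "{p \<in> space (\<sigma> \<Otimes>\<^sub>M \<eta>). x < T p} \<in> sets (\<sigma> \<Otimes>\<^sub>M \<eta>)" by measurable
    have "AE y in \<eta>. \<sigma>.prob {w. (w, y) \<in> {p \<in> space (\<sigma> \<Otimes>\<^sub>M \<eta>). x < T p}} = F (x / Y y)"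
      using \<eta>.AE_pos
      by eventually_elim (auto simp: F_def Y_def T_def space_pair_measure field_simps intro!: arg_cong[of _ _ \<sigma>.prob])
    then show ?thesis
      unfolding prob_pair_eq(2)[OF \<open>_ \<in> sets (\<sigma> \<Otimes>\<^sub>M \<eta>)\<close>]
      by (rule integral_cong_AE[rotated 2]) measurable
  qed
  note tail = \<eta>.product_tail_limit[OF _ _ Y_pos F_lim F_bound Y_int(1), unfolded Y_int(2)]
  have "((\<lambda>x. x powr \<gamma> * (\<integral>y. F (x / Y y) \<partial>\<eta>)) \<longlongrightarrow> c) at_top"
    unfolding c_def by (rule tail(1)) measurable
  moreover have "\<forall>\<^sub>F x in at_top. x powr \<gamma> * (\<integral>y. F (x / Y y) \<partial>\<eta>) = x powr \<gamma> * N.prob {p \<in> space (\<sigma> \<Otimes>\<^sub>M \<eta>). x < T p}"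
    using eventually_gt_at_top[of 0] by eventually_elim (simp only: eq)
  ultimately show "((\<lambda>x. x powr \<gamma> * N.prob {p \<in> space (\<sigma> \<Otimes>\<^sub>M \<eta>). x < T p}) \<longlongrightarrow> c) at_top"
    by (simp only: tendsto_cong)
  show "\<exists>C. \<forall>x>0. x powr \<gamma> * N.prob {p \<in> space (\<sigma> \<Otimes>\<^sub>M \<eta>). x < T p} \<le> C"
    using tail(2) by (intro exI[of _ "1 / (1 - exp (- 1)) * (4 powr (- \<gamma>) / (\<gamma> * Gamma \<gamma>))"]) (simp add: eq)
qed

text \<open>Small values come from a large second component: \<open>T (w, y) < 1 / x\<close> means
  that \<open>y\<close> exceeds \<open>x / Y w\<close> with
  \<open>Y w = 4 * w powr (- (\<beta> / \<gamma>))\<close>. The roles are thus exchanged, and the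
  moment needed is that of \<open>w powr (- \<beta>)\<close> times
  \<open>4 powr \<gamma>\<close>.\<close>

lemma T_lower_tail:
  defines "c \<equiv> 1 / Gamma (1 - \<gamma>) * (4 powr \<gamma> / (\<beta> * Gamma \<beta>))"
  shows "((\<lambda>x. x powr \<gamma> * N.prob {p \<in> space (\<sigma> \<Otimes>\<^sub>M \<eta>). T p < 1 / x}) \<longlongrightarrow> c) at_top"
    and "\<exists>C. \<forall>x>0. x powr \<gamma> * N.prob {p \<in> space (\<sigma> \<Otimes>\<^sub>M \<eta>). T p < 1 / x} \<le> C"
proof -
  define F where "F v = \<eta>.prob {v<..}" for v
  define Y where "Y w = 4 * w powr (- (\<beta> / \<gamma>))" for w :: real
  note pos = \<sigma>.b_pos \<eta>.b_pos
  have [measurable]: "F \<in> borel_measurable borel"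
    using \<eta>.borel_measurable_upper_tail[of "\<lambda>w. w"] by (simp add: F_def[abs_def] greaterThan_def)
  have F_lim: "((\<lambda>v. v powr \<gamma> * F v) \<longlongrightarrow> 1 / Gamma (1 - \<gamma>)) at_top"
    unfolding F_def by (rule \<eta>.tail_tendsto)
  have F_bound: "\<bar>v powr \<gamma> * F v\<bar> \<le> 1 / (1 - exp (- 1))" if "0 < v" for v
  proof -
    have "v powr \<gamma> * F v \<le> v powr \<gamma> * (v powr (- \<gamma>) / (1 - exp (- 1)))"
      unfolding F_def using that by (intro mult_left_mono \<eta>.tail_bound) auto
    also have "\<dots> = 1 / (1 - exp (- 1))" using that by (simp add: powr_minus)
    finally show ?thesis by (simp add: F_def)
  qed
  have Y_pos: "AE w in \<sigma>. 0 < Y w" using \<sigma>.AE_pos by eventually_elim (simp add: Y_def)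
  have [measurable]: "Y \<in> borel_measurable \<sigma>" unfolding Y_def[abs_def] by measurable
  have "has_bochner_integral \<sigma> (\<lambda>w. 4 powr \<gamma> * w powr (- \<beta>)) (4 powr \<gamma> * (Gamma (\<beta> / \<beta>) / (\<beta> * Gamma \<beta>)))"
    using pos by (intro has_bochner_integral_mult_right has_bochner_integral_powr_neg)
  then have "has_bochner_integral \<sigma> (\<lambda>w. Y w powr \<gamma>) (4 powr \<gamma> * (Gamma (\<beta> / \<beta>) / (\<beta> * Gamma \<beta>)))"
  proof (subst has_bochner_integral_cong_AE)
    show "AE w in \<sigma>. Y w powr \<gamma> = 4 powr \<gamma> * w powr (- \<beta>)"
      using \<sigma>.AE_pos by eventually_elim (use pos in \<open>simp add: Y_def powr_mult powr_powr\<close>)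
  qed measurable
  then have Y_int: "integrable \<sigma> (\<lambda>w. Y w powr \<gamma>)" "(\<integral>w. Y w powr \<gamma> \<partial>\<sigma>) = 4 powr \<gamma> / (\<beta> * Gamma \<beta>)"
    using pos by (auto simp: has_bochner_integral_iff)
  have eq: "N.prob {p \<in> space (\<sigma> \<Otimes>\<^sub>M \<eta>). T p < 1 / x} = (\<integral>w. F (x / Y w) \<partial>\<sigma>)" if "0 < x" for x
  proof -
    have [measurable]: "{p \<in> space (\<sigma> \<Otimes>\<^sub>M \<eta>). T p < 1 / x} \<in> sets (\<sigma> \<Otimes>\<^sub>M \<eta>)" by measurable
    have "AE w in \<sigma>. \<eta>.prob {y. (w, y) \<in> {p \<in> space (\<sigma> \<Otimes>\<^sub>M \<eta>). T p < 1 / x}} = F (x / Y w)"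
      using \<sigma>.AE_pos
    proof eventually_elim
      case (elim w)
      show ?case
        unfolding F_def
      proof (rule \<eta>.finite_measure_eq_AE)
        show "AE y in \<eta>. (y \<in> {y. (w, y) \<in> {p \<in> space (\<sigma> \<Otimes>\<^sub>M \<eta>). T p < 1 / x}}) = (y \<in> {x / Y w<..})"
          using \<eta>.AE_pos
          by eventually_elim (use elim that in \<open>simp add: T_def Y_def space_pair_measure powr_minus field_simps\<close>)
        show "{y. (w, y) \<in> {p \<in> space (\<sigma> \<Otimes>\<^sub>M \<eta>). T p < 1 / x}} \<in> \<eta>.events"
          by (simp add: T_def space_pair_measure)
      qed simp
    qed
    then show ?thesis
      unfolding prob_pair_eq(1)[OF \<open>_ \<in> sets (\<sigma> \<Otimes>\<^sub>M \<eta>)\<close>]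
      by (rule integral_cong_AE[rotated 2]) measurable
  qed
  note tail = \<sigma>.product_tail_limit[OF _ _ Y_pos F_lim F_bound Y_int(1), unfolded Y_int(2)]
  have "((\<lambda>x. x powr \<gamma> * (\<integral>w. F (x / Y w) \<partial>\<sigma>)) \<longlongrightarrow> c) at_top"
    unfolding c_def by (rule tail(1)) measurable
  moreover have "\<forall>\<^sub>F x in at_top. x powr \<gamma> * (\<integral>w. F (x / Y w) \<partial>\<sigma>) = x powr \<gamma> * N.prob {p \<in> space (\<sigma> \<Otimes>\<^sub>M \<eta>). T p < 1 / x}"
    using eventually_gt_at_top[of 0] by eventually_elim (simp only: eq)
  ultimately show "((\<lambda>x. x powr \<gamma> * N.prob {p \<in> space (\<sigma> \<Otimes>\<^sub>M \<eta>). T p < 1 / x}) \<longlongrightarrow> c) at_top"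
    by (simp only: tendsto_cong)
  show "\<exists>C. \<forall>x>0. x powr \<gamma> * N.prob {p \<in> space (\<sigma> \<Otimes>\<^sub>M \<eta>). T p < 1 / x} \<le> C"
    using tail(2) by (intro exI[of _ "1 / (1 - exp (- 1)) * (4 powr \<gamma> / (\<beta> * Gamma \<beta>))"]) (simp add: eq)
qed

text \<open>By independence this is a positive moment of order \<open>a * \<beta> / \<gamma>\<close>
  of the first component times a negative moment of order \<open>a\<close> of the second. The
  condition \<open>a < \<gamma>\<close> says precisely that the first order stays below
  \<beta>.\<close>

lemma T_moment:
  assumes a: "0 < a" "a < \<gamma>"
  shows "has_bochner_integral (\<sigma> \<Otimes>\<^sub>M \<eta>) (\<lambda>p. T p powr a)
    (4 powr (- a) * (Gamma (1 - a / \<gamma>) / Gamma (1 - a * \<beta> / \<gamma>)) * (Gamma (a / \<gamma>) / (\<gamma> * Gamma a)))"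
proof (rule has_bochner_integral_nn_integral)
  note pos = \<sigma>.b_pos \<eta>.b_pos \<sigma>.b_less_1
  define k where "k = a * \<beta> / \<gamma>"
  have k: "0 < k" "k < \<beta>" "k / \<beta> = a / \<gamma>" using a pos by (auto simp: k_def divide_less_eq)
  then have k1: "k < 1" using pos by simp
  have meas: "(\<lambda>p. ennreal (fst p powr k) * ennreal (4 powr (- a) * snd p powr (- a))) \<in> borel_measurable (\<sigma> \<Otimes>\<^sub>M \<eta>)"
  proof -
    have "(\<lambda>p. ennreal (fst p powr k) * ennreal (4 powr (- a) * snd p powr (- a))) \<in> borel_measurable (borel \<Otimes>\<^sub>M borel)"
      by measurable
    then show ?thesis
      using measurable_cong_sets[OF sets_pair_measure_cong[OF \<sigma>.events_eq_borel \<eta>.events_eq_borel] refl] by blast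
  qed
  have "(\<integral>\<^sup>+p. ennreal (T p powr a) \<partial>(\<sigma> \<Otimes>\<^sub>M \<eta>))
    = (\<integral>\<^sup>+p. ennreal (fst p powr k) * ennreal (4 powr (- a) * snd p powr (- a)) \<partial>(\<sigma> \<Otimes>\<^sub>M \<eta>))"
  proof (rule nn_integral_cong_AE)
    show "AE p in \<sigma> \<Otimes>\<^sub>M \<eta>. ennreal (T p powr a) = ennreal (fst p powr k) * ennreal (4 powr (- a) * snd p powr (- a))"
      using AE_pair_pos
      by eventually_elim
         (auto simp: T_def k_def powr_divide powr_mult powr_powr powr_minus ennreal_mult[symmetric] field_simps)
  qed
  also have "\<dots> = (\<integral>\<^sup>+x. ennreal (x powr k) \<partial>\<sigma>) * (\<integral>\<^sup>+y. ennreal (4 powr (- a) * y powr (- a)) \<partial>\<eta>)"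
    using meas by (subst \<eta>.nn_integral_fst[symmetric]) (auto simp: nn_integral_cmult nn_integral_multc)
  also have "(\<integral>\<^sup>+y. ennreal (4 powr (- a) * y powr (- a)) \<partial>\<eta>) = ennreal (4 powr (- a)) * ennreal (Gamma (a / \<gamma>) / (\<gamma> * Gamma a))"
    using \<eta>.nn_integral_powr_neg[OF a(1)] by (simp add: ennreal_mult nn_integral_cmult)
  also have "\<dots> = ennreal (4 powr (- a) * (Gamma (a / \<gamma>) / (\<gamma> * Gamma a)))"
    by (rule ennreal_mult'[symmetric]) simp
  also have "(\<integral>\<^sup>+x. ennreal (x powr k) \<partial>\<sigma>) = ennreal (Gamma (1 - a / \<gamma>) / Gamma (1 - k))"
    using \<sigma>.nn_integral_powr_pos[OF k(1,2)] k(3) by simp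
  finally show "(\<integral>\<^sup>+p. ennreal (T p powr a) \<partial>(\<sigma> \<Otimes>\<^sub>M \<eta>))
    = ennreal (4 powr (- a) * (Gamma (1 - a / \<gamma>) / Gamma (1 - a * \<beta> / \<gamma>)) * (Gamma (a / \<gamma>) / (\<gamma> * Gamma a)))"
    using a pos k k1 unfolding k_def[symmetric] by (simp add: ennreal_mult[symmetric] Gamma_real_nonneg mult_ac)
  show "0 \<le> 4 powr (- a) * (Gamma (1 - a / \<gamma>) / Gamma (1 - a * \<beta> / \<gamma>)) * (Gamma (a / \<gamma>) / (\<gamma> * Gamma a))"
    using a pos k k1 by (auto simp: k_def[symmetric] intro!: mult_nonneg_nonneg divide_nonneg_nonneg Gamma_real_nonneg)
qed auto

end

section \<open>Asymptotics of the fundamental solution\<close>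

context stable_pair
begin

text \<open>Two mixtures are combined: the stable density at time s is a Gaussian with random time
  s^(1/\<gamma>) \<theta>, and s itself is distributed as \<open>(t / w) powr \<beta>\<close>.
  Everything then depends on the single variable \<open>T (w, \<theta>)\<close>, scaled by a power
  of the similarity quantity.\<close>

lemma fundamental_solution_eq_expectation:
  fixes M :: "'w measure" and X :: "real \<Rightarrow> 'w \<Rightarrow> 'a::euclidean_space" and x y :: 'a
  assumes M: "prob_space M" and X: "symmetric_stable_process M (2 * \<gamma>) X"
    and S: "stable_subordinator M \<beta> S" and \<sigma>_def: "\<sigma> = distr M borel (S 1)"
    and q: "transition_density M X q"
    and t: "0 < t" and xy: "x \<noteq> y"
  shows "fundamental_solution M S q t x y = norm (x - y) powr (- real DIM('a)) * pi powr (- (DIM('a) / 2)) *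
    N.expectation (\<lambda>p. gamma_kernel (DIM('a) / 2) ((norm (x - y) powr (- 2 * \<gamma> / \<beta>) * t) powr (- (\<beta> / \<gamma>)) * T p))"
proof -
  let ?m = "real DIM('a) / 2" and ?r = "norm (x - y)"
  let ?A = "?r powr (- 2 * \<gamma> / \<beta>) * t"
  note pos = \<sigma>.b_pos \<eta>.b_pos
  have m: "0 < ?m" by simp
  have r: "0 < ?r" using xy by simp
  \<comment> \<open>The absolute value makes the random variance nonnegative at every point, as the
    mixture lemma demands, and agrees with \<theta> almost surely.\<close>
  define H where "H s = (\<integral>\<theta>. heat_kernel (s powr (1 / \<gamma>) * \<bar>\<theta>\<bar>) (y - x) \<partial>\<eta>)" for s
  have [measurable]: "H \<in> borel_measurable borel"
    unfolding H_def[abs_def] heat_kernel_def by measurable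
  have q_eq: "q s x y = H s" if s: "0 < s" for s
    unfolding H_def
  proof (rule density_eq_gaussian_mixture[where X = "X s" and Q = "q s x"])
    show "X s \<in> borel_measurable M"
      using X s by (simp add: symmetric_stable_process_def levy_process_def)
    show "prob_space \<eta>" by (rule \<eta>.prob_space_axioms)
    show "AE \<theta> in \<eta>. 0 < s powr (1 / \<gamma>) * \<bar>\<theta>\<bar>"
      using \<eta>.AE_pos by eventually_elim (use s in simp)
    fix \<xi> :: 'a
    have "(\<integral>\<theta>. exp (- (s powr (1 / \<gamma>) * \<bar>\<theta>\<bar> * (norm \<xi>)\<^sup>2)) \<partial>\<eta>) = (\<integral>\<theta>. exp (- (s powr (1 / \<gamma>) * (norm \<xi>)\<^sup>2 * \<theta>)) \<partial>\<eta>)"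
      by (rule integral_cong_AE, measurable, use \<eta>.AE_pos in eventually_elim) (simp add: mult_ac)
    also have "\<dots> = exp (- ((s powr (1 / \<gamma>) * (norm \<xi>)\<^sup>2) powr \<gamma>))"
      by (rule \<eta>.laplace_nonneg) simp
    also have "(s powr (1 / \<gamma>) * (norm \<xi>)\<^sup>2) powr \<gamma> = s * norm \<xi> powr (2 * \<gamma>)"
    proof (cases "\<xi> = 0")
      case False
      then show ?thesis
        using s pos by (simp add: powr_mult powr_powr flip: powr_numeral)
    qed simp
    finally show "(CLINT \<omega>|M. iexp (\<xi> \<bullet> X s \<omega>)) = complex_of_real (\<integral>\<theta>. exp (- (s powr (1 / \<gamma>) * \<bar>\<theta>\<bar> * (norm \<xi>)\<^sup>2)) \<partial>\<eta>)"
      using X s by (simp add: symmetric_stable_process_def)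
  next
    have int: "integrable \<eta> (\<lambda>\<theta>. (s powr (1 / \<gamma>)) powr (- ?m) * \<theta> powr (- ?m))"
      using has_bochner_integral_powr_neg(2)[OF m] by (simp add: has_bochner_integral_iff)
    show "integrable \<eta> (\<lambda>\<theta>. (s powr (1 / \<gamma>) * \<bar>\<theta>\<bar>) powr (- ?m))"
    proof (rule integrable_cong_AE_imp[OF int])
      show "AE \<theta> in \<eta>. (s powr (1 / \<gamma>)) powr (- ?m) * \<theta> powr (- ?m) = (s powr (1 / \<gamma>) * \<bar>\<theta>\<bar>) powr (- ?m)"
        using \<eta>.AE_pos by eventually_elim (simp add: powr_mult)
    qed measurable
    show "distributed M lborel (\<lambda>\<omega>. x + X s \<omega>) (\<lambda>y. ennreal (q s x y))" "continuous_on UNIV (q s x)" "\<And>y. 0 \<le> q s x y"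
      using q s by (simp_all add: transition_density_def)
  qed (use M in simp_all)
  have bounded: "integrable (\<sigma> \<Otimes>\<^sub>M \<eta>) (\<lambda>p. gamma_kernel ?m (?A powr (- (\<beta> / \<gamma>)) * T p))"
  proof (rule N.integrable_const_bound[of _ "?m powr ?m"])
    show "AE p in \<sigma> \<Otimes>\<^sub>M \<eta>. norm (gamma_kernel ?m (?A powr (- (\<beta> / \<gamma>)) * T p)) \<le> ?m powr ?m"
      using AE_T_pos
    proof eventually_elim
      case (elim p)
      then have "0 \<le> ?A powr (- (\<beta> / \<gamma>)) * T p" by simp
      then show ?case using gamma_kernel_bounds[OF m] by simp
    qed
  qed measurable
  have "fundamental_solution M S q t x y = (LINT s|distr \<sigma> borel (\<lambda>w. (t / w) powr \<beta>). indicator {0<..} s *\<^sub>R q s x y)"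
    unfolding fundamental_solution_def set_lebesgue_integral_def \<sigma>_def
    by (subst distr_inverse_subordinator[OF M _ _ S t]) (use pos \<sigma>.b_less_1 in auto)
  also have "\<dots> = (LINT s|distr \<sigma> borel (\<lambda>w. (t / w) powr \<beta>). indicator {0<..} s * H s)"
    by (rule Bochner_Integration.integral_cong) (auto simp: q_eq indicator_def)
  also have "\<dots> = (\<integral>w. indicator {0<..} ((t / w) powr \<beta>) * H ((t / w) powr \<beta>) \<partial>\<sigma>)"
    by (subst integral_distr) auto
  also have "\<dots> = (\<integral>w. ?r powr (- real DIM('a)) * pi powr (- ?m) * (\<integral>\<theta>. gamma_kernel ?m (?A powr (- (\<beta> / \<gamma>)) * T (w, \<theta>)) \<partial>\<eta>) \<partial>\<sigma>)"
  proof (rule integral_cong_AE)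
    show "(\<lambda>w. ?r powr (- real DIM('a)) * pi powr (- ?m) * (\<integral>\<theta>. gamma_kernel ?m (?A powr (- (\<beta> / \<gamma>)) * T (w, \<theta>)) \<partial>\<eta>)) \<in> borel_measurable \<sigma>"
      using N.integrable_fst'[OF bounded] by (intro borel_measurable_times borel_measurable_const) (rule borel_measurable_integrable)
    show "AE w in \<sigma>. indicator {0<..} ((t / w) powr \<beta>) * H ((t / w) powr \<beta>)
      = ?r powr (- real DIM('a)) * pi powr (- ?m) * (\<integral>\<theta>. gamma_kernel ?m (?A powr (- (\<beta> / \<gamma>)) * T (w, \<theta>)) \<partial>\<eta>)"
      using \<sigma>.AE_pos
    proof eventually_elim
      case (elim w)
      have "H ((t / w) powr \<beta>) = (\<integral>\<theta>. ?r powr (- real DIM('a)) * pi powr (- ?m) * gamma_kernel ?m (?A powr (- (\<beta> / \<gamma>)) * T (w, \<theta>)) \<partial>\<eta>)"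
        unfolding H_def
      proof (rule integral_cong_AE)
        show "AE \<theta> in \<eta>. heat_kernel (((t / w) powr \<beta>) powr (1 / \<gamma>) * \<bar>\<theta>\<bar>) (y - x)
          = ?r powr (- real DIM('a)) * pi powr (- ?m) * gamma_kernel ?m (?A powr (- (\<beta> / \<gamma>)) * T (w, \<theta>))"
          using \<eta>.AE_pos
        proof eventually_elim
          case (elim \<theta>)
          \<comment> \<open>The exponent \<open>- 2 * \<gamma> / \<beta>\<close> in the similarity
            quantity is what makes its power \<open>- (\<beta> / \<gamma>)\<close> proportional to
            the squared distance, as in the Gaussian.\<close>
          have "?A powr (- (\<beta> / \<gamma>)) = ?r powr 2 * t powr (- (\<beta> / \<gamma>))"
            using r t pos by (simp add: powr_mult powr_powr)
          then have arg: "(norm (y - x))\<^sup>2 / (4 * (((t / w) powr \<beta>) powr (1 / \<gamma>) * \<bar>\<theta>\<bar>)) = ?A powr (- (\<beta> / \<gamma>)) * T (w, \<theta>)"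
            using r t elim \<open>0 < w\<close>
            by (simp add: T_def powr_powr powr_divide powr_minus norm_minus_commute field_simps)
          have "heat_kernel (((t / w) powr \<beta>) powr (1 / \<gamma>) * \<bar>\<theta>\<bar>) (y - x)
            = norm (y - x) powr (- real DIM('a)) * pi powr (- ?m) * gamma_kernel ?m ((norm (y - x))\<^sup>2 / (4 * (((t / w) powr \<beta>) powr (1 / \<gamma>) * \<bar>\<theta>\<bar>)))"
            by (rule heat_kernel_eq_gamma_kernel) (use xy t elim \<open>0 < w\<close> in auto)
          then show ?case unfolding arg by (simp only: norm_minus_commute[of y x])
        qed
        show "(\<lambda>\<theta>. ?r powr (- real DIM('a)) * pi powr (- ?m) * gamma_kernel ?m (?A powr (- (\<beta> / \<gamma>)) * T (w, \<theta>))) \<in> borel_measurable \<eta>"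
          unfolding T_def by simp
      qed (simp add: heat_kernel_def)
      then show ?case using elim t by simp
    qed
  qed measurable
  also have "\<dots> = ?r powr (- real DIM('a)) * pi powr (- ?m) * N.expectation (\<lambda>p. gamma_kernel ?m (?A powr (- (\<beta> / \<gamma>)) * T p))"
    using N.integral_fst'[OF bounded] by simp
  finally show ?thesis .
qed

text \<open>The scaling function: at m = n/2 the fundamental solution is \<open>\<Phi> m\<close> of
  the similarity quantity times |x - y|^(-n) \<pi>^(-n/2).\<close>

definition \<Phi> :: "real \<Rightarrow> real \<Rightarrow> real" where
  "\<Phi> m a = N.expectation (\<lambda>p. gamma_kernel m (a powr (- (\<beta> / \<gamma>)) * T p))"

lemma filterlim_powr_index_ratio: "filterlim (\<lambda>a. a powr (\<beta> / \<gamma>)) at_top at_top"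
  using \<sigma>.b_pos \<eta>.b_pos by real_asymp

text \<open>At m = n/2 the condition \<open>m < \<gamma>\<close> leaves only n = 1 with \<gamma> >
  1/2, where the stable process is recurrent. The limit is the moment of \<open>T\<close> of order
  \<open>m\<close>.\<close>

lemma \<Phi>_limit_recurrent:
  assumes m: "0 < m" "m < \<gamma>"
  shows "((\<lambda>a. \<Phi> m a / a powr (- (m * \<beta> / \<gamma>))) \<longlongrightarrow>
    4 powr (- m) * (Gamma (1 - m / \<gamma>) / Gamma (1 - m * \<beta> / \<gamma>)) * (Gamma (m / \<gamma>) / (\<gamma> * Gamma m))) at_top"
proof -
  note moment = T_moment[OF m, unfolded has_bochner_integral_iff]
  have "((\<lambda>a. (a powr (\<beta> / \<gamma>)) powr m * N.expectation (\<lambda>p. gamma_kernel m (1 / a powr (\<beta> / \<gamma>) * T p))) \<longlongrightarrow>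
    4 powr (- m) * (Gamma (1 - m / \<gamma>) / Gamma (1 - m * \<beta> / \<gamma>)) * (Gamma (m / \<gamma>) / (\<gamma> * Gamma m))) at_top"
    using N.gamma_kernel_small_argument_limit[OF m(1) borel_measurable_T AE_T_pos conjunct1[OF moment], unfolded conjunct2[OF moment]]
    by (rule filterlim_compose[OF _ filterlim_powr_index_ratio])
  then show ?thesis
    by (simp add: \<Phi>_def powr_powr powr_minus divide_inverse mult_ac)
qed

lemma \<Phi>_limit_transient:
  assumes m: "\<gamma> < m"
  shows "((\<lambda>a. \<Phi> m a / a powr (- \<beta>)) \<longlongrightarrow>
    1 / Gamma (1 - \<beta>) * (4 powr (- \<gamma>) / (\<gamma> * Gamma \<gamma>)) * \<gamma> * Gamma (m - \<gamma>)) at_top"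
proof -
  have m0: "0 < m" using m \<eta>.b_pos by simp
  obtain C where C: "\<And>x. 0 < x \<Longrightarrow> x powr \<gamma> * N.prob {p \<in> space (\<sigma> \<Otimes>\<^sub>M \<eta>). x < T p} \<le> C"
    using T_upper_tail(2) by blast
  have "((\<lambda>a. (a powr (\<beta> / \<gamma>)) powr \<gamma> * N.expectation (\<lambda>p. gamma_kernel m (1 / a powr (\<beta> / \<gamma>) * T p))) \<longlongrightarrow>
    1 / Gamma (1 - \<beta>) * (4 powr (- \<gamma>) / (\<gamma> * Gamma \<gamma>)) * \<gamma> * Gamma (m - \<gamma>)) at_top"
    using N.gamma_kernel_upper_tail_limit[OF m0 borel_measurable_T AE_T_pos m T_upper_tail(1) C]
    by (rule filterlim_compose[OF _ filterlim_powr_index_ratio])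
  then show ?thesis
    using \<eta>.b_pos by (simp add: \<Phi>_def powr_powr powr_minus divide_inverse mult_ac)
qed

lemma \<Phi>_limit_critical:
  "((\<lambda>a. \<Phi> \<gamma> a / (a powr (- \<beta>) * ln a)) \<longlongrightarrow>
    \<beta> * (1 / Gamma (1 - \<beta>) * (4 powr (- \<gamma>) / (\<gamma> * Gamma \<gamma>)))) at_top"
proof -
  note pos = \<sigma>.b_pos \<eta>.b_pos
  obtain C where C: "\<And>x. 0 < x \<Longrightarrow> x powr \<gamma> * N.prob {p \<in> space (\<sigma> \<Otimes>\<^sub>M \<eta>). x < T p} \<le> C"
    using T_upper_tail(2) by blast
  have "((\<lambda>a. (a powr (\<beta> / \<gamma>)) powr \<gamma> * N.expectation (\<lambda>p. gamma_kernel \<gamma> (1 / a powr (\<beta> / \<gamma>) * T p)) / ln (a powr (\<beta> / \<gamma>))) \<longlongrightarrow>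
    \<gamma> * (1 / Gamma (1 - \<beta>) * (4 powr (- \<gamma>) / (\<gamma> * Gamma \<gamma>)))) at_top"
    using N.gamma_kernel_upper_tail_log_limit[OF pos(2) borel_measurable_T AE_T_pos T_upper_tail(1) C]
    by (rule filterlim_compose[OF _ filterlim_powr_index_ratio])
  \<comment> \<open>The factor \<open>\<beta> / \<gamma>\<close> converts the logarithm of
    \<open>a powr (\<beta> / \<gamma>)\<close> into \<open>ln a\<close>.\<close>
  then have "((\<lambda>a. \<beta> / \<gamma> * ((a powr (\<beta> / \<gamma>)) powr \<gamma> * N.expectation (\<lambda>p. gamma_kernel \<gamma> (1 / a powr (\<beta> / \<gamma>) * T p)) / ln (a powr (\<beta> / \<gamma>)))) \<longlongrightarrow>
    \<beta> / \<gamma> * (\<gamma> * (1 / Gamma (1 - \<beta>) * (4 powr (- \<gamma>) / (\<gamma> * Gamma \<gamma>))))) at_top"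
    by (intro tendsto_intros)
  moreover have "\<forall>\<^sub>F a in at_top. \<beta> / \<gamma> * ((a powr (\<beta> / \<gamma>)) powr \<gamma> * N.expectation (\<lambda>p. gamma_kernel \<gamma> (1 / a powr (\<beta> / \<gamma>) * T p)) / ln (a powr (\<beta> / \<gamma>)))
    = \<Phi> \<gamma> a / (a powr (- \<beta>) * ln a)"
    using eventually_gt_at_top[of 1]
    by eventually_elim (use pos in \<open>simp add: \<Phi>_def powr_powr powr_minus ln_powr field_simps\<close>)
  ultimately show ?thesis
    using pos by (simp add: tendsto_cong mult_ac)
qed

lemma \<Phi>_limit_small:
  assumes m: "0 < m"
  shows "((\<lambda>a. \<Phi> m a / a powr \<beta>) \<longlongrightarrow>
    1 / Gamma (1 - \<gamma>) * (4 powr \<gamma> / (\<beta> * Gamma \<beta>)) * \<gamma> * Gamma (m + \<gamma>)) (at_right 0)"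
proof -
  note pos = \<sigma>.b_pos \<eta>.b_pos
  obtain C where C: "\<And>x. 0 < x \<Longrightarrow> x powr \<gamma> * N.prob {p \<in> space (\<sigma> \<Otimes>\<^sub>M \<eta>). T p < 1 / x} \<le> C"
    using T_lower_tail(2) by blast
  have "filterlim (\<lambda>a. a powr (- (\<beta> / \<gamma>))) at_top (at_right 0)" using pos by real_asymp
  from filterlim_compose[OF N.gamma_kernel_lower_tail_limit[OF m borel_measurable_T AE_T_pos pos(2) T_lower_tail(1) C] this]
  have "((\<lambda>a. (a powr (- (\<beta> / \<gamma>))) powr \<gamma> * N.expectation (\<lambda>p. gamma_kernel m (a powr (- (\<beta> / \<gamma>)) * T p))) \<longlongrightarrow>
    1 / Gamma (1 - \<gamma>) * (4 powr \<gamma> / (\<beta> * Gamma \<beta>)) * \<gamma> * Gamma (m + \<gamma>)) (at_right 0)" .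
  moreover have "(a powr (- (\<beta> / \<gamma>))) powr \<gamma> * N.expectation (\<lambda>p. gamma_kernel m (a powr (- (\<beta> / \<gamma>)) * T p)) = \<Phi> m a / a powr \<beta>" for a
  proof -
    have "(a powr (- (\<beta> / \<gamma>))) powr \<gamma> = a powr (- \<beta>)" unfolding powr_powr using pos by simp
    then show ?thesis by (simp add: \<Phi>_def powr_minus divide_inverse)
  qed
  ultimately show ?thesis by (simp only:)
qed

end

text \<open>A one-variable limit is pulled back along \<open>A\<close>. The prefactor
  \<open>h\<close> may vary freely with the point, since it multiplies both sides and asymptotic
  equivalence is multiplicative; \<open>c \<noteq> 0\<close> makes the limit an equivalence.\<close>

lemma asymp_equiv_along:
  fixes f g :: "real \<Rightarrow> real" and h P G A :: "real \<times> 'a \<times> 'a \<Rightarrow> real"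
  assumes lim: "((\<lambda>a. f a / g a) \<longlongrightarrow> c) F'" and c: "c \<noteq> 0"
    and A: "filterlim A F' (along A F)"
    and P: "\<And>t x y. 0 < t \<Longrightarrow> x \<noteq> y \<Longrightarrow> P (t, x, y) = h (t, x, y) * f (A (t, x, y))"
    and G: "\<And>t x y. 0 < t \<Longrightarrow> x \<noteq> y \<Longrightarrow> G (t, x, y) = h (t, x, y) * (c * g (A (t, x, y)))"
  shows "P \<sim>[along A F] G"
proof -
  have "((\<lambda>a. (f a / g a) / c) \<longlongrightarrow> c / c) F'" by (intro tendsto_intros lim c)
  then have "f \<sim>[F'] (\<lambda>a. c * g a)" using c by (intro asymp_equivI') (simp add: mult.commute)
  from asymp_equiv_compose'[OF this A]
  have "(\<lambda>z. h z * f (A z)) \<sim>[along A F] (\<lambda>z. h z * (c * g (A z)))"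
    by (intro asymp_equiv_mult asymp_equiv_refl)
  moreover have "\<forall>\<^sub>F z in along A F. P z = h z * f (A z)" "\<forall>\<^sub>F z in along A F. G z = h z * (c * g (A z))"
    unfolding along_def eventually_inf_principal
    by (auto intro!: always_eventually simp: P G)
  ultimately show ?thesis by (simp add: asymp_equiv_cong)
qed

lemma filterlim_along: "filterlim A F (along A F)"
  unfolding along_def by (rule filterlim_mono[OF filterlim_filtercomap]) auto

lemma filterlim_along_at_right:
  assumes "\<And>t x y. 0 < t \<Longrightarrow> x \<noteq> y \<Longrightarrow> 0 < A (t, x, y)"
  shows "filterlim A (at_right 0) (along A (nhds 0))"
proof -
  have "\<forall>\<^sub>F z in along A (nhds 0). 0 < A z"
    unfolding along_def eventually_inf_principal using assms by (auto intro!: always_eventually)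
  then show ?thesis
    using filterlim_along[of A "nhds 0"] by (simp add: filterlim_at eventually_mono)
qed

theorem corollary2p6:
  fixes M :: "'w measure"
    and X :: "real \<Rightarrow> 'w \<Rightarrow> real ^ 'n"
    and S :: "real \<Rightarrow> 'w \<Rightarrow> real"
    and q :: "real \<Rightarrow> real ^ 'n \<Rightarrow> real ^ 'n \<Rightarrow> real"
    and p :: "real \<Rightarrow> real ^ 'n \<Rightarrow> real ^ 'n \<Rightarrow> real"
    and A :: "real \<times> (real ^ 'n) \<times> (real ^ 'n) \<Rightarrow> real"
    and n \<beta> \<gamma> :: real
  defines "n \<equiv> real CARD('n)"
    and "A \<equiv> \<lambda>(t, x, y). norm (x - y) powr (- 2 * \<gamma> / \<beta>) * t"
    and "p \<equiv> fundamental_solution M S q"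
  assumes "0 < \<beta>" "\<beta> < 1" and "0 < \<gamma>" "\<gamma> < 1"
    and "prob_space M"
    and "symmetric_stable_process M (2 * \<gamma>) X"
    and "stable_subordinator M \<beta> S"
    and "independent_processes M X S"
    and "transition_density M X q"
  shows
    "(n = 1 \<and> 1 / 2 < \<gamma> \<longrightarrow>
        (\<lambda>(t, x, y). p t x y) \<sim>[along A at_top]
        (\<lambda>(t, x, y).
           Gamma (1 / (2 * \<gamma>)) * Gamma (1 - 1 / (2 * \<gamma>)) /
             (2 * pi * \<gamma> * Gamma (1 - \<beta> / (2 * \<gamma>))) * t powr (- \<beta> / (2 * \<gamma>))))
     \<and> (n = 1 \<and> \<gamma> = 1 / 2 \<longrightarrow>
        (\<lambda>(t, x, y). p t x y) \<sim>[along A at_top]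
        (\<lambda>(t, x, y).
           \<beta> / (pi * Gamma (1 - \<beta>)) * t powr (- \<beta>) * ln (norm (x - y) powr (- 1 / \<beta>) * t)))
     \<and> (n > 2 * \<gamma> \<longrightarrow>
        (\<lambda>(t, x, y). p t x y) \<sim>[along A at_top]
        (\<lambda>(t, x, y).
           2 * \<gamma> * Gamma ((n - 2 * \<gamma>) / 2) /
             (2 powr (1 + 2 * \<gamma>) * pi powr (n / 2) * Gamma (1 - \<beta>) * Gamma (1 + \<gamma>)) *
             norm (x - y) powr (2 * \<gamma> - n) * t powr (- \<beta>)))
     \<and> (\<lambda>(t, x, y). p t x y) \<sim>[along A (nhds 0)]
        (\<lambda>(t, x, y).
           \<gamma> * 4 powr \<gamma> * Gamma (n / 2 + \<gamma>) /
             (pi powr (n / 2) * Gamma (1 - \<gamma>) * \<beta> * Gamma \<beta>) *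
             norm (x - y) powr (- n - 2 * \<gamma>) * t powr \<beta>)"
proof -
  interpret M: prob_space M by fact
  \<comment> \<open>The second stable law comes from the existence theorem and enters only as a law,
    as the other factor of the product measure.\<close>
  obtain \<eta> where \<eta>: "one_sided_stable \<eta> \<gamma>"
    using one_sided_stable_exists[of \<gamma>] \<open>0 < \<gamma>\<close> \<open>\<gamma> < 1\<close> by blast
  define \<sigma> where "\<sigma> = distr M borel (S 1)"
  interpret stable_pair \<sigma> \<eta> \<beta> \<gamma>
    unfolding stable_pair_def \<sigma>_def
    using one_sided_stable_subordinator[OF \<open>prob_space M\<close> \<open>0 < \<beta>\<close> \<open>\<beta> < 1\<close> \<open>stable_subordinator M \<beta> S\<close>] \<eta> by blast
  define m where "m = n / 2"
  define h where "h = (\<lambda>(t :: real, x, y). norm (x - y :: real ^ 'n) powr (- n) * pi powr (- m))"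
  let ?p = "\<lambda>(t, x, y). p t x y"
  have n: "1 \<le> n" "0 < m" unfolding n_def m_def by (simp_all add: Suc_le_eq)
  have p_eq: "?p (t, x, y) = h (t, x, y) * \<Phi> m (A (t, x, y))" if "0 < t" "x \<noteq> y" for t x y
    using fundamental_solution_eq_expectation[OF \<open>prob_space M\<close> \<open>symmetric_stable_process M (2 * \<gamma>) X\<close>
        \<open>stable_subordinator M \<beta> S\<close> \<sigma>_def \<open>transition_density M X q\<close> that]
    by (simp add: p_def h_def \<Phi>_def A_def m_def n_def)
  have A_pos: "0 < A (t, x, y)" if "0 < t" "x \<noteq> y" for t x y
    using that by (simp add: A_def)
  have A_powr: "A (t, x, y) powr e = norm (x - y) powr (- 2 * \<gamma> / \<beta> * e) * t powr e" if "0 < t" "x \<noteq> y" for t x y e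
    using that by (simp add: A_def powr_mult powr_powr)
  have G_pos: "0 < Gamma \<beta>" "0 < Gamma \<gamma>" "0 < Gamma (1 - \<beta>)" "0 < Gamma (1 - \<gamma>)"
    using \<open>0 < \<beta>\<close> \<open>\<beta> < 1\<close> \<open>0 < \<gamma>\<close> \<open>\<gamma> < 1\<close> by (auto intro: Gamma_real_pos)
  have four_powr: "4 powr (- (1 / 2)) = (1 / 2 :: real)" by (simp add: powr_minus_divide powr_half_sqrt)
  have pi_powr: "pi powr (- (1 / 2)) = 1 / sqrt pi" by (simp add: powr_minus_divide powr_half_sqrt)
  have norm_split: "r powr (- n) * r powr e = r powr (e - n)" for r e :: real
    by (simp add: powr_add[symmetric])
  show ?thesis
  proof (intro conjI impI)
    assume "n = 1 \<and> 1 / 2 < \<gamma>"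
    then have n1: "n = 1" and m1: "m = 1 / 2" and g: "1 / 2 < \<gamma>" by (auto simp: m_def)
    have G: "0 < Gamma (1 - 1 / (2 * \<gamma>))" "0 < Gamma (1 - \<beta> / (2 * \<gamma>))" "0 < Gamma (1 / (2 * \<gamma>))"
      using g \<open>\<beta> < 1\<close> by (auto intro!: Gamma_real_pos simp: divide_less_eq)
    show "?p \<sim>[along A at_top] (\<lambda>(t, x, y). Gamma (1 / (2 * \<gamma>)) * Gamma (1 - 1 / (2 * \<gamma>)) /
             (2 * pi * \<gamma> * Gamma (1 - \<beta> / (2 * \<gamma>))) * t powr (- \<beta> / (2 * \<gamma>)))"
    proof (rule asymp_equiv_along[where f = "\<Phi> m" and h = h and A = A, OF \<Phi>_limit_recurrent[OF n(2)] _ filterlim_along p_eq])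
      fix t :: real and x y :: "real ^ 'n"
      assume txy: "0 < t" "x \<noteq> y"
      \<comment> \<open>At \<open>m = 1 / 2\<close> this power contributes exactly one factor
        \<open>norm (x - y)\<close>, which cancels the prefactor
        \<open>norm (x - y) powr (- 1)\<close>: the leading term does not depend on the distance.
        The product of \<open>Gamma (1 / 2)\<close> and the root in the prefactor gives
        \<open>pi\<close>.\<close>
      have "A (t, x, y) powr (- (m * \<beta> / \<gamma>)) = norm (x - y) powr 1 * t powr (- \<beta> / (2 * \<gamma>))"
        unfolding A_powr[OF txy] m1 using \<open>0 < \<beta>\<close> \<open>0 < \<gamma>\<close> by simp
      moreover have cancel: "g3 * g1 / (2 * (s * s) * c * g2) * u = (1 / r) * (1 / s) * (1 / 2 * (g1 / g2) * (g3 / (c * s)) * (r * u))"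
        if "s \<noteq> 0" "r \<noteq> 0" for s r c g1 g2 g3 u :: real
        using that by (simp add: mult_ac)
      moreover note cancel[of "sqrt pi" "norm (x - y)" "Gamma (1 / (2 * \<gamma>))" "Gamma (1 - 1 / (2 * \<gamma>))" \<gamma>]
      ultimately show "(case (t, x, y) of (t, x, y) \<Rightarrow> Gamma (1 / (2 * \<gamma>)) * Gamma (1 - 1 / (2 * \<gamma>)) /
             (2 * pi * \<gamma> * Gamma (1 - \<beta> / (2 * \<gamma>))) * t powr (- \<beta> / (2 * \<gamma>)))
        = h (t, x, y) * (4 powr - m * (Gamma (1 - m / \<gamma>) / Gamma (1 - m * \<beta> / \<gamma>)) * (Gamma (m / \<gamma>) / (\<gamma> * Gamma m)) * A (t, x, y) powr - (m * \<beta> / \<gamma>))"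
        using txy by (simp add: h_def m1 n1 Gamma_one_half_real four_powr pi_powr powr_minus_divide[of "norm (x - y)" 1])
    qed (use g G[THEN less_imp_neq, THEN not_sym] in \<open>simp_all add: m1 Gamma_one_half_real\<close>)
  next
    assume "n = 1 \<and> \<gamma> = 1 / 2"
    then have n1: "n = 1" and g: "\<gamma> = 1 / 2" and m1: "m = \<gamma>" by (auto simp: m_def)
    show "?p \<sim>[along A at_top] (\<lambda>(t, x, y). \<beta> / (pi * Gamma (1 - \<beta>)) * t powr (- \<beta>) * ln (norm (x - y) powr (- 1 / \<beta>) * t))"
    proof (rule asymp_equiv_along[where f = "\<Phi> \<gamma>" and h = h and A = A, OF \<Phi>_limit_critical _ filterlim_along p_eq[unfolded m1]])
      fix t :: real and x y :: "real ^ 'n"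
      assume txy: "0 < t" "x \<noteq> y"
      have "A (t, x, y) powr (- \<beta>) = norm (x - y) powr 1 * t powr (- \<beta>)"
        unfolding A_powr[OF txy] g using \<open>0 < \<beta>\<close> by simp
      moreover have "sqrt pi * (u * sqrt pi) = pi * u" for u
      proof -
        have "sqrt pi * (u * sqrt pi) = (sqrt pi * sqrt pi) * u" by (simp only: mult_ac)
        then show ?thesis by simp
      qed
      \<comment> \<open>At \<open>\<gamma> = 1 / 2\<close> the argument of the logarithm is the
        similarity quantity itself.\<close>
      moreover have "A (t, x, y) = norm (x - y) powr (- 1 / \<beta>) * t" by (simp add: A_def g)
      ultimately show "(case (t, x, y) of (t, x, y) \<Rightarrow> \<beta> / (pi * Gamma (1 - \<beta>)) * t powr (- \<beta>) * ln (norm (x - y) powr (- 1 / \<beta>) * t))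
        = h (t, x, y) * (\<beta> * (1 / Gamma (1 - \<beta>) * (4 powr - \<gamma> / (\<gamma> * Gamma \<gamma>))) * (A (t, x, y) powr - \<beta> * ln (A (t, x, y))))"
        using txy by (simp add: h_def m1 n1 g Gamma_one_half_real mult.assoc four_powr pi_powr powr_minus_divide[of "norm (x - y)" 1])
    qed (use \<open>0 < \<beta>\<close> \<open>0 < \<gamma>\<close> G_pos[THEN less_imp_neq, THEN not_sym] in auto)
  next
    assume "n > 2 * \<gamma>"
    then have g: "\<gamma> < m" by (simp add: m_def)
    then have G: "0 < Gamma (m - \<gamma>)" by (intro Gamma_real_pos) simp
    \<comment> \<open>The stated constant is in terms of \<open>Gamma (1 + \<gamma>)\<close> and
      \<open>2 powr (1 + 2 * \<gamma>)\<close>, the limit in terms of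
      \<open>\<gamma> * Gamma \<gamma>\<close> and \<open>4 powr \<gamma>\<close>; the surplus 2
      cancels the one in the numerator.\<close>
    have G1: "Gamma (1 + \<gamma>) = \<gamma> * Gamma \<gamma>"
      unfolding add.commute[of 1] by (rule Gamma_plus1) (use \<open>0 < \<gamma>\<close> in \<open>auto dest!: nonpos_Ints_nonpos\<close>)
    have two: "2 powr (1 + 2 * \<gamma>) = 2 * 4 powr \<gamma>"
      using powr_powr[of 2 2 \<gamma>] by (simp add: powr_add)
    show "?p \<sim>[along A at_top] (\<lambda>(t, x, y). 2 * \<gamma> * Gamma ((n - 2 * \<gamma>) / 2) /
             (2 powr (1 + 2 * \<gamma>) * pi powr (n / 2) * Gamma (1 - \<beta>) * Gamma (1 + \<gamma>)) *
             norm (x - y) powr (2 * \<gamma> - n) * t powr (- \<beta>))"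
    proof (rule asymp_equiv_along[where f = "\<Phi> m" and h = h and A = A, OF \<Phi>_limit_transient[OF g] _ filterlim_along p_eq])
      fix t :: real and x y :: "real ^ 'n"
      assume txy: "0 < t" "x \<noteq> y"
      have 1: "A (t, x, y) powr (- \<beta>) = norm (x - y) powr (2 * \<gamma>) * t powr (- \<beta>)"
        unfolding A_powr[OF txy] using \<open>0 < \<beta>\<close> by simp
      have 2: "(n - 2 * \<gamma>) / 2 = m - \<gamma>" by (simp add: m_def field_simps)
      have 3: "norm (x - y) powr (2 * \<gamma> - n) = norm (x - y) powr (- n) * norm (x - y) powr (2 * \<gamma>)"
        by (rule norm_split[symmetric])
      show "(case (t, x, y) of (t, x, y) \<Rightarrow> 2 * \<gamma> * Gamma ((n - 2 * \<gamma>) / 2) /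
             (2 powr (1 + 2 * \<gamma>) * pi powr (n / 2) * Gamma (1 - \<beta>) * Gamma (1 + \<gamma>)) *
             norm (x - y) powr (2 * \<gamma> - n) * t powr (- \<beta>))
        = h (t, x, y) * (1 / Gamma (1 - \<beta>) * (4 powr - \<gamma> / (\<gamma> * Gamma \<gamma>)) * \<gamma> * Gamma (m - \<gamma>) * A (t, x, y) powr - \<beta>)"
        unfolding 1 2 3 G1 two m_def[symmetric] h_def prod.case using \<open>0 < \<gamma>\<close>
        by (simp add: powr_minus_divide[of pi m] powr_minus_divide[of 4 \<gamma>] mult_ac)
    qed (use \<open>0 < \<gamma>\<close> G[THEN less_imp_neq, THEN not_sym] G_pos[THEN less_imp_neq, THEN not_sym] in auto)
  next
    have G: "0 < Gamma (m + \<gamma>)" using n(2) \<open>0 < \<gamma>\<close> by (intro Gamma_real_pos) simp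
    show "?p \<sim>[along A (nhds 0)] (\<lambda>(t, x, y). \<gamma> * 4 powr \<gamma> * Gamma (n / 2 + \<gamma>) /
             (pi powr (n / 2) * Gamma (1 - \<gamma>) * \<beta> * Gamma \<beta>) *
             norm (x - y) powr (- n - 2 * \<gamma>) * t powr \<beta>)"
    proof (rule asymp_equiv_along[where f = "\<Phi> m" and h = h and A = A, OF \<Phi>_limit_small[OF n(2)] _ filterlim_along_at_right[of A, OF A_pos] p_eq])
      fix t :: real and x y :: "real ^ 'n"
      assume txy: "0 < t" "x \<noteq> y"
      have "A (t, x, y) powr \<beta> = norm (x - y) powr (- 2 * \<gamma>) * t powr \<beta>"
        unfolding A_powr[OF txy] using \<open>0 < \<beta>\<close> by simp
      moreover have "norm (x - y) powr (- n - 2 * \<gamma>) = norm (x - y) powr (- n) * norm (x - y) powr (- 2 * \<gamma>)"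
        unfolding norm_split by (rule arg_cong[of _ _ "(powr) (norm (x - y))"]) simp
      ultimately show "(case (t, x, y) of (t, x, y) \<Rightarrow> \<gamma> * 4 powr \<gamma> * Gamma (n / 2 + \<gamma>) /
             (pi powr (n / 2) * Gamma (1 - \<gamma>) * \<beta> * Gamma \<beta>) *
             norm (x - y) powr (- n - 2 * \<gamma>) * t powr \<beta>)
        = h (t, x, y) * (1 / Gamma (1 - \<gamma>) * (4 powr \<gamma> / (\<beta> * Gamma \<beta>)) * \<gamma> * Gamma (m + \<gamma>) * A (t, x, y) powr \<beta>)"
        by (simp add: h_def m_def[symmetric] powr_minus_divide[of pi m] mult_ac)
    qed (use \<open>0 < \<beta>\<close> \<open>0 < \<gamma>\<close> G[THEN less_imp_neq, THEN not_sym] G_pos[THEN less_imp_neq, THEN not_sym] in auto)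
  qed
qed

end
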